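(* Assume (A) (stated in the context), with ellipticity constant $\lambda>0$. Let $\alpha\in(0,\infty)$, $f\in L^1(U)$ and $F\in L^2(U,\mathbb{R}^d)$. For each $n\ge1$, let $A_n=(a^n_{ij})_{1\le i,j\le d}$ be a matrix of functions in $L^\infty(U)$ such that $\langle A_n(x)\xi,\xi\rangle\ge\lambda\|\xi\|^2$ for any $x\in U$ and $\xi\in\mathbb{R}^d$ (with the same $\lambda$). For each $n\ge1$, let $B_n\in L^2(U,\mathbb{R}^d)$, $c_n\in L^{2_*}(U)$, $f_n\in L^1(U)$ and $F_n\in L^2(U,\mathbb{R}^d)$, and let $u_n$ be a weak solution to $$-\mathrm{div}(A_n\nabla u_n)+\langle B_n,\nabla u_n\rangle+(c_n+\alpha)u_n=f_n-\mathrm{div}F_n\ \text{ in }U,\qquad u_n=0\ \text{ on }\partial U.$$ Let $u$ be a weak solution to $$-\mathrm{div}(A\nabla u)+\langle B,\nabla u\rangle+(c+\alpha)u=f-\mathrm{div}F\ \text{ in }U,\qquad u=0\ \text{ on }\partial U.$$ Then the following estimate holds: $$\|u_n-u\|_{L^1(U)}\le\alpha^{-1}C_4\Big(\|B-B_n\|_{L^2(U)}+N\|c-c_n\|_{L^{2_*}(U)}\Big)+C_3\|(A_n-A)\nabla u\|_{L^2(U)}+\alpha^{-1}\|f-f_n\|_{L^1(U)}+C_3\|F-F_n\|_{L^2(U)},$$ where $C_4=C_1\big(\|f\|_{L^{2_*}(U)}+\|F\|_{L^2(U)}\big)$, $C_3=|U|^{1/2}C_1$, $N=\frac{2(d-1)}{d-2}$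 if $d\ge3$ and $N=\frac{2^*}{2}|U|^{\frac{1}{2^*}}$ with $2^*:=\frac{2_*}{2_*-1}$ if $d=2$, and $C_1>0$ is the energy constant described in the context. In particular, if for some $M>0$, $\max_{1\le i,j\le d}\|a^n_{ij}\|_{L^\infty(U)}\le M$ for all $n\ge1$ and $\lim_{n\to\infty}a^n_{ij}=a_{ij}$ a.e. for each $1\le i,j\le d$, $\lim_{n\to\infty}B_n=B$ and $\lim_{n\to\infty}F_n=F$ in $L^2(U,\mathbb{R}^d)$, $\lim_{n\to\infty}c_n=c$ in $L^{2_*}(U)$ and $\lim_{n\to\infty}f_n=f$ in $L^1(U)$, then $\lim_{n\to\infty}u_n=u$ in $L^1(U)$.
   Context: $\langle\cdot,\cdot\rangle$ and $\|\cdot\|$ are the Euclidean inner product and norm on $\mathbb{R}^d$; $dx$ is Lebesgue measure and $|U|$ is the Lebesgue measure of $U$; $L^p(U,\mathbb{R}^d)$ is the space of $L^p$ vector fields, with $\|F\|_{L^p(U)}:=\big\|\,\|F\|\,\big\|_{L^p(U)}$. $H^{1,2}(U)$ is the Sobolev space with norm $\big(\|f\|_{L^2(U)}^2+\sum_{i=1}^d\|\partial_i f\|_{L^2(U)}^2\big)^{1/2}$, and $H^{1,2}_0(U)$ is the closure of $C_0^\infty(U)$ (smooth functions compactly supported in $U$) in it, with the same norm. Exponent: $2_*:=\frac{2d}{d+2}$ if $d\ge3$; if $d=2$, $2_*\in(1,2)$ is arbitrary but fixed. Assumption (A): $U$ is a bounded open subset of $\mathbb{R}^d$ with $d\ge2$.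 $A=(a_{ij})_{1\le i,j\le d}$ is a $d\times d$ (possibly non-symmetric) matrix of functions in $L^\infty(U)$ such that for some constants $\lambda,\Lambda>0$, $\langle A(x)\xi,\xi\rangle\ge\lambda\|\xi\|^2$ and $\max_{1\le i,j\le d}|a_{ij}(x)|\le\Lambda$ for all $x\in U$ and $\xi\in\mathbb{R}^d$. $B\in L^2(U,\mathbb{R}^d)$ satisfies $\mathrm{div}B\le0$ weakly in $U$, i.e. $\int_U\langle B,\nabla\varphi\rangle dx\ge0$ for all $\varphi\in C_0^\infty(U)$ with $\varphi\ge0$. $\alpha\in[0,\infty)$, and $c\in L^{2_*}(U)$ with $c\ge0$. Weak solution: $u$ is a weak solution to $-\mathrm{div}(A\nabla u)+\langle B,\nabla u\rangle+(c+\alpha)u=f-\mathrm{div}F$ in $U$, $u=0$ on $\partial U$, if $u\in H^{1,2}_0(U)$ satisfies for any $\varphi\in C_0^\infty(U)$ $$\int_U\langle A\nabla u,\nabla\varphi\rangle+\big(\langle B,\nabla u\rangle+(c+\alpha)u\big)\varphi\,dx=\int_Uf\varphi+\langle F,\nabla\varphi\rangle\,dx,$$ where both integrals are well defined in $\mathbb{R}$; similarly for $u_n$ with $A_n,B_n,c_n,f_n,F_n$ in place of $A,B,c,f,F$. Energy constant: $C_1>0$ is the constant, depending only on $\lambda$, $d$ and $|U|$, in the following existence and uniqueness result: under (A), for $\tilde f\in L^{2_*}(U)$ and $\tilde F\in L^2(U,\mathbb{R}^d)$, the unique weak solution $\tilde u$ to $-\mathrm{div}(A\nabla \tilde u)+\langle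 B,\nabla \tilde u\rangle+(c+\alpha)\tilde u=\tilde f-\mathrm{div}\tilde F$ in $U$, $\tilde u=0$ on $\partial U$, satisfies $\|\tilde u\|_{H^{1,2}_0(U)}\le C_1\big(\|\tilde f\|_{L^{2_*}(U)}+\|\tilde F\|_{L^2(U)}\big)$.
   Formalization: The formal theorem also assumes, for each n≥1, that div B_n ≤ 0 weakly in U and c_n ≥ 0 a.e.; without these the estimate is false (e.g. zero data, u=0, B_n=0, c_n = −α−μ_1 with μ_1 the first Dirichlet eigenvalue, u_n an eigenfunction). *)

theory Defs
  imports "HOL-Probability.Essential_Supremum"
begin

section \<open>Lebesgue spaces\<close>

text \<open>
  Norms take values in \<^typ>\<open>ennreal\<close>: the \<open>L\<^sup>p\<close> norm is \<open>\<infinity>\<close> for measurable functions outside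
  \<open>L\<^sup>p\<close>, and products follow the convention \<open>0 * \<infinity> = 0\<close> of \<^typ>\<open>ennreal\<close>.
  Functions live on the whole space, but only their values on \<open>U\<close> matter.
\<close>

text \<open>\<open>epowr x a\<close> is \<open>x\<^sup>a\<close> for \<open>a > 0\<close>, with \<open>\<infinity>\<^sup>a = \<infinity>\<close>.\<close>

definition epowr :: "ennreal \<Rightarrow> real \<Rightarrow> ennreal" where
  "epowr x a = (if x = \<infinity> then \<infinity> else ennreal (enn2real x powr a))"

definition Lp_norm :: "real \<Rightarrow> 'a::euclidean_space set \<Rightarrow> ('a \<Rightarrow> 'b::real_normed_vector) \<Rightarrow> ennreal" where
  "Lp_norm p U f = epowr (\<integral>\<^sup>+ x. ennreal (norm (f x) powr p) \<partial>lebesgue_on U) (1 / p)"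

definition in_Lp :: "real \<Rightarrow> 'a::euclidean_space set \<Rightarrow> ('a \<Rightarrow> 'b::real_normed_vector) \<Rightarrow> bool" where
  "in_Lp p U f \<longleftrightarrow> f \<in> borel_measurable (lebesgue_on U) \<and> Lp_norm p U f < \<infinity>"

definition Linf_norm :: "'a::euclidean_space set \<Rightarrow> ('a \<Rightarrow> 'b::real_normed_vector) \<Rightarrow> ennreal" where
  "Linf_norm U f = esssup (lebesgue_on U) (\<lambda>x. ennreal (norm (f x)))"

definition in_Linf :: "'a::euclidean_space set \<Rightarrow> ('a \<Rightarrow> 'b::real_normed_vector) \<Rightarrow> bool" where
  "in_Linf U f \<longleftrightarrow> f \<in> borel_measurable (lebesgue_on U) \<and> Linf_norm U f < \<infinity>"


section \<open>Test functions\<close>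

definition partial :: "'d::finite \<Rightarrow> (real^'d \<Rightarrow> real) \<Rightarrow> real^'d \<Rightarrow> real" where
  "partial i f x = frechet_derivative f (at x) (axis i 1)"

definition grad :: "(real^'d::finite \<Rightarrow> real) \<Rightarrow> real^'d \<Rightarrow> real^'d" where
  "grad f x = (\<chi> i. partial i f x)"

text \<open>
  A function is \<open>C\<^sup>\<infinity>\<close> iff all its iterated partial derivatives, of every order including \<open>0\<close>,
  are (Frechet) differentiable everywhere.
\<close>

definition smooth :: "(real^'d::finite \<Rightarrow> real) \<Rightarrow> bool" where
  "smooth f \<longleftrightarrow> (\<forall>is x. foldr partial is f differentiable at x)"

text \<open>\<open>C\<^sub>0\<^sup>\<infinity>(U)\<close>; its elements are extended by \<open>0\<close> outside \<open>U\<close>.\<close>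

definition test_function :: "(real^'d::finite) set \<Rightarrow> (real^'d \<Rightarrow> real) \<Rightarrow> bool" where
  "test_function U \<phi> \<longleftrightarrow>
     smooth \<phi> \<and> compact (closure {x. \<phi> x \<noteq> 0}) \<and> closure {x. \<phi> x \<noteq> 0} \<subseteq> U"


section \<open>Sobolev spaces\<close>

definition has_weak_gradient ::
    "(real^'d::finite) set \<Rightarrow> (real^'d \<Rightarrow> real) \<Rightarrow> (real^'d \<Rightarrow> real^'d) \<Rightarrow> bool" where
  "has_weak_gradient U f g \<longleftrightarrow>
     (\<forall>K. compact K \<and> K \<subseteq> U \<longrightarrow> f absolutely_integrable_on K \<and> g absolutely_integrable_on K) \<and>
     (\<forall>\<phi> i. test_function U \<phi> \<longrightarrow>
        (\<integral>x. f x * partial i \<phi> x \<partial>lebesgue_on U) = - (\<integral>x. g x $ i * \<phi> x \<partial>lebesgue_on U))"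

text \<open>
  On an open set weak gradients are unique up to null sets; \<open>weak_grad U f\<close> is a chosen
  representative, meaningful only if \<open>f\<close> has a weak gradient.
\<close>

definition weak_grad :: "(real^'d::finite) set \<Rightarrow> (real^'d \<Rightarrow> real) \<Rightarrow> real^'d \<Rightarrow> real^'d" where
  "weak_grad U f = (SOME g. has_weak_gradient U f g)"

definition H12 :: "(real^'d::finite) set \<Rightarrow> (real^'d \<Rightarrow> real) set" where
  "H12 U = {f. in_Lp 2 U f \<and> (\<exists>g. has_weak_gradient U f g) \<and> in_Lp 2 U (weak_grad U f)}"

definition H12_norm :: "(real^'d::finite) set \<Rightarrow> (real^'d \<Rightarrow> real) \<Rightarrow> ennreal" where
  "H12_norm U f =
     epowr ((Lp_norm 2 U f)^2 + (\<Sum>i\<in>UNIV. (Lp_norm 2 U (\<lambda>x. weak_grad U f x $ i))^2)) (1/2)"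

definition H12_0 :: "(real^'d::finite) set \<Rightarrow> (real^'d \<Rightarrow> real) set" where
  "H12_0 U = {f \<in> H12 U.
     \<forall>\<epsilon>>0. \<exists>\<phi>. test_function U \<phi> \<and> H12_norm U (\<lambda>x. f x - \<phi> x) < ennreal \<epsilon>}"


section \<open>The boundary value problem\<close>

text \<open>\<open>lower_exponent d p\<close> says that \<open>p\<close> is an admissible value of \<open>2\<^sub>*\<close> in dimension \<open>d \<ge> 2\<close>.\<close>

definition lower_exponent :: "nat \<Rightarrow> real \<Rightarrow> bool" where
  "lower_exponent d p \<longleftrightarrow> (if d = 2 then 1 < p \<and> p < 2 else p = 2 * real d / (real d + 2))"

definition elliptic :: "real \<Rightarrow> (real^'d::finite) set \<Rightarrow> (real^'d \<Rightarrow> real^'d^'d) \<Rightarrow> bool" where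
  "elliptic lam U A \<longleftrightarrow> (\<forall>x\<in>U. \<forall>\<xi>. (A x *v \<xi>) \<bullet> \<xi> \<ge> lam * (norm \<xi>)^2)"

definition weak_div_nonpos :: "(real^'d::finite) set \<Rightarrow> (real^'d \<Rightarrow> real^'d) \<Rightarrow> bool" where
  "weak_div_nonpos U B \<longleftrightarrow>
     (\<forall>\<phi>. test_function U \<phi> \<and> (\<forall>x. \<phi> x \<ge> 0) \<longrightarrow> (\<integral>x. B x \<bullet> grad \<phi> x \<partial>lebesgue_on U) \<ge> 0)"

text \<open>Assumption (A), where \<open>p\<close> is the exponent \<open>2\<^sub>*\<close> and \<open>lam\<close> the ellipticity constant.\<close>

definition assumption_A ::
    "real \<Rightarrow> real \<Rightarrow> (real^'d::finite) set \<Rightarrow> (real^'d \<Rightarrow> real^'d^'d) \<Rightarrow> (real^'d \<Rightarrow> real^'d)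
     \<Rightarrow> (real^'d \<Rightarrow> real) \<Rightarrow> real \<Rightarrow> bool" where
  "assumption_A p lam U A B c \<alpha> \<longleftrightarrow>
     CARD('d) \<ge> 2 \<and> open U \<and> bounded U \<and>
     lam > 0 \<and> elliptic lam U A \<and>
     (\<forall>i j. in_Linf U (\<lambda>x. A x $ i $ j)) \<and>
     (\<exists>Lam>0. \<forall>x\<in>U. \<forall>i j. \<bar>A x $ i $ j\<bar> \<le> Lam) \<and>
     in_Lp 2 U B \<and> weak_div_nonpos U B \<and>
     \<alpha> \<ge> 0 \<and>
     in_Lp p U c \<and> (AE x in lebesgue_on U. c x \<ge> 0)"

text \<open>
  \<open>u\<close> is a weak solution to
  \<open>- div (A \<nabla>u) + \<langle>B, \<nabla>u\<rangle> + (c + \<alpha>) u = f - div F\<close> in \<open>U\<close>, \<open>u = 0\<close> on the boundary of \<open>U\<close>.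
\<close>

definition weak_solution ::
    "(real^'d::finite) set \<Rightarrow> (real^'d \<Rightarrow> real^'d^'d) \<Rightarrow> (real^'d \<Rightarrow> real^'d) \<Rightarrow> (real^'d \<Rightarrow> real)
     \<Rightarrow> real \<Rightarrow> (real^'d \<Rightarrow> real) \<Rightarrow> (real^'d \<Rightarrow> real^'d) \<Rightarrow> (real^'d \<Rightarrow> real) \<Rightarrow> bool" where
  "weak_solution U A B c \<alpha> f F u \<longleftrightarrow>
     u \<in> H12_0 U \<and>
     (\<forall>\<phi>. test_function U \<phi> \<longrightarrow>
        (let lhs = (\<lambda>x. (A x *v weak_grad U u x) \<bullet> grad \<phi> x
                       + (B x \<bullet> weak_grad U u x + (c x + \<alpha>) * u x) * \<phi> x);
             rhs = (\<lambda>x. f x * \<phi> x + F x \<bullet> grad \<phi> x)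
         in integrable (lebesgue_on U) lhs \<and> integrable (lebesgue_on U) rhs \<and>
            (\<integral>x. lhs x \<partial>lebesgue_on U) = (\<integral>x. rhs x \<partial>lebesgue_on U)))"

text \<open>
  \<open>C1\<close> is an energy constant if the energy estimate holds with \<open>C1\<close> for all coefficients and data,
  and on all sets \<open>V\<close> of the same measure as \<open>U\<close>: besides the fixed exponent \<open>p\<close>, it
  depends only on \<open>lam\<close>, the dimension and the measure of \<open>U\<close>. As the equation is linear,
  the estimate contains the uniqueness of the weak solution.
\<close>

definition energy_constant :: "real \<Rightarrow> real \<Rightarrow> (real^'d::finite) set \<Rightarrow> real \<Rightarrow> bool" where
  "energy_constant p lam U C1 \<longleftrightarrow>
     C1 > 0 \<and>
     (\<forall>(V :: (real^'d) set) A B c \<alpha> f F u.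
        measure lebesgue V = measure lebesgue U \<and> assumption_A p lam V A B c \<alpha> \<and>
        in_Lp p V f \<and> in_Lp 2 V F \<and> weak_solution V A B c \<alpha> f F u
        \<longrightarrow> H12_norm V u \<le> ennreal C1 * (Lp_norm p V f + Lp_norm 2 V F))"

text \<open>The constant \<open>N\<close>, for dimension \<open>d\<close>, \<open>p = 2\<^sub>*\<close> and \<open>v = |U|\<close>.\<close>

definition N_const :: "nat \<Rightarrow> real \<Rightarrow> real \<Rightarrow> real" where
  "N_const d p v =
     (if d = 2 then (let q = p / (p - 1) in q / 2 * v powr (1 / q))
      else 2 * (real d - 1) / (real d - 2))"

end

theory Submission
  imports Defs "HOL-Computational_Algebra.Polynomial"
begin

text \<open>
  The difference \<open>w = u\<^sub>n - u\<close> solves the equation with coefficients \<open>A\<^sub>n, B\<^sub>n, c\<^sub>n\<close> and data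
  \<open>r = (f\<^sub>n - f) + \<langle>B - B\<^sub>n, \<nabla>u\<rangle> + (c - c\<^sub>n) u\<close> and \<open>G = F\<^sub>n - F - (A\<^sub>n - A) \<nabla>u\<close>. Testing it with a bounded
  increasing function \<open>S\<^sub>k(w)\<close>, the drift term is nonnegative because \<open>\<langle>B\<^sub>n, \<nabla>w\<rangle> S\<^sub>k(w)\<close> is
  \<open>\<langle>B\<^sub>n, \<nabla>R\<^sub>k(w)\<rangle>\<close> for the nonnegative primitive \<open>R\<^sub>k\<close> of \<open>S\<^sub>k\<close>. The result controls \<open>\<parallel>w\<parallel>\<close> in \<open>L\<^sup>1\<close> by
  \<open>\<parallel>r\<parallel>\<close> in \<open>L\<^sup>1\<close>, by \<open>\<parallel>G\<parallel>\<close> in \<open>L\<^sup>2\<close> and by the Poincare constant of \<open>U\<close>; for the optimal \<open>k\<close> the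
  constants are those claimed, because any energy constant \<open>C\<^sub>1\<close> makes \<open>C\<^sub>1 \<lambda>\<close> a Poincare constant.
  Hence no auxiliary problem has to be solved. The zero order part of \<open>r\<close> is estimated by Hoelder's
  inequality and the Sobolev inequality with constant \<open>N\<close>. The convergence statement uses
  \<open>\<parallel>\<nabla>u\<parallel>\<close> in place of \<open>C\<^sub>4\<close>, which is infinite if \<open>f\<close> lies only in \<open>L\<^sup>1\<close>.
\<close>

section \<open>Weighted Hoelder inequality\<close>

text \<open>The residual r lies only in L^1 and the drift only in L^2, so neither r w nor
  \<langle>B_n, grad w\<rangle> w has to be integrable: w itself is no admissible test function,
  which forces a bounded one. No chain rule for Sobolev functions is developed. Identities are
  written for the truncation S of test functions \<phi>_j and passed to the limit: gradients
  converge in L^2, while the nonlinear factors stay bounded and converge almost everywhere. Hence S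
  and its primitive must be smooth. The L^1 norm of w comes from |t| \<le> t S(t) / k + |S(t)|: the
  zero order term with \<alpha> pays for the first summand, the Poincare inequality for S(w) for the
  second. With the Poincare constant P = C_1 \<lambda> only P / \<lambda> = C_1 survives, and
  |U|^(1/2) is the price of passing from L^2 to L^1. The number \<open>N\<close> stems from the
  Gagliardo-Nirenberg inequality for |\<phi>|^\<gamma>, whose gradient carries the factor \<gamma>;
  the exponents force \<gamma> = 2 (d - 1) / (d - 2) for d \<ge> 3 and \<gamma> = q / 2 for d = 2,
  where q is the exponent conjugate to p.\<close>

lemma weighted_arith_geom_mean:
  fixes a y :: "'i \<Rightarrow> real"
  assumes "finite I" "\<And>i. i \<in> I \<Longrightarrow> 0 < a i" "(\<Sum>i\<in>I. a i) = 1" "\<And>i. i \<in> I \<Longrightarrow> 0 \<le> y i"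
  shows "(\<Prod>i\<in>I. y i powr a i) \<le> (\<Sum>i\<in>I. a i * y i)"
proof (cases "\<exists>i\<in>I. y i = 0")
  case True
  then have "(\<Prod>i\<in>I. y i powr a i) = 0"
    using assms(1) by (intro prod_zero) auto
  moreover have "0 \<le> (\<Sum>i\<in>I. a i * y i)"
    using assms by (intro sum_nonneg) (simp add: less_imp_le)
  ultimately show ?thesis by simp
next
  case False
  then have pos: "i \<in> I \<Longrightarrow> y i > 0" for i
    using assms(4) by (metis order_le_less)
  have ne: "I \<noteq> {}" using assms(3) by auto
  have "(\<Prod>i\<in>I. y i powr a i) = exp (\<Sum>i\<in>I. a i *\<^sub>R ln (y i))"
    using assms(1) by (subst exp_sum) (auto simp: powr_def intro!: prod.cong dest: pos)
  also have "\<dots> \<le> (\<Sum>i\<in>I. a i * exp (ln (y i)))"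
    by (rule convex_on_sum[OF assms(1) ne exp_convex]) (use assms in \<open>auto intro: less_imp_le\<close>)
  also have "\<dots> = (\<Sum>i\<in>I. a i * y i)"
    using pos by simp
  finally show ?thesis .
qed

text \<open>Unlike \<open>epowr\<close>, this power is \<open>1\<close> for exponent \<open>0\<close>, also at the bases \<open>0\<close> and \<open>\<infinity>\<close>.\<close>

definition epow :: "ennreal \<Rightarrow> real \<Rightarrow> ennreal" where
  "epow x a = (if a = 0 then 1 else epowr x a)"

lemma epow_0 [simp]: "epow x 0 = 1"
  by (simp add: epow_def)

lemma epowr_top [simp]: "epowr top a = top"
  by (simp add: epowr_def)

lemma epowr_ennreal: "0 \<le> x \<Longrightarrow> epowr (ennreal x) a = ennreal (x powr a)"
  by (simp add: epowr_def)

lemma epowr_0 [simp]: "epowr 0 a = 0"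
  by (simp add: epowr_def)

lemma epowr_mono: "x \<le> y \<Longrightarrow> 0 \<le> a \<Longrightarrow> epowr x a \<le> epowr y a"
  by (cases x; cases y) (auto simp: epowr_ennreal intro!: ennreal_leI powr_mono2 simp: top_unique)

lemma epow_mono: "x \<le> y \<Longrightarrow> 0 \<le> a \<Longrightarrow> epow x a \<le> epow y a"
  by (auto simp: epow_def epowr_mono)

lemma epowr_eq_0_iff [simp]: "epowr x a = 0 \<longleftrightarrow> x = 0"
  by (cases x) (auto simp: epowr_def powr_eq_0_iff enn2real_eq_0_iff simp flip: ennreal_0)

lemma epowr_eq_top_iff [simp]: "epowr x a = top \<longleftrightarrow> x = top"
  by (cases x) (auto simp: epowr_def)

lemma epowr_add: "0 < a \<Longrightarrow> 0 < b \<Longrightarrow> epowr x (a + b) = epowr x a * epowr x b"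
  by (cases x) (auto simp: epowr_ennreal powr_add simp flip: ennreal_mult)

lemma epow_add: "0 \<le> a \<Longrightarrow> 0 \<le> b \<Longrightarrow> epow x (a + b) = epow x a * epow x b"
  by (auto simp: epow_def epowr_add)

lemma measurable_epowr [measurable]:
  assumes [measurable]: "f \<in> borel_measurable M"
  shows "(\<lambda>x. epowr (f x) a) \<in> borel_measurable M"
  unfolding epowr_def by measurable

lemma measurable_epow [measurable]:
  assumes [measurable]: "f \<in> borel_measurable M"
  shows "(\<lambda>x. epow (f x) a) \<in> borel_measurable M"
  by (cases "a = 0") (simp_all add: epow_def)

text \<open>The weighted mean inequality for y_i / c_i, multiplied back. The normalisers c_i will be
  the integrals of the factors, so that integrating the sum on the right leaves the sum of the
  weights.\<close>

lemma epow_prod_le_sum: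
  fixes a :: "'i \<Rightarrow> real"
  assumes "finite I" "\<And>i. i \<in> I \<Longrightarrow> 0 < a i" "(\<Sum>i\<in>I. a i) = 1"
    and "\<And>i. i \<in> I \<Longrightarrow> 0 < c i \<and> c i < top"
  shows "(\<Prod>i\<in>I. epowr (y i) (a i)) \<le> (\<Prod>i\<in>I. epowr (c i) (a i)) * (\<Sum>i\<in>I. ennreal (a i) / c i * y i)"
proof (cases "\<exists>i\<in>I. y i = top")
  case True
  then obtain j where j: "j \<in> I" "y j = top" by auto
  have "ennreal (a j) / c j * y j = top"
    using j assms(2,4)[of j] by (auto simp: ennreal_mult_top ennreal_divide_eq_0_iff)
  then have "(\<Sum>i\<in>I. ennreal (a i) / c i * y i) = top"
    using j assms(1) by (metis (mono_tags, lifting) ennreal_sum_eq_top)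
  moreover have "(\<Prod>i\<in>I. epowr (c i) (a i)) \<noteq> 0"
    using assms(1) by (auto dest: assms(4))
  ultimately show ?thesis by (auto simp: ennreal_mult_top)
next
  case False
  define y' c' where "y' i = enn2real (y i)" and "c' i = enn2real (c i)" for i
  have y: "i \<in> I \<Longrightarrow> y i = ennreal (y' i)" for i
    using False by (simp add: y'_def less_top)
  have c: "i \<in> I \<Longrightarrow> c i = ennreal (c' i)" and c'pos: "i \<in> I \<Longrightarrow> 0 < c' i" for i
    using assms(4)[of i] by (auto simp: c'_def less_top enn2real_positive_iff)
  have y'nn: "0 \<le> y' i" for i by (simp add: y'_def)
  have "(\<Prod>i\<in>I. epowr (y i) (a i)) = ennreal (\<Prod>i\<in>I. y' i powr a i)"
    by (subst prod_ennreal[symmetric]) (auto simp: y epowr_ennreal y'nn intro!: prod.cong)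
  also have "(\<Prod>i\<in>I. y' i powr a i) = (\<Prod>i\<in>I. c' i powr a i) * (\<Prod>i\<in>I. (y' i / c' i) powr a i)"
    using c'pos y'nn by (subst prod.distrib[symmetric])
       (intro prod.cong refl, simp add: powr_divide less_imp_le dual_order.strict_implies_not_eq)
  also have "\<dots> \<le> (\<Prod>i\<in>I. c' i powr a i) * (\<Sum>i\<in>I. a i * (y' i / c' i))"
    using assms(1,2,3) c'pos y'nn
    by (intro mult_left_mono weighted_arith_geom_mean) (auto intro!: prod_nonneg simp: less_imp_le)
  also have "ennreal \<dots> = (\<Prod>i\<in>I. epowr (c i) (a i)) * (\<Sum>i\<in>I. ennreal (a i) / c i * y i)"
  proof -
    have "ennreal (\<Prod>i\<in>I. c' i powr a i) = (\<Prod>i\<in>I. epowr (c i) (a i))"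
      by (subst prod_ennreal[symmetric]) (auto simp: c epowr_ennreal c'pos less_imp_le intro!: prod.cong)
    moreover have "ennreal (\<Sum>i\<in>I. a i * (y' i / c' i)) = (\<Sum>i\<in>I. ennreal (a i) / c i * y i)"
    proof (subst sum_ennreal[symmetric])
      show "0 \<le> a i * (y' i / c' i)" if "i \<in> I" for i
        using that assms(2) c'pos y'nn by (simp add: less_imp_le)
      show "(\<Sum>i\<in>I. ennreal (a i * (y' i / c' i))) = (\<Sum>i\<in>I. ennreal (a i) / c i * y i)"
      proof (intro sum.cong refl)
        fix i assume i: "i \<in> I"
        show "ennreal (a i * (y' i / c' i)) = ennreal (a i) / c i * y i"
          using i assms(2)[OF i] c'pos[OF i] y'nn[of i]
          by (simp add: c y divide_ennreal less_imp_le flip: ennreal_mult)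
      qed
    qed
    moreover have "0 \<le> (\<Prod>i\<in>I. c' i powr a i)" "0 \<le> (\<Sum>i\<in>I. a i * (y' i / c' i))"
      using assms(2) c'pos y'nn by (auto intro!: prod_nonneg sum_nonneg simp: less_imp_le)
    ultimately show ?thesis by (simp add: ennreal_mult)
  qed
  finally show ?thesis by (simp add: ennreal_leI)
qed

text \<open>Hoelder's inequality for finitely many factors with exponents 1 / a_i, obtained by
  integrating the normalised pointwise bound. A weight 0 stands for an infinite exponent and
  contributes the factor 1, hence the passage to the set \<open>J\<close> of positive
  weights.\<close>

lemma nn_integral_prod_epow_le:
  fixes a :: "'i \<Rightarrow> real"
  assumes fin: "finite I" and a: "\<And>i. i \<in> I \<Longrightarrow> 0 \<le> a i" "(\<Sum>i\<in>I. a i) = 1"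
    and f [measurable]: "\<And>i. i \<in> I \<Longrightarrow> f i \<in> borel_measurable M"
  shows "(\<integral>\<^sup>+x. (\<Prod>i\<in>I. epow (f i x) (a i)) \<partial>M) \<le> (\<Prod>i\<in>I. epow (\<integral>\<^sup>+x. f i x \<partial>M) (a i))"
proof -
  define J where "J = {i\<in>I. a i > 0}"
  have J: "finite J" "J \<subseteq> I" using fin by (auto simp: J_def)
  have aJ: "(\<Sum>i\<in>J. a i) = 1"
    unfolding a(2)[symmetric] using a(1) by (intro sum.mono_neutral_left) (auto simp: J_def fin, force)
  have eqJ: "(\<Prod>i\<in>I. epow (g i) (a i)) = (\<Prod>i\<in>J. epowr (g i) (a i))" for g
  proof -
    have "(\<Prod>i\<in>J. epowr (g i) (a i)) = (\<Prod>i\<in>J. epow (g i) (a i))"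
      by (intro prod.cong) (auto simp: J_def epow_def)
    also have "\<dots> = (\<Prod>i\<in>I. epow (g i) (a i))"
      using a(1) by (intro prod.mono_neutral_left) (auto simp: J_def fin epow_def order_le_less)
    finally show ?thesis by simp
  qed
  have fJ [measurable]: "\<And>i. i \<in> J \<Longrightarrow> f i \<in> borel_measurable M" using J by auto
  define c where "c i = (\<integral>\<^sup>+x. f i x \<partial>M)" for i
  have "(\<integral>\<^sup>+x. (\<Prod>i\<in>J. epowr (f i x) (a i)) \<partial>M) \<le> (\<Prod>i\<in>J. epowr (c i) (a i))"
  \<comment> \<open>Normalising needs integrals strictly between 0 and \<open>top\<close>. A
    vanishing integral kills the product almost everywhere; an infinite one, when none vanishes,
    makes the right side infinite.\<close>
  proof (cases "\<exists>i\<in>J. c i = 0")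
    case True
    then obtain j where j: "j \<in> J" "c j = 0" by auto
    then have "AE x in M. f j x = 0"
      by (simp add: c_def nn_integral_0_iff_AE)
    then have "AE x in M. (\<Prod>i\<in>J. epowr (f i x) (a i)) = 0"
      by eventually_elim (use j J(1) in \<open>auto intro!: prod_zero\<close>)
    then have "(\<integral>\<^sup>+x. (\<Prod>i\<in>J. epowr (f i x) (a i)) \<partial>M) = 0"
      by (subst nn_integral_0_iff_AE) (auto)
    then show ?thesis by simp
  next
    case no0: False
    show ?thesis
    proof (cases "\<exists>i\<in>J. c i = top")
      case True
      then obtain j where j: "j \<in> J" "c j = top" by auto
      have "(\<Prod>i\<in>J. epowr (c i) (a i)) = epowr (c j) (a j) * (\<Prod>i\<in>J-{j}. epowr (c i) (a i))"
        using j J(1) by (simp add: prod.remove)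
      also have "\<dots> = top"
        using j no0 J(1) by (auto simp: ennreal_top_mult prod_zero_iff)
      finally show ?thesis by simp
    next
      case False
      have "(\<integral>\<^sup>+x. (\<Prod>i\<in>J. epowr (f i x) (a i)) \<partial>M)
          \<le> (\<integral>\<^sup>+x. (\<Prod>i\<in>J. epowr (c i) (a i)) * (\<Sum>i\<in>J. ennreal (a i) / c i * f i x) \<partial>M)"
        using J(1) aJ no0 False
        by (intro nn_integral_mono epow_prod_le_sum) (auto simp: J_def less_top zero_less_iff_neq_zero)
      also have "\<dots> = (\<Prod>i\<in>J. epowr (c i) (a i)) * (\<Sum>i\<in>J. ennreal (a i) / c i * c i)"
        by (simp add: nn_integral_cmult nn_integral_sum c_def cong: sum.cong)
      also have "(\<Sum>i\<in>J. ennreal (a i) / c i * c i) = (\<Sum>i\<in>J. ennreal (a i))"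
      proof (intro sum.cong refl)
        fix i assume "i \<in> J"
        then have "c i \<noteq> 0" "c i \<noteq> top" using no0 False by auto
        then show "ennreal (a i) / c i * c i = ennreal (a i)"
          by (simp add: ennreal_divide_times divide_ennreal_def mult.assoc ennreal_inverse_mult less_top)
             (metis ennreal_divide_self divide_ennreal_def mult.commute mult_1_right less_top)
      qed
      also have "\<dots> = 1"
        using aJ a(1) J by (subst sum_ennreal) auto
      finally show ?thesis by simp
    qed
  qed
  then show ?thesis by (simp add: eqJ c_def)
qed

section \<open>The Gagliardo--Nirenberg inequality\<close>

text \<open>
  The case of interest is \<open>p = 1 / (card I - 1)\<close>, where the first factor disappears. In the induction the
  new coordinate is integrated by Hoelder's inequality, and the weights add up to one due to that factor.
\<close>

lemma nn_integral_PiM_grid_le: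
  fixes f :: "('i \<Rightarrow> real) \<Rightarrow> ennreal" and p :: real
  assumes "finite I" "f \<in> borel_measurable (Pi\<^sub>M I (\<lambda>_. lborel))" "0 \<le> p" "(real (card I) - 1) * p \<le> 1"
  shows "(\<integral>\<^sup>+x. epow (f x) (1 - (real (card I) - 1) * p) *
           (\<Prod>i\<in>I. epow (\<integral>\<^sup>+t. f (x(i := t)) \<partial>lborel) p) \<partial>Pi\<^sub>M I (\<lambda>_. lborel))
         \<le> epow (\<integral>\<^sup>+x. f x \<partial>Pi\<^sub>M I (\<lambda>_. lborel)) (1 + p)"
  using assms
proof (induction I arbitrary: f)
  case empty
  interpret product_sigma_finite "\<lambda>_. lborel :: real measure"
    by standard
  show ?case by (simp add: PiM_empty nn_integral_count_space_finite)
next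
  case (insert j I f)
  interpret product_sigma_finite "\<lambda>_. lborel :: real measure"
    by standard
  let ?P = "\<lambda>I. Pi\<^sub>M I (\<lambda>_. lborel :: real measure)"
  note f[measurable] = insert.prems(1)
  define n where "n = real (card I)"
  have card: "real (card (insert j I)) - 1 = n"
    using insert.hyps by (simp add: n_def)
  have np: "n * p \<le> 1" using insert.prems(3) card by simp
  \<comment> \<open>The new coordinate is integrated out; the induction hypothesis will be applied
    to \<open>F\<close>.\<close>
  define F where "F x = (\<integral>\<^sup>+t. f (x(j := t)) \<partial>lborel)" for x
  have F[measurable]: "F \<in> borel_measurable (?P I)"
    unfolding F_def by measurable
  have upd[measurable]: "(\<lambda>(z, t). z(i := t)) \<in> measurable (?P K \<Otimes>\<^sub>M lborel) (?P K)" if "i \<in> K" for i K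
  proof -
    have "K = K \<union> {i}" using that by auto
    then show ?thesis
      by (simp only: case_prod_unfold) (rule measurable_fun_upd[of K K i], auto)
  qed
  define q where "q x y = epow (f (x(j := y))) (1 - n * p) *
       (\<Prod>i\<in>I. epow (\<integral>\<^sup>+t. f (x(j := y, i := t)) \<partial>lborel) p)" for x y
  have inner: "(\<integral>\<^sup>+y. q x y \<partial>lborel) \<le> epow (F x) (1 - n * p) * (\<Prod>i\<in>I. epow (\<integral>\<^sup>+t. F (x(i := t)) \<partial>lborel) p)"
    if x: "x \<in> space (?P I)" for x
  proof -
    \<comment> \<open>Hoelder's inequality in the variable \<open>y\<close>: the index
      \<open>None\<close> carries \<open>f\<close> itself with weight 1 - n p, the index
      \<open>Some i\<close> the line integral in direction \<open>i\<close> with weight p. As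
      \<open>I\<close> has n elements, the weights add up to one.\<close>
    define g where "g k y = (case k of None \<Rightarrow> f (x(j := y)) | Some i \<Rightarrow> (\<integral>\<^sup>+t. f (x(j := y, i := t)) \<partial>lborel))" for k y
    define a where "a k = (case k of None \<Rightarrow> 1 - n * p | Some (i::'i) \<Rightarrow> p)" for k
    have mx[measurable]: "(\<lambda>y. x(j := y)) \<in> measurable lborel (?P (insert j I))"
      using x insert.hyps by (intro measurable_component_update)
    have mg: "g k \<in> borel_measurable lborel" if "k \<in> insert None (Some ` I)" for k
    proof (cases k)
      case None
      show ?thesis unfolding g_def None by simp
    next
      case (Some i)
      then have i: "i \<in> insert j I" using that by auto
      note upd[OF i, measurable]
      have "(\<lambda>z. case z of (y, t) \<Rightarrow> f (x(j := y, i := t))) \<in> borel_measurable (lborel \<Otimes>\<^sub>M lborel)"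
        using measurable_compose[OF _ upd[OF i], of "\<lambda>(y,t). (x(j := y), t)" "lborel \<Otimes>\<^sub>M lborel"]
        by (simp add: case_prod_beta)
      then show ?thesis unfolding g_def Some by simp
    qed
    have "(\<integral>\<^sup>+y. q x y \<partial>lborel) = (\<integral>\<^sup>+y. (\<Prod>k\<in>insert None (Some ` I). epow (g k y) (a k)) \<partial>lborel)"
      using insert.hyps(1) by (intro nn_integral_cong) (simp add: q_def g_def a_def prod.reindex)
    also have "\<dots> \<le> (\<Prod>k\<in>insert None (Some ` I). epow (\<integral>\<^sup>+y. g k y \<partial>lborel) (a k))"
      using insert.hyps(1) insert.prems(2) np mg
      by (intro nn_integral_prod_epow_le) (auto simp: a_def sum.reindex n_def split: option.splits)
    also have "\<dots> = epow (F x) (1 - n * p) * (\<Prod>i\<in>I. epow (\<integral>\<^sup>+y. \<integral>\<^sup>+t. f (x(j := y, i := t)) \<partial>lborel \<partial>lborel) p)"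
      using insert.hyps(1) by (simp add: g_def a_def F_def prod.reindex)
    also have "(\<Prod>i\<in>I. epow (\<integral>\<^sup>+y. \<integral>\<^sup>+t. f (x(j := y, i := t)) \<partial>lborel \<partial>lborel) p)
             = (\<Prod>i\<in>I. epow (\<integral>\<^sup>+t. F (x(i := t)) \<partial>lborel) p)"
    proof (intro prod.cong refl)
      fix i assume i: "i \<in> I"
      then have ij: "i \<noteq> j" "i \<in> insert j I" using insert.hyps(2) by auto
      have m: "(\<lambda>z. case z of (y, t) \<Rightarrow> f (x(j := y, i := t))) \<in> borel_measurable (lborel \<Otimes>\<^sub>M lborel)"
        using measurable_compose[OF _ upd[OF ij(2)], of "\<lambda>(y,t). (x(j := y), t)" "lborel \<Otimes>\<^sub>M lborel"]
        by (simp add: case_prod_beta)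
      have "(\<integral>\<^sup>+y. \<integral>\<^sup>+t. f (x(j := y, i := t)) \<partial>lborel \<partial>lborel) = (\<integral>\<^sup>+t. \<integral>\<^sup>+y. f (x(j := y, i := t)) \<partial>lborel \<partial>lborel)"
        by (rule pair_sigma_finite.Fubini'[OF _ m, symmetric]) (simp add: lborel_pair.pair_sigma_finite_axioms)
      also have "\<dots> = (\<integral>\<^sup>+t. F (x(i := t)) \<partial>lborel)"
        using ij(1) by (simp add: F_def fun_upd_twist)
      finally show "epow (\<integral>\<^sup>+y. \<integral>\<^sup>+t. f (x(j := y, i := t)) \<partial>lborel \<partial>lborel) p = epow (\<integral>\<^sup>+t. F (x(i := t)) \<partial>lborel) p"
        by simp
    qed
    finally show ?thesis .
  qed
  have "(\<integral>\<^sup>+x. epow (f x) (1 - (real (card (insert j I)) - 1) * p) *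
           (\<Prod>i\<in>insert j I. epow (\<integral>\<^sup>+t. f (x(i := t)) \<partial>lborel) p) \<partial>?P (insert j I))
      = (\<integral>\<^sup>+x. \<integral>\<^sup>+y. epow (f (x(j := y))) (1 - n * p) *
           (\<Prod>i\<in>insert j I. epow (\<integral>\<^sup>+t. f (x(j := y, i := t)) \<partial>lborel) p) \<partial>lborel \<partial>?P I)"
    unfolding card
  proof (subst product_nn_integral_insert[OF insert.hyps(1,2)])
    show "(\<lambda>x. epow (f x) (1 - n * p) * (\<Prod>i\<in>insert j I. epow (\<integral>\<^sup>+ t. f (x(i := t)) \<partial>lborel) p))
      \<in> borel_measurable (?P (insert j I))"
    proof (intro borel_measurable_times_ennreal borel_measurable_prod_ennreal measurable_epow)
      fix i assume i: "i \<in> insert j I"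
      note upd[OF i, measurable]
      show "(\<lambda>x. \<integral>\<^sup>+ t. f (x(i := t)) \<partial>lborel) \<in> borel_measurable (?P (insert j I))"
        by measurable
    qed simp
  qed simp
  \<comment> \<open>The factor of direction \<open>j\<close> does not depend on \<open>y\<close>,
    because the second update at \<open>j\<close> overwrites the first; it is \<open>F x\<close> to
    the power p and leaves the inner integral.\<close>
  also have "\<dots> = (\<integral>\<^sup>+x. \<integral>\<^sup>+y. epow (F x) p * q x y \<partial>lborel \<partial>?P I)"
    using insert.hyps by (simp add: q_def F_def mult_ac cong: prod.cong)
  also have "\<dots> \<le> (\<integral>\<^sup>+x. epow (F x) p * (\<integral>\<^sup>+y. q x y \<partial>lborel) \<partial>?P I)"
  proof (intro nn_integral_mono)
    fix x assume x: "x \<in> space (?P I)"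
    have mx[measurable]: "(\<lambda>y. x(j := y)) \<in> measurable lborel (?P (insert j I))"
      using x insert.hyps by (intro measurable_component_update)
    have "q x \<in> borel_measurable lborel"
      unfolding q_def
    proof (intro borel_measurable_times_ennreal borel_measurable_prod_ennreal measurable_epow)
      fix i assume i: "i \<in> I"
      then have i': "i \<in> insert j I" by simp
      have "(\<lambda>z. case z of (y, t) \<Rightarrow> f (x(j := y, i := t))) \<in> borel_measurable (lborel \<Otimes>\<^sub>M lborel)"
        using measurable_compose[OF _ upd[OF i'], of "\<lambda>(y,t). (x(j := y), t)" "lborel \<Otimes>\<^sub>M lborel"]
        by (simp add: case_prod_beta)
      then show "(\<lambda>y. \<integral>\<^sup>+ t. f (x(j := y, i := t)) \<partial>lborel) \<in> borel_measurable lborel" by simp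
    qed simp
    then show "(\<integral>\<^sup>+y. epow (F x) p * q x y \<partial>lborel) \<le> epow (F x) p * (\<integral>\<^sup>+y. q x y \<partial>lborel)"
      by (simp add: nn_integral_cmult)
  qed
  also have "\<dots> \<le> (\<integral>\<^sup>+x. epow (F x) p * (epow (F x) (1 - n * p) * (\<Prod>i\<in>I. epow (\<integral>\<^sup>+t. F (x(i := t)) \<partial>lborel) p)) \<partial>?P I)"
    by (intro nn_integral_mono mult_left_mono inner) auto
  also have "\<dots> = (\<integral>\<^sup>+x. epow (F x) (1 - (real (card I) - 1) * p) * (\<Prod>i\<in>I. epow (\<integral>\<^sup>+t. F (x(i := t)) \<partial>lborel) p) \<partial>?P I)"
  proof (intro nn_integral_cong)
    fix x
    \<comment> \<open>The extra power p of \<open>F\<close>, which came from direction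
      \<open>j\<close>, raises the exponent 1 - n p to the one that the induction hypothesis asks
      for.\<close>
    have "1 - (real (card I) - 1) * p = p + (1 - n * p)" by (simp add: n_def algebra_simps)
    then have "epow (F x) (1 - (real (card I) - 1) * p) = epow (F x) p * epow (F x) (1 - n * p)"
      using np insert.prems(2) by (metis epow_add diff_ge_0_iff_ge)
    then show "epow (F x) p * (epow (F x) (1 - n * p) * (\<Prod>i\<in>I. epow (\<integral>\<^sup>+t. F (x(i := t)) \<partial>lborel) p))
       = epow (F x) (1 - (real (card I) - 1) * p) * (\<Prod>i\<in>I. epow (\<integral>\<^sup>+t. F (x(i := t)) \<partial>lborel) p)"
      by (simp add: mult.assoc)
  qed
  also have "\<dots> \<le> epow (\<integral>\<^sup>+x. F x \<partial>?P I) (1 + p)"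
    using np insert.prems(2) F by (intro insert.IH) (auto simp: n_def algebra_simps)
  also have "(\<integral>\<^sup>+x. F x \<partial>?P I) = (\<integral>\<^sup>+x. f x \<partial>?P (insert j I))"
    using insert.hyps by (simp add: F_def product_nn_integral_insert)
  finally show ?case .
qed

lemma nn_integral_lborel_PiM:
  fixes g :: "'a::euclidean_space \<Rightarrow> ennreal"
  assumes "g \<in> borel_measurable borel"
  shows "(\<integral>\<^sup>+x. g x \<partial>lborel) = (\<integral>\<^sup>+x. g (\<Sum>b\<in>Basis. x b *\<^sub>R b) \<partial>Pi\<^sub>M Basis (\<lambda>_. lborel))"
  by (subst lborel_eq, subst nn_integral_distr) (use assms in auto)

text \<open>A form free of derivatives: all that enters is that line integrals of \<open>h\<close>
  in every coordinate direction dominate \<open>v\<close>. Multiplying these d bounds, each to the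
  power 1 / (d - 1), leads to the grid estimate with p = 1 / (d - 1), where 1 + p = d / (d -
  1).\<close>

lemma Gagliardo_Nirenberg:
  fixes v h :: "'a::euclidean_space \<Rightarrow> ennreal"
  assumes d: "DIM('a) \<ge> 2" and [measurable]: "v \<in> borel_measurable borel" "h \<in> borel_measurable borel"
    and le: "\<And>x b. b \<in> Basis \<Longrightarrow> v x \<le> (\<integral>\<^sup>+t. h (x + (t - x \<bullet> b) *\<^sub>R b) \<partial>lborel)"
  shows "(\<integral>\<^sup>+x. epowr (v x) (real DIM('a) / (real DIM('a) - 1)) \<partial>lborel) \<le> epowr (\<integral>\<^sup>+x. h x \<partial>lborel) (real DIM('a) / (real DIM('a) - 1))"
proof -
  define d where "d = real DIM('a)"
  define p where "p = 1 / (d - 1)"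
  have d2: "d \<ge> 2" using d by (simp add: d_def)
  have p: "0 < p" "(d - 1) * p = 1" "d * p = d / (d - 1)" "1 + p = d / (d - 1)"
    using d2 by (auto simp: p_def field_simps)
  let ?s = "\<lambda>x. \<Sum>b\<in>(Basis::'a set). x b *\<^sub>R b"
  let ?P = "Pi\<^sub>M (Basis :: 'a set) (\<lambda>_. lborel :: real measure)"
  have fold: "real DIM('a) / (real DIM('a) - 1) = d / (d - 1)" by (simp add: d_def)
  have "(\<integral>\<^sup>+x. epowr (v x) (d / (d - 1)) \<partial>lborel) = (\<integral>\<^sup>+x. epowr (v (?s x)) (d / (d - 1)) \<partial>?P)"
    by (rule nn_integral_lborel_PiM) measurable
  also have "\<dots> \<le> (\<integral>\<^sup>+x. epow (h (?s x)) (1 - (real (card (Basis :: 'a set)) - 1) * p) *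
           (\<Prod>i\<in>Basis. epow (\<integral>\<^sup>+t. h (?s (x(i := t))) \<partial>lborel) p) \<partial>?P)"
  proof (intro nn_integral_mono)
    fix x :: "'a \<Rightarrow> real"
    \<comment> \<open>The power is split into d equal factors so that each can be bounded along a
      different coordinate direction.\<close>
    have "epowr (v (?s x)) (d / (d - 1)) = (\<Prod>i\<in>(Basis :: 'a set). epow (v (?s x)) p)"
    proof -
      have "(\<Prod>i\<in>(Basis :: 'a set). epow (v (?s x)) p) = epowr (v (?s x)) p ^ DIM('a)"
        using p(1) by (simp add: epow_def)
      also have "\<dots> = epowr (v (?s x)) (real DIM('a) * p)"
      proof -
        have "epowr y p ^ Suc n = epowr y (real (Suc n) * p)" for y n
        proof (induction n)
          case (Suc n)
          have "real (Suc (Suc n)) * p = p + real (Suc n) * p" by (simp add: algebra_simps)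
          then show ?case using Suc p(1) by (simp add: epowr_add)
        qed simp
        moreover obtain n where "DIM('a) = Suc n" using d by (cases "DIM('a)") auto
        ultimately show ?thesis by metis
      qed
      finally show ?thesis using p(3) by (simp add: d_def)
    qed
    also have "\<dots> \<le> (\<Prod>i\<in>Basis. epow (\<integral>\<^sup>+t. h (?s (x(i := t))) \<partial>lborel) p)"
    proof (intro prod_mono_ennreal epow_mono)
      fix i :: 'a assume i: "i \<in> Basis"
      have "?s x + (t - ?s x \<bullet> i) *\<^sub>R i = ?s (x(i := t))" for t
      proof -
        have "?s (x(i := t)) = t *\<^sub>R i + (\<Sum>b\<in>Basis - {i}. x b *\<^sub>R b)"
          using i by (simp add: sum.remove[of _ i])
        moreover have "?s x = x i *\<^sub>R i + (\<Sum>b\<in>Basis - {i}. x b *\<^sub>R b)"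
          using i by (simp add: sum.remove[of _ i])
        moreover have "?s x \<bullet> i = x i" using i by simp
        ultimately show ?thesis by (simp add: algebra_simps)
      qed
      then show "v (?s x) \<le> (\<integral>\<^sup>+t. h (?s (x(i := t))) \<partial>lborel)"
        using le[OF i, of "?s x"] by simp
    qed (use p in auto)
    finally show "epowr (v (?s x)) (d / (d - 1)) \<le> epow (h (?s x)) (1 - (real (card (Basis :: 'a set)) - 1) * p) *
           (\<Prod>i\<in>Basis. epow (\<integral>\<^sup>+t. h (?s (x(i := t))) \<partial>lborel) p)"
      using p(2) by (simp add: d_def)
  qed
  also have "\<dots> \<le> epow (\<integral>\<^sup>+x. h (?s x) \<partial>?P) (1 + p)"
    using p by (intro nn_integral_PiM_grid_le) (auto simp: d_def)
  also have "(\<integral>\<^sup>+x. h (?s x) \<partial>?P) = (\<integral>\<^sup>+x. h x \<partial>lborel)"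
    by (rule nn_integral_lborel_PiM[symmetric]) measurable
  finally show ?thesis
    using p d2 by (simp add: epow_def fold)
qed

section \<open>Smooth functions and test functions\<close>

lemma partial_eqI: "(f has_derivative f') (at x) \<Longrightarrow> partial i f x = f' (axis i 1)"
  unfolding partial_def by (metis frechet_derivative_at)

lemma smooth_differentiable: "smooth f \<Longrightarrow> f differentiable at x"
  unfolding smooth_def by (drule spec[of _ "[]"]) simp

lemma smooth_partial:
  assumes "smooth f" shows "smooth (partial i f)"
  unfolding smooth_def
proof (intro allI)
  fix "is" x
  show "foldr partial is (partial i f) differentiable at x"
    using assms[unfolded smooth_def, rule_format, of "is @ [i]" x] by simp
qed

text \<open>Smoothness speaks of all iterated partial derivatives at once, so it suffices to exhibit
  a class of differentiable functions that \<open>partial\<close> does not leave.\<close>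

lemma smooth_coinduct:
  assumes "f \<in> S" "\<And>g x. g \<in> S \<Longrightarrow> g differentiable at x" "\<And>g i. g \<in> S \<Longrightarrow> partial i g \<in> S"
  shows "smooth f"
proof -
  have "foldr partial is f \<in> S" for "is"
    using assms(1,3) by (induction "is") auto
  then show ?thesis
    unfolding smooth_def using assms(2) by blast
qed

lemma smooth_has_derivative:
  assumes "smooth f" shows "(f has_derivative (\<lambda>v. grad f x \<bullet> v)) (at x)"
proof -
  have D: "(f has_derivative frechet_derivative f (at x)) (at x)"
    using smooth_differentiable[OF assms] by (simp add: frechet_derivative_works)
  then have lin: "linear (frechet_derivative f (at x))"
    by (simp add: has_derivative_linear)
  have "frechet_derivative f (at x) v = grad f x \<bullet> v" for v
  proof -
    have "frechet_derivative f (at x) v = frechet_derivative f (at x) (\<Sum>i\<in>UNIV. (v $ i) *\<^sub>R axis i 1)"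
      by (simp add: basis_expansion flip: scalar_mult_eq_scaleR)
    also have "\<dots> = (\<Sum>i\<in>UNIV. v $ i * partial i f x)"
      using lin by (simp add: linear_sum linear_cmul partial_def)
    also have "\<dots> = grad f x \<bullet> v"
      by (simp add: grad_def inner_vec_def mult.commute)
    finally show ?thesis .
  qed
  then have "frechet_derivative f (at x) = (\<lambda>v. grad f x \<bullet> v)" by (rule ext)
  then show ?thesis using D by simp
qed

lemma grad_eqI:
  assumes "(f has_derivative (\<lambda>v. g \<bullet> v)) (at x)" shows "grad f x = g"
  using partial_eqI[OF assms] by (simp add: grad_def vec_eq_iff inner_axis)

lemma smooth_affine: "smooth (\<lambda>x. c * x $ j + d)"
proof (rule smooth_coinduct[where S = "{\<lambda>x. c * x $ j + d |c j d. True}"])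
  have D: "((\<lambda>x. c * x $ j + d) has_derivative (\<lambda>v. c * v $ j)) (at x)" for c d j and x :: "real^'n::finite"
    by (auto intro!: derivative_eq_intros bounded_linear.has_derivative[OF bounded_linear_vec_nth])
  show "g differentiable at x" if g0: "g \<in> {\<lambda>x. c * x $ j + d |c j d. True}" for g and x :: "real^'n::finite"
  proof -
    obtain c j d where "g = (\<lambda>x. c * x $ j + d)" using g0 by auto
    then show ?thesis using D[of c j d x] unfolding differentiable_def by blast
  qed
  show "partial i g \<in> {\<lambda>x. c * x $ j + d |c j d. True}" if g0: "g \<in> {\<lambda>x. c * x $ j + d |c j d. True}" for g and i :: "'n::finite"
  proof -
    obtain c j d where g: "g = (\<lambda>x. c * x $ j + d)" using g0 by auto
    then have "partial i g = (\<lambda>x. 0 * x $ j + c * axis i 1 $ j)"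
      using partial_eqI[OF D] by (intro ext) simp
    then show ?thesis by blast
  qed
  show "(\<lambda>x. c * x $ j + d) \<in> {\<lambda>x. c * x $ j + d |c j d. True}" by blast
qed

lemma smooth_const: "smooth (\<lambda>x. c)"
  using smooth_affine[of 0 _ c] by simp

text \<open>
  If \<open>H\<close> is closed under derivatives on \<open>T\<close>, then this algebra is closed under partial derivatives, so
  that \<open>smooth_coinduct\<close> applies.
\<close>

inductive_set smooth_algebra :: "(real \<Rightarrow> real) set \<Rightarrow> real set \<Rightarrow> (real^'d::finite \<Rightarrow> real) set"
  for H T where
  base: "smooth f \<Longrightarrow> f \<in> smooth_algebra H T"
| add: "f \<in> smooth_algebra H T \<Longrightarrow> g \<in> smooth_algebra H T \<Longrightarrow> (\<lambda>x. f x + g x) \<in> smooth_algebra H T"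
| mult: "f \<in> smooth_algebra H T \<Longrightarrow> g \<in> smooth_algebra H T \<Longrightarrow> (\<lambda>x. f x * g x) \<in> smooth_algebra H T"
| comp: "h \<in> H \<Longrightarrow> smooth f \<Longrightarrow> (\<And>x. f x \<in> T) \<Longrightarrow> (\<lambda>x. h (f x)) \<in> smooth_algebra H T"

lemma smooth_algebra_smooth:
  assumes H: "\<And>h. h \<in> H \<Longrightarrow> \<exists>h'\<in>H. \<forall>t\<in>T. (h has_real_derivative h' t) (at t)"
    and "f \<in> smooth_algebra H T"
  shows "smooth (f :: real^'d::finite \<Rightarrow> real)"
proof (rule smooth_coinduct[of f "smooth_algebra H T"])
  have *: "(\<forall>x. g differentiable at x) \<and> (\<forall>i. partial i g \<in> smooth_algebra H T)" if "g \<in> smooth_algebra H T" for g :: "real^'d \<Rightarrow> real"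
    using that
  proof induction
    case (base f)
    then show ?case by (blast intro: smooth_differentiable smooth_algebra.base smooth_partial)
  next
    case (add f g)
    have "partial i (\<lambda>x. f x + g x) = (\<lambda>x. partial i f x + partial i g x)" for i
    proof
      fix x
      have "(f has_derivative frechet_derivative f (at x)) (at x)" "(g has_derivative frechet_derivative g (at x)) (at x)"
        using add.IH frechet_derivative_works by blast+
      from partial_eqI[OF has_derivative_add[OF this]]
      show "partial i (\<lambda>x. f x + g x) x = partial i f x + partial i g x"
        by (simp add: partial_def)
    qed
    moreover have "(\<lambda>x. partial i f x + partial i g x) \<in> smooth_algebra H T" for i
      using add.IH by (intro smooth_algebra.add) auto
    ultimately show ?case using add.IH by simp
  next
    case (mult f g)
    have "partial i (\<lambda>x. f x * g x) = (\<lambda>x. f x * partial i g x + partial i f x * g x)" for i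
    proof
      fix x
      have "(f has_derivative frechet_derivative f (at x)) (at x)" "(g has_derivative frechet_derivative g (at x)) (at x)"
        using mult.IH frechet_derivative_works by blast+
      from partial_eqI[OF has_derivative_mult[OF this]]
      show "partial i (\<lambda>x. f x * g x) x = f x * partial i g x + partial i f x * g x"
        by (simp add: partial_def)
    qed
    moreover have "(\<lambda>x. f x * partial i g x + partial i f x * g x) \<in> smooth_algebra H T" for i
      using mult.IH mult.hyps
      by (intro smooth_algebra.add smooth_algebra.mult[of f H T "partial i g"] smooth_algebra.mult[of "partial i f" H T g]) auto
    ultimately show ?case using mult.IH by simp
  next
    case (comp h f)
    then obtain h' where h': "h' \<in> H" "\<And>t. t \<in> T \<Longrightarrow> (h has_real_derivative h' t) (at t)"
      using H by blast
    have D: "((\<lambda>x. h (f x)) has_derivative (\<lambda>v. (grad f x \<bullet> v) * h' (f x))) (at x)" for x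
      using has_derivative_compose[OF smooth_has_derivative[OF comp(2)] h'(2)[OF comp(3), unfolded has_field_derivative_def]]
      by (simp add: mult.commute)
    have "partial i (\<lambda>x. h (f x)) = (\<lambda>x. partial i f x * h' (f x))" for i
      by (intro ext) (simp only: partial_eqI[OF D] partial_eqI[OF smooth_has_derivative[OF comp(2)]])
    moreover have "(\<lambda>x. partial i f x * h' (f x)) \<in> smooth_algebra H T" for i
      by (rule smooth_algebra.mult[OF smooth_algebra.base[OF smooth_partial[OF comp(2)]] smooth_algebra.comp[OF h'(1) comp(2,3)]])
    moreover have "(\<lambda>x. h (f x)) differentiable at x" for x
      using D[of x] unfolding differentiable_def by blast
    ultimately show ?case by simp
  qed
  show "g differentiable at x" if "g \<in> smooth_algebra H T" for g and x :: "real^'d" using *[OF that] by auto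
  show "partial i g \<in> smooth_algebra H T" if "g \<in> smooth_algebra H T" for g and i :: 'd using *[OF that] by auto
qed (rule assms(2))

lemma smooth_add: "smooth f \<Longrightarrow> smooth g \<Longrightarrow> smooth (\<lambda>x. f x + g x)"
  by (rule smooth_algebra_smooth[of "{}" UNIV, OF _ smooth_algebra.add[OF smooth_algebra.base smooth_algebra.base]]) simp_all

lemma smooth_mult: "smooth f \<Longrightarrow> smooth g \<Longrightarrow> smooth (\<lambda>x. f x * g x)"
  by (rule smooth_algebra_smooth[of "{}" UNIV, OF _ smooth_algebra.mult[OF smooth_algebra.base smooth_algebra.base]]) simp_all

lemma smooth_prod: "finite I \<Longrightarrow> (\<And>i. i \<in> I \<Longrightarrow> smooth (f i)) \<Longrightarrow> smooth (\<lambda>x. \<Prod>i\<in>I. f i x)"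
  by (induction I rule: finite_induct) (auto intro: smooth_const smooth_mult)

lemma smooth_powr:
  assumes "smooth f" "\<And>x. f x > 0"
  shows "smooth (\<lambda>x. f x powr a)"
\<comment> \<open>The functions c t^b are closed under differentiation on the positive half line,
  whereas a single power is not.\<close>
proof (rule smooth_algebra_smooth[of "{\<lambda>t. c * t powr b |b c. True}" "{0<..}"])
  show "\<exists>h'\<in>{\<lambda>t. c * t powr b |b c. True}. \<forall>t\<in>{0<..}. (h has_real_derivative h' t) (at t)"
    if h0: "h \<in> {\<lambda>t. c * t powr b |b c. True}" for h
  proof -
    obtain b c where h: "h = (\<lambda>t. c * t powr b)" using h0 by auto
    have "\<forall>t\<in>{0<..}. (h has_real_derivative (c * b) * t powr (b - 1)) (at t)"
      unfolding h by (auto intro!: derivative_eq_intros)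
    then show ?thesis by (rule bexI[of _ "\<lambda>t. (c * b) * t powr (b - 1)"]) blast
  qed
  have "(\<lambda>t. t powr a) \<in> {\<lambda>t. c * t powr b |b c. True}"
    by (intro CollectI exI[of _ a] exI[of _ 1]) simp
  then show "(\<lambda>x. f x powr a) \<in> smooth_algebra {\<lambda>t. c * t powr b |b c. True} {0<..}"
    by (rule smooth_algebra.comp[OF _ assms(1)]) (simp add: assms(2))
qed

section \<open>A smooth function vanishing on a half line\<close>

definition flat_exp :: "real \<Rightarrow> real" where
  "flat_exp t = (if t \<le> 0 then 0 else exp (- (1 / t)))"

lemma poly_mult_exp_tendsto_0: "((\<lambda>s::real. poly p s * exp (- s)) \<longlongrightarrow> 0) at_top"
proof -
  have "((\<lambda>s::real. \<Sum>i\<le>degree p. coeff p i * (s ^ i / exp s)) \<longlongrightarrow> (\<Sum>i\<le>degree p. coeff p i * 0)) at_top"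
    by (intro tendsto_intros tendsto_power_div_exp_0)
  then show ?thesis
    by (simp add: poly_altdef exp_minus divide_inverse sum_distrib_left mult_ac)
qed

text \<open>Closing \<open>flat_exp\<close> under derivatives: with s = 1 / t the derivative in t is
  - s^2 times the derivative in s, so p(s) exp(-s) becomes s^2 (p - p')(s) exp(-s), which is again
  of this form. The case p = 1 is \<open>flat_exp\<close>.\<close>

definition flat_exp_family :: "real poly \<Rightarrow> real \<Rightarrow> real" where
  "flat_exp_family p t = (if t \<le> 0 then 0 else poly p (1 / t) * exp (- (1 / t)))"

lemma flat_exp_family_deriv:
  "(flat_exp_family p has_real_derivative flat_exp_family ([:0, 0, 1:] * (p - pderiv p)) t) (at t)"
    (is "(?e has_real_derivative ?e' t) (at t)")
proof -
  consider "t < 0" | "t = 0" | "t > 0" by linarith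
  then show ?thesis
  proof cases
    case 1
    have "((\<lambda>_. 0) has_real_derivative ?e' t) (at t)"
      using 1 by (simp add: flat_exp_family_def)
    then show ?thesis
      by (rule has_field_derivative_transform_within_open[of _ _ _ "{..<0}"])
         (use 1 in \<open>auto simp: flat_exp_family_def\<close>)
  next
    case 3
    have "((\<lambda>t. poly p (1 / t) * exp (- (1 / t))) has_real_derivative
        (poly (pderiv p) (1 / t) * (- (1 / t\<^sup>2))) * exp (- (1 / t)) + (exp (- (1 / t)) * (1 / t\<^sup>2)) * poly p (1 / t)) (at t)"
      using 3
      by (auto intro!: derivative_eq_intros DERIV_chain2[OF poly_DERIV] simp: power2_eq_square)
    moreover have "(poly (pderiv p) (1 / t) * (- (1 / t\<^sup>2))) * exp (- (1 / t)) + (exp (- (1 / t)) * (1 / t\<^sup>2)) * poly p (1 / t) = ?e' t"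
      using 3 by (simp add: flat_exp_family_def power2_eq_square algebra_simps)
    ultimately have "((\<lambda>t. poly p (1 / t) * exp (- (1 / t))) has_real_derivative ?e' t) (at t)"
      by simp
    then show ?thesis
      by (rule has_field_derivative_transform_within_open[of _ _ _ "{0<..}"])
         (use 3 in \<open>auto simp: flat_exp_family_def\<close>)
  next
    case 2
    have "((\<lambda>h. (?e h - ?e 0) / (h - 0)) \<longlongrightarrow> 0) (at (0::real))"
    proof (rule filterlim_split_at)
      show "((\<lambda>h. (?e h - ?e 0) / (h - 0)) \<longlongrightarrow> 0) (at_left (0::real))"
        by (rule tendsto_eventually) (auto simp: flat_exp_family_def eventually_at intro!: exI[of _ 1])
      \<comment> \<open>Division by h is multiplication by s = 1 / h, which \<open>pCons 0\<close>
        performs on the polynomial; the exponential beats it as s tends to infinity.\<close>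
      have "((\<lambda>h. poly (pCons 0 p) (inverse h) * exp (- (inverse h))) \<longlongrightarrow> 0) (at_right (0::real))"
        by (rule filterlim_compose[OF poly_mult_exp_tendsto_0 filterlim_inverse_at_top_right])
      then show "((\<lambda>h. (?e h - ?e 0) / (h - 0)) \<longlongrightarrow> 0) (at_right (0::real))"
        by (rule Lim_transform_eventually)
           (auto simp: flat_exp_family_def eventually_at divide_inverse intro!: exI[of _ 1])
    qed
    then show ?thesis
      using 2 by (simp add: has_field_derivative_iff flat_exp_family_def)
  qed
qed

lemma smooth_flat_exp:
  assumes "smooth f" shows "smooth (\<lambda>x. flat_exp (f x))"
proof (rule smooth_algebra_smooth[of "range flat_exp_family" UNIV])
  show "\<exists>h'\<in>range flat_exp_family. \<forall>t\<in>UNIV. (h has_real_derivative h' t) (at t)"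
    if "h \<in> range flat_exp_family" for h
    using that flat_exp_family_deriv by blast
  have "flat_exp = flat_exp_family [:1:]" by (auto simp: flat_exp_def flat_exp_family_def)
  then show "(\<lambda>x. flat_exp (f x)) \<in> smooth_algebra (range flat_exp_family) UNIV"
    by (simp add: smooth_algebra.comp[OF _ assms])
qed


section \<open>Test functions and their stability properties\<close>

lemma test_function_smooth: "test_function U \<phi> \<Longrightarrow> smooth \<phi>"
  by (simp add: test_function_def)

lemma smooth_continuous:
  assumes "smooth f" shows "continuous_on S f"
  using smooth_differentiable[OF assms] by (meson differentiable_imp_continuous_within continuous_at_imp_continuous_on)

lemma smooth_continuous_grad:
  assumes "smooth f" shows "continuous_on S (grad f)"
  unfolding grad_def using smooth_continuous[OF smooth_partial[OF assms]] by (intro continuous_on_vec_lambda)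

lemma grad_eq_0_outside:
  assumes "smooth f" "x \<notin> closure {x. f x \<noteq> 0}" shows "grad f x = 0"
proof (rule grad_eqI)
  have "((\<lambda>_. 0) has_derivative (\<lambda>v. 0 \<bullet> v)) (at x)" by simp
  then show "(f has_derivative (\<lambda>v. 0 \<bullet> v)) (at x)"
    by (rule has_derivative_transform_within_open[of _ _ _ _ "- closure {x. f x \<noteq> 0}"])
       (use assms(2) closure_subset[of "{x. f x \<noteq> 0}"] in auto)
qed

lemma test_function_eq_0:
  assumes "test_function U \<phi>" "x \<notin> U" shows "\<phi> x = 0" "grad \<phi> x = 0"
proof -
  have "x \<notin> closure {x. \<phi> x \<noteq> 0}" using assms by (auto simp: test_function_def)
  then show "\<phi> x = 0" "grad \<phi> x = 0"
    using assms closure_subset[of "{x. \<phi> x \<noteq> 0}"] grad_eq_0_outside[of \<phi> x] by (auto simp: test_function_def)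
qed

lemma test_function_bounded:
  assumes "test_function U \<phi>"
  obtains C where "C > 0" "\<And>x. \<bar>\<phi> x\<bar> \<le> C" "\<And>x. norm (grad \<phi> x) \<le> C"
proof -
  let ?K = "closure {x. \<phi> x \<noteq> 0}"
  have K: "compact ?K" and s: "smooth \<phi>" using assms by (auto simp: test_function_def)
  obtain C1 where C1: "C1 > 0" "\<And>x. x \<in> ?K \<Longrightarrow> norm (\<phi> x) \<le> C1"
    using compact_imp_bounded[OF compact_continuous_image[OF smooth_continuous[OF s] K]]
    by (auto simp: bounded_pos)
  obtain C2 where C2: "C2 > 0" "\<And>x. x \<in> ?K \<Longrightarrow> norm (grad \<phi> x) \<le> C2"
    using compact_imp_bounded[OF compact_continuous_image[OF smooth_continuous_grad[OF s] K]]
    by (auto simp: bounded_pos)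
  show thesis
  proof
    show "0 < max C1 C2" using C1 by simp
    show "\<bar>\<phi> x\<bar> \<le> max C1 C2" for x
      using C1 closure_subset[of "{x. \<phi> x \<noteq> 0}"] by (cases "x \<in> ?K") (force simp: max_def)+
    show "norm (grad \<phi> x) \<le> max C1 C2" for x
      using C1 C2(2)[of x] grad_eq_0_outside[OF s, of x] by (cases "x \<in> ?K") auto
  qed
qed

lemma test_function_subset:
  assumes "test_function U \<phi>" "smooth \<psi>" "\<And>x. \<phi> x = 0 \<Longrightarrow> \<psi> x = 0"
  shows "test_function U \<psi>"
proof -
  have "closure {x. \<psi> x \<noteq> 0} \<subseteq> closure {x. \<phi> x \<noteq> 0}"
    using assms(3) by (intro closure_mono) auto
  then show ?thesis
    using assms(1,2) unfolding test_function_def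
    by (meson closed_closure closed_subset compact_closure bounded_subset compact_eq_bounded_closed order_trans)
qed

lemma test_function_diff:
  assumes "test_function U \<phi>" "test_function U \<psi>"
  shows "test_function U (\<lambda>x. \<phi> x - \<psi> x)" "grad (\<lambda>x. \<phi> x - \<psi> x) x = grad \<phi> x - grad \<psi> x"
proof -
  have s: "smooth \<phi>" "smooth \<psi>" using assms by (auto simp: test_function_def)
  have "closure {x. \<phi> x - \<psi> x \<noteq> 0} \<subseteq> closure ({x. \<phi> x \<noteq> 0} \<union> {x. \<psi> x \<noteq> 0})"
    by (intro closure_mono) auto
  then have sub: "closure {x. \<phi> x - \<psi> x \<noteq> 0} \<subseteq> closure {x. \<phi> x \<noteq> 0} \<union> closure {x. \<psi> x \<noteq> 0}"
    by (simp add: closure_Un)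
  have "compact (closure {x. \<phi> x \<noteq> 0} \<union> closure {x. \<psi> x \<noteq> 0})"
    using assms by (auto simp: test_function_def)
  then have "compact (closure {x. \<phi> x - \<psi> x \<noteq> 0})"
    using sub by (meson bounded_subset closed_closure compact_eq_bounded_closed)
  moreover have "smooth (\<lambda>x. \<phi> x - \<psi> x)"
    using smooth_add[OF s(1) smooth_mult[OF smooth_const[of "-1"] s(2)]] by simp
  ultimately show "test_function U (\<lambda>x. \<phi> x - \<psi> x)"
    using sub assms by (auto simp: test_function_def)
  show "grad (\<lambda>x. \<phi> x - \<psi> x) x = grad \<phi> x - grad \<psi> x"
    using has_derivative_diff[OF s[THEN smooth_has_derivative]]
    by (intro grad_eqI) (simp add: inner_diff_left)
qed

text \<open>The cutoff is a product over the faces of \<open>flat_exp\<close> of n times the signed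
  distance to the face. It vanishes outside the box, and inside each factor exp(-1 / (n c)) with c >
  0 tends to 1. The closed box has to lie in \<open>U\<close>, because it contains the closure of
  the support.\<close>

lemma box_indicator_approx:
  fixes a b :: "real^'d::finite"
  assumes "cbox a b \<subseteq> U"
  obtains \<phi> :: "nat \<Rightarrow> real^'d \<Rightarrow> real"
  where "\<And>n. test_function U (\<phi> n)" "\<And>n x. \<bar>\<phi> n x\<bar> \<le> indicator (box a b) x"
    "\<And>x. (\<lambda>n. \<phi> n x) \<longlonglongrightarrow> indicator (box a b) x"
proof -
  define \<phi> where "\<phi> n x = (\<Prod>i\<in>UNIV. flat_exp (real n * (x $ i - a $ i)) * flat_exp (real n * (b $ i - x $ i)))"
    for n :: nat and x :: "real^'d"
  have range: "0 \<le> flat_exp t" "flat_exp t \<le> 1" for t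
    by (auto simp: flat_exp_def)
  have s: "smooth (\<phi> n)" for n
    unfolding \<phi>_def
  proof (rule smooth_prod, simp, rule smooth_mult; rule smooth_flat_exp)
    fix i
    show "smooth (\<lambda>x::real^'d. real n * (x $ i - a $ i))"
      using smooth_affine[of "real n" i "- real n * a $ i"] by (simp add: algebra_simps)
    show "smooth (\<lambda>x::real^'d. real n * (b $ i - x $ i))"
      using smooth_affine[of "- real n" i "real n * b $ i"] by (simp add: algebra_simps)
  qed
  have out: "\<phi> n x = 0" if x: "x \<notin> box a b" for n x
  proof -
    obtain i where "x $ i \<le> a $ i \<or> b $ i \<le> x $ i"
      using x by (auto simp: mem_box_cart not_less)
    then have "flat_exp (real n * (x $ i - a $ i)) * flat_exp (real n * (b $ i - x $ i)) = 0"
      by (auto simp: flat_exp_def mult_le_0_iff zero_less_mult_iff not_le)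
    then show ?thesis unfolding \<phi>_def by (intro prod_zero) auto
  qed
  show thesis
  proof
    fix n
    have "closure {x. \<phi> n x \<noteq> 0} \<subseteq> cbox a b"
      using out box_subset_cbox[of a b] by (intro closure_minimal) auto
    then show "test_function U (\<phi> n)"
      using s assms unfolding test_function_def
      by (meson bounded_cbox bounded_subset closed_closure compact_eq_bounded_closed order_trans)
  next
    fix n x
    have "0 \<le> \<phi> n x" "\<phi> n x \<le> 1"
      unfolding \<phi>_def using range by (auto intro!: prod_nonneg prod_le_1 mult_le_one)
    then show "\<bar>\<phi> n x\<bar> \<le> indicator (box a b) x"
      using out[of x n] by (auto simp: indicator_def)
  next
    fix x
    show "(\<lambda>n. \<phi> n x) \<longlonglongrightarrow> indicator (box a b) x"
    proof (cases "x \<in> box a b")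
      case False
      then show ?thesis using out by simp
    next
      case True
      have lim: "(\<lambda>n. flat_exp (real n * c)) \<longlonglongrightarrow> 1" if "c > 0" for c
      proof -
        have "(\<lambda>n. exp (- (1 / c * (1 / real n)))) \<longlonglongrightarrow> exp (- (1 / c * 0))"
          by (intro tendsto_intros lim_1_over_n)
        then have "(\<lambda>n. exp (- (1 / c * (1 / real n)))) \<longlonglongrightarrow> 1" by simp
        then show ?thesis
          by (rule Lim_transform_eventually)
             (use that in \<open>auto simp: flat_exp_def eventually_sequentially mult_le_0_iff mult.commute intro!: exI[of _ 1]\<close>)
      qed
      have "(\<lambda>n. \<phi> n x) \<longlonglongrightarrow> (\<Prod>i\<in>(UNIV::'d set). 1 * 1)"
        unfolding \<phi>_def using True by (intro tendsto_prod tendsto_mult lim) (auto simp: mem_box_cart)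
      then show ?thesis using True by simp
    qed
  qed
qed

section \<open>The fundamental lemma of the calculus of variations\<close>

text \<open>The positive and the negative part of \<open>k\<close> are densities of two finite
  measures that agree on open boxes. Boxes form a generator stable under intersection, so the
  measures coincide, and so do their densities almost everywhere.\<close>

lemma AE_zero_of_integral_box:
  fixes k :: "'a::euclidean_space \<Rightarrow> real"
  assumes k: "integrable lborel k" and box: "\<And>a b. (\<integral>x. indicator (box a b) x * k x \<partial>lborel) = 0"
  shows "AE x in lborel. k x = 0"
proof -
  have [measurable]: "k \<in> borel_measurable lborel" using k by simp
  let ?M = "density lborel (\<lambda>x. ennreal (k x))" and ?N = "density lborel (\<lambda>x. ennreal (- k x))"
  have fin: "(\<integral>\<^sup>+x. ennreal (k x) \<partial>lborel) < \<infinity>" "(\<integral>\<^sup>+x. ennreal (- k x) \<partial>lborel) < \<infinity>"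
    using integrableD(2,3)[OF k] by (auto simp: less_top)
  have le: "emeasure ?M X \<le> (\<integral>\<^sup>+x. ennreal (k x) \<partial>lborel)" if [measurable]: "X \<in> sets borel" for X
    by (auto simp: emeasure_density intro!: nn_integral_mono split: split_indicator)
  have eq: "emeasure ?M (box a b) = emeasure ?N (box a b)" for a b
  proof -
    let ?g = "\<lambda>x. indicator (box a b) x * k x"
    have int: "integrable lborel ?g"
      by (rule Bochner_Integration.integrable_bound[OF k]) (auto split: split_indicator)
    have 1: "emeasure ?M (box a b) = (\<integral>\<^sup>+x. ennreal (?g x) \<partial>lborel)"
      by (auto simp: emeasure_density intro!: nn_integral_cong split: split_indicator)
    have 2: "emeasure ?N (box a b) = (\<integral>\<^sup>+x. ennreal (- ?g x) \<partial>lborel)"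
      by (auto simp: emeasure_density intro!: nn_integral_cong split: split_indicator)
    have "enn2real (\<integral>\<^sup>+x. ennreal (?g x) \<partial>lborel) = enn2real (\<integral>\<^sup>+x. ennreal (- ?g x) \<partial>lborel)"
      using box[of a b] real_lebesgue_integral_def[OF int] by simp
    moreover have "(\<integral>\<^sup>+x. ennreal (?g x) \<partial>lborel) < top" "(\<integral>\<^sup>+x. ennreal (- ?g x) \<partial>lborel) < top"
      using integrableD(2,3)[OF int] by (auto simp: less_top)
    ultimately show ?thesis
      unfolding 1 2 using ennreal_enn2real by (metis (no_types))
  qed
  have "?M = ?N"
  proof (rule measure_eqI_generator_eq[where \<Omega> = UNIV])
    show "Int_stable (range (\<lambda>(a, b). box a b :: 'a set))"
      unfolding Int_stable_def by (force simp: box_Int_box)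
    show "range (\<lambda>i::nat. box (- (real i *\<^sub>R One)) (real i *\<^sub>R One)) \<subseteq> range (\<lambda>(a, b). box a b :: 'a set)"
      by auto
    show "(\<Union>i::nat. box (- (real i *\<^sub>R One)) (real i *\<^sub>R One)) = (UNIV :: 'a set)"
      by (rule UN_box_eq_UNIV)
    show "emeasure ?M (box (- (real i *\<^sub>R One)) (real i *\<^sub>R One)) \<noteq> \<infinity>" for i :: nat
      using le_less_trans[OF le fin(1)] by (simp add: less_top)
  qed (auto simp: eq borel_eq_box)
  then have "AE x in lborel. ennreal (k x) = ennreal (- k x)"
    by (rule sigma_finite_measure.density_unique[OF sigma_finite_lborel, rotated 2]) auto
  then show ?thesis
  proof eventually_elim
    fix x assume "ennreal (k x) = ennreal (- k x)"
    \<comment> \<open>\<open>ennreal\<close> sends negative reals to 0, so one of the two equal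
      values is 0 and the other is the absolute value of \<open>k x\<close>.\<close>
    then show "k x = 0" by (cases "0 \<le> k x") (auto simp: ennreal_neg ennreal_eq_0_iff)
  qed
qed

text \<open>The uniqueness argument for densities runs on \<open>lborel\<close>; a Borel
  representative of \<open>h\<close> carries the result over to the completed measure.\<close>

lemma AE_zero_of_integral_box_lebesgue:
  fixes h :: "'a::euclidean_space \<Rightarrow> real"
  assumes h: "integrable lebesgue h" and box: "\<And>a b. (\<integral>x. indicator (box a b) x * h x \<partial>lebesgue) = 0"
  shows "AE x in lebesgue. h x = 0"
proof -
  have "h \<in> borel_measurable (completion lborel)" using h by simp
  from completion_ex_borel_measurable_real[OF this]
  obtain k where [measurable]: "k \<in> borel_measurable lborel" and hk: "AE x in lborel. h x = k x" by auto
  have hk': "AE x in lebesgue. h x = k x" by (rule AE_completion[OF hk])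
  have "integrable lebesgue k"
    using h hk' by (subst integrable_cong_AE[of k _ h]) (auto intro: measurable_completion)
  then have int: "integrable lborel k" by (simp add: integrable_completion)
  have "(\<integral>x. indicator (box a b) x * k x \<partial>lborel) = 0" for a b
  proof -
    have "(\<integral>x. indicator (box a b) x * k x \<partial>lborel) = (\<integral>x. indicator (box a b) x * k x \<partial>lebesgue)"
      by (rule integral_completion[symmetric]) auto
    also have "\<dots> = (\<integral>x. indicator (box a b) x * h x \<partial>lebesgue)"
    proof (rule integral_cong_AE)
      have [measurable]: "h \<in> borel_measurable lebesgue" "k \<in> borel_measurable lebesgue"
        using h by (auto intro: measurable_completion)
      have [measurable]: "box a b \<in> sets lebesgue" by simp
      show "(\<lambda>x. indicator (box a b) x * k x) \<in> borel_measurable lebesgue"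
        "(\<lambda>x. indicator (box a b) x * h x) \<in> borel_measurable lebesgue"
        by measurable
    qed (use hk' in auto)
    finally show ?thesis using box by simp
  qed
  then have "AE x in lborel. k x = 0" using int by (rule AE_zero_of_integral_box[rotated])
  from AE_completion[OF this] hk' show ?thesis by eventually_elim simp
qed

text \<open>Makes pairings with test functions meaningful when only local integrability is known:
  everything happens on the compact set \<open>K\<close>, where \<psi> is bounded.\<close>

lemma absolutely_integrable_times_test:
  fixes h \<psi> :: "'a::euclidean_space \<Rightarrow> real"
  assumes K: "compact K" "K \<subseteq> U" "U \<in> sets lebesgue" and h: "h absolutely_integrable_on K"
    and \<psi>: "continuous_on UNIV \<psi>" "\<And>x. x \<notin> K \<Longrightarrow> \<psi> x = 0"
  shows "integrable (lebesgue_on U) (\<lambda>x. h x * \<psi> x)"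
    and "(\<integral>x. h x * \<psi> x \<partial>lebesgue_on U) = (\<integral>x. (indicator K x * h x) * \<psi> x \<partial>lebesgue)"
proof -
  have eq: "indicator U x * (h x * \<psi> x) = (indicator K x * h x) * \<psi> x" for x
    using K(2) \<psi>(2)[of x] by (auto split: split_indicator)
  obtain C where C: "\<And>x. x \<in> K \<Longrightarrow> norm (\<psi> x) \<le> C"
    using compact_imp_bounded[OF compact_continuous_image[OF continuous_on_subset[OF \<psi>(1)] K(1)]]
    by (auto simp: bounded_iff)
  have int: "integrable lebesgue (\<lambda>x. indicator K x * h x)"
    using h by (simp add: set_integrable_def)
  have "integrable lebesgue (\<lambda>x. (indicator K x * h x) * \<psi> x)"
  proof (rule Bochner_Integration.integrable_bound[OF integrable_mult_right[OF integrable_norm[OF int], of C]])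
    show "(\<lambda>x. indicator K x * h x * \<psi> x) \<in> borel_measurable lebesgue"
      using \<psi>(1) by (intro borel_measurable_times[OF borel_measurable_integrable[OF int]] measurable_completion)
        (auto intro: borel_measurable_continuous_onI)
    show "AE x in lebesgue. norm (indicator K x * h x * \<psi> x) \<le> norm (C * norm (indicator K x * h x))"
    proof (intro AE_I2)
      fix x
      show "norm (indicator K x * h x * \<psi> x) \<le> norm (C * norm (indicator K x * h x))"
      proof (cases "x \<in> K")
        case True
        then have "\<bar>\<psi> x\<bar> * \<bar>h x\<bar> \<le> \<bar>C\<bar> * \<bar>h x\<bar>"
          using C[OF True] by (intro mult_right_mono) auto
        then show ?thesis using True by (simp add: abs_mult mult.commute)
      qed simp
    qed
  qed
  then show "integrable (lebesgue_on U) (\<lambda>x. h x * \<psi> x)"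
    using K(3) by (simp add: integrable_restrict_space eq)
  show "(\<integral>x. h x * \<psi> x \<partial>lebesgue_on U) = (\<integral>x. (indicator K x * h x) * \<psi> x \<partial>lebesgue)"
    using K(3) by (simp add: integral_restrict_space eq)
qed

text \<open>Local integrability gives no integral over \<open>U\<close>. On a closed box inside
  \<open>U\<close>, however, \<open>h\<close> extended by zero is integrable, and its integrals over
  open boxes are limits of pairings with the smooth cutoffs. Countably many closed boxes exhaust
  \<open>U\<close>.\<close>

lemma fundamental_lemma_variations:
  fixes h :: "real^'d::finite \<Rightarrow> real"
  assumes U: "open U" and h: "\<And>K. compact K \<Longrightarrow> K \<subseteq> U \<Longrightarrow> h absolutely_integrable_on K"
    and zero: "\<And>\<phi>. test_function U \<phi> \<Longrightarrow> (\<integral>x. h x * \<phi> x \<partial>lebesgue_on U) = 0"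
  shows "AE x in lebesgue_on U. h x = 0"
proof -
  have Us: "U \<in> sets lebesgue" using U by simp
  have cb: "AE x in lebesgue. x \<in> cbox a b \<longrightarrow> h x = 0" if ab: "cbox a b \<subseteq> U" for a b
  proof -
    let ?H = "\<lambda>x. indicator (cbox a b) x * h x"
    have int: "integrable lebesgue ?H"
      using h[of "cbox a b"] ab by (simp add: set_integrable_def)
    have "(\<integral>x. indicator (box c d) x * ?H x \<partial>lebesgue) = 0" for c d
    proof -
      \<comment> \<open>The intersection of two open boxes is an open box, for which cutoffs are
        available; passing from the closed to the open box changes only a null set.\<close>
      obtain e f where ef: "box a b \<inter> box c d = box e f"
        using box_Int_box[of a b c d] by blast
      have ae: "AE x in lebesgue. indicator (box c d) x * ?H x = ?H x * indicator (box e f) x"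
      proof (rule AE_I'[of "cbox a b - box a b"])
        show "cbox a b - box a b \<in> null_sets lebesgue"
          using negligible_frontier_interval negligible_iff_null_sets by blast
        have "indicator (box c d) x * ?H x = ?H x * indicator (box e f) x" if "x \<notin> cbox a b - box a b" for x
        proof -
          have "x \<in> cbox a b \<longleftrightarrow> x \<in> box a b" using that box_subset_cbox[of a b] by blast
          then show ?thesis unfolding ef[symmetric] by (simp add: indicator_def)
        qed
        then show "{x \<in> space lebesgue. indicator (box c d) x * ?H x \<noteq> ?H x * indicator (box e f) x} \<subseteq> cbox a b - box a b"
          by blast
      qed
      have "(\<integral>x. indicator (box c d) x * ?H x \<partial>lebesgue) = (\<integral>x. ?H x * indicator (box e f) x \<partial>lebesgue)"
        by (rule integral_cong_AE[OF borel_measurable_times[OF _ borel_measurable_integrable[OF int]]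
              borel_measurable_times[OF borel_measurable_integrable[OF int]] ae])
             (auto intro!: borel_measurable_indicator)
      also have "\<dots> = 0"
      proof (cases "box e f = {}")
        case False
        then have "cbox e f = closure (box e f)" by (simp add: closure_box)
        also have "\<dots> \<subseteq> cbox a b" using ef box_subset_cbox[of a b] by (intro closure_minimal) auto
        finally have sub: "cbox e f \<subseteq> cbox a b" .
        obtain \<phi> where \<phi>: "\<And>n. test_function U (\<phi> n)" "\<And>n x. \<bar>\<phi> n x\<bar> \<le> indicator (box e f) x"
            "\<And>x. (\<lambda>n. \<phi> n x) \<longlonglongrightarrow> indicator (box e f) x"
          by (rule box_indicator_approx[OF order_trans[OF sub ab]]) blast
        have cont: "continuous_on UNIV (\<phi> n)" for n
          using \<phi>(1) smooth_continuous test_function_smooth by blast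
        have "(\<lambda>n. \<integral>x. ?H x * \<phi> n x \<partial>lebesgue) \<longlonglongrightarrow> (\<integral>x. ?H x * indicator (box e f) x \<partial>lebesgue)"
        proof (rule integral_dominated_convergence[OF _ _ integrable_norm[OF int]])
          show "(\<lambda>x. ?H x * indicator (box e f) x) \<in> borel_measurable lebesgue"
            by (intro borel_measurable_times[OF borel_measurable_integrable[OF int]])
              (auto intro!: borel_measurable_indicator)
          show "(\<lambda>x. ?H x * \<phi> n x) \<in> borel_measurable lebesgue" for n
            using cont[of n] by (intro borel_measurable_times[OF borel_measurable_integrable[OF int]] measurable_completion)
              (auto intro: borel_measurable_continuous_onI)
          show "AE x in lebesgue. (\<lambda>n. ?H x * \<phi> n x) \<longlonglongrightarrow> ?H x * indicator (box e f) x"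
            by (intro AE_I2 tendsto_intros \<phi>(3))
          show "AE x in lebesgue. norm (?H x * \<phi> n x) \<le> norm (?H x)" for n
          proof (intro AE_I2)
            fix x
            have "\<bar>\<phi> n x\<bar> \<le> 1" using \<phi>(2)[of n x] by (auto split: split_indicator_asm)
            then show "norm (?H x * \<phi> n x) \<le> norm (?H x)"
              by (simp add: abs_mult mult_left_le)
          qed
        qed
        moreover have "(\<integral>x. ?H x * \<phi> n x \<partial>lebesgue) = 0" for n
        proof -
          have "\<phi> n x = 0" if "x \<notin> cbox a b" for x
            using that \<phi>(2)[of n x] sub box_subset_cbox[of e f] by (auto split: split_indicator_asm)
          then show ?thesis
            using absolutely_integrable_times_test(2)[OF compact_cbox ab Us h[OF compact_cbox ab] cont[of n]] zero[OF \<phi>(1)[of n]]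
            by simp
        qed
        ultimately show ?thesis by (simp add: LIMSEQ_const_iff)
      qed simp
      finally show ?thesis .
    qed
    from AE_zero_of_integral_box_lebesgue[OF int this]
    show ?thesis by eventually_elim (auto split: split_indicator_asm)
  qed
  obtain \<D> where \<D>: "countable \<D>" "\<D> \<subseteq> Pow U" "\<And>X. X \<in> \<D> \<Longrightarrow> \<exists>a b. X = cbox a b" "\<Union>\<D> = U"
    using open_countable_Union_open_cbox[OF U] by blast
  have "AE x in lebesgue. \<forall>X\<in>\<D>. x \<in> X \<longrightarrow> h x = 0"
    unfolding AE_ball_countable[OF \<D>(1)]
  proof
    fix X assume X: "X \<in> \<D>"
    then obtain a b where "X = cbox a b" "cbox a b \<subseteq> U" using \<D>(2,3) by blast
    then show "AE x in lebesgue. x \<in> X \<longrightarrow> h x = 0" using cb by simp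
  qed
  then have "AE x in lebesgue. x \<in> U \<longrightarrow> h x = 0"
    by eventually_elim (use \<D>(4) in blast)
  then show ?thesis using Us by (simp add: AE_restrict_space_iff)
qed

text \<open>Integration by parts without boundary term: the difference quotients have integral zero
  by translation invariance of Lebesgue measure, and they converge to the partial derivative under a
  common majorant.\<close>

lemma integral_partial_eq_0:
  fixes f :: "real^'d::finite \<Rightarrow> real"
  assumes f: "smooth f" and K: "compact (closure {x. f x \<noteq> 0})"
  shows "(\<integral>x. partial i f x \<partial>lborel) = 0"
proof -
  let ?K = "closure {x. f x \<noteq> 0}"
  define e :: "real^'d" where "e = axis i 1"
  have e: "norm e = 1" by (simp add: e_def)
  have tf: "test_function UNIV f" using f K by (simp add: test_function_def)
  obtain C where C: "C > 0" "\<And>x. norm (grad f x) \<le> C"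
    using test_function_bounded[OF tf] by metis
  obtain R where R: "\<And>x. x \<in> ?K \<Longrightarrow> norm x \<le> R"
    using compact_imp_bounded[OF K] by (auto simp: bounded_iff)
  have cont: "continuous_on UNIV f" by (rule smooth_continuous[OF f])
  have contp: "continuous_on UNIV (partial i f)" by (rule smooth_continuous[OF smooth_partial[OF f]])
  have [measurable]: "f \<in> borel_measurable borel" "partial i f \<in> borel_measurable borel"
    using cont contp by (auto intro: borel_measurable_continuous_onI)
  have out: "f x = 0" if "norm x > R" for x
    using R[of x] that closure_subset[of "{x. f x \<noteq> 0}"] by force
  have intf: "integrable lborel f"
  proof -
    have "integrable lborel (\<lambda>x. indicator ?K x *\<^sub>R f x)"
      using borel_integrable_compact[OF K continuous_on_subset[OF cont]] by simp
    moreover have "(\<lambda>x. indicator ?K x *\<^sub>R f x) = f"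
      using closure_subset[of "{x. f x \<noteq> 0}"] by (auto simp: fun_eq_iff split: split_indicator)
    ultimately show ?thesis by simp
  qed
  define t where "t n = 1 / real (Suc n)" for n
  have t: "0 < t n" "t n \<le> 1" for n by (auto simp: t_def)
  define D where "D n x = (f (x + t n *\<^sub>R e) - f x) / t n" for n x
  have Df: "((\<lambda>s. f (x + s *\<^sub>R e)) has_real_derivative grad f (x + s *\<^sub>R e) \<bullet> e) (at s)" for x s
  proof -
    have "((\<lambda>s. x + s *\<^sub>R e) has_derivative (\<lambda>s. s *\<^sub>R e)) (at s)"
      by (auto intro!: derivative_eq_intros)
    from has_derivative_compose[OF this smooth_has_derivative[OF f]]
    show ?thesis by (simp add: has_field_derivative_def mult_commute_abs)
  qed
  have int0: "(\<integral>x. D n x \<partial>lborel) = 0" for n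
  proof -
    have "integrable lborel (\<lambda>x. f (t n *\<^sub>R e + x))"
      using intf by (subst (asm) lborel_distr_plus[of "t n *\<^sub>R e", symmetric]) (simp add: integrable_distr_eq)
    moreover have "(\<integral>x. f (t n *\<^sub>R e + x) \<partial>lborel) = (\<integral>x. f x \<partial>lborel)"
      by (subst (2) lborel_distr_plus[of "t n *\<^sub>R e", symmetric]) (simp add: integral_distr)
    ultimately show ?thesis
      using intf by (simp add: D_def add.commute)
  qed
  have "(\<lambda>n. \<integral>x. D n x \<partial>lborel) \<longlonglongrightarrow> (\<integral>x. partial i f x \<partial>lborel)"
  \<comment> \<open>The mean value theorem bounds the quotients by \<open>C\<close>. The increments
    are at most 1, so the quotients vanish outside the ball of radius R + 1.\<close>
  proof (rule integral_dominated_convergence[where w = "\<lambda>x. indicator (cball 0 (R + 1)) x *\<^sub>R C"])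
    show "integrable lborel (\<lambda>x. indicator (cball (0::real^'d) (R + 1)) x *\<^sub>R C)"
      by (rule borel_integrable_compact) auto
    show "AE x in lborel. (\<lambda>n. D n x) \<longlonglongrightarrow> partial i f x"
    proof (intro AE_I2)
      fix x
      have "((\<lambda>s. f (x + s *\<^sub>R e)) has_real_derivative partial i f x) (at 0)"
        using Df[of x 0] by (simp add: e_def grad_def inner_axis)
      then have "((\<lambda>s. (f (x + s *\<^sub>R e) - f x) / s) \<longlongrightarrow> partial i f x) (at 0)"
        by (simp add: has_field_derivative_iff)
      moreover have "filterlim t (at 0) sequentially"
      proof -
        have "t = (\<lambda>n. inverse (real (Suc n)))" by (auto simp: t_def divide_inverse)
        then show ?thesis using LIMSEQ_inverse_real_of_nat t(1) less_imp_neq[OF t(1)]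
          by (auto simp: filterlim_at simp del: of_nat_Suc intro!: always_eventually)
      qed
      ultimately show "(\<lambda>n. D n x) \<longlonglongrightarrow> partial i f x"
        unfolding D_def by (rule filterlim_compose)
    qed
    show "AE x in lborel. norm (D n x) \<le> indicator (cball 0 (R + 1)) x *\<^sub>R C" for n
    proof (intro AE_I2)
      fix x
      show "norm (D n x) \<le> indicator (cball 0 (R + 1)) x *\<^sub>R C"
      proof (cases "x \<in> cball 0 (R + 1)")
        case False
        then have "norm x > R + 1" by simp
        moreover have "norm (x + t n *\<^sub>R e) \<ge> norm x - 1"
          using norm_diff_ineq[of x "t n *\<^sub>R e"] e t[of n] by simp
        ultimately show ?thesis using out[of x] out[of "x + t n *\<^sub>R e"] by (simp add: D_def)
      next
        case True
        obtain z where z: "f (x + t n *\<^sub>R e) - f (x + 0 *\<^sub>R e) = (t n - 0) * (grad f (x + z *\<^sub>R e) \<bullet> e)"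
          using MVT2[of 0 "t n" "\<lambda>s. f (x + s *\<^sub>R e)" "\<lambda>s. grad f (x + s *\<^sub>R e) \<bullet> e"] Df t[of n] by metis
        have "\<bar>grad f (x + z *\<^sub>R e) \<bullet> e\<bar> \<le> C"
          using Cauchy_Schwarz_ineq2[of "grad f (x + z *\<^sub>R e)" e] C(2)[of "x + z *\<^sub>R e"] e by simp
        then show ?thesis using True z t[of n] by (simp add: D_def)
      qed
    qed
  qed (simp_all add: D_def)
  then show ?thesis by (simp add: int0 LIMSEQ_const_iff)
qed

section \<open>Square integrable functions\<close>

definition sq_int :: "'a measure \<Rightarrow> ('a \<Rightarrow> 'b::euclidean_space) \<Rightarrow> bool" where
  "sq_int M f \<longleftrightarrow> f \<in> borel_measurable M \<and> integrable M (\<lambda>x. (norm (f x))\<^sup>2)"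

text \<open>Real valued, so that differences and limits of norms can be formed. The integral of a
  function that is not integrable is 0, hence \<open>l2\<close> is the norm only in company with
  \<open>sq_int\<close>.\<close>

definition l2 :: "'a measure \<Rightarrow> ('a \<Rightarrow> 'b::euclidean_space) \<Rightarrow> real" where
  "l2 M f = sqrt (\<integral>x. (norm (f x))\<^sup>2 \<partial>M)"

lemma l2_nonneg [simp]: "0 \<le> l2 M f"
  by (simp add: l2_def)

lemma l2_power2: "(l2 M f)\<^sup>2 = (\<integral>x. (norm (f x))\<^sup>2 \<partial>M)"
  by (simp add: l2_def)

lemma sq_int_measurable: "sq_int M f \<Longrightarrow> f \<in> borel_measurable M"
  by (simp add: sq_int_def)

lemma sq_int_integrable: "sq_int M f \<Longrightarrow> integrable M (\<lambda>x. (norm (f x))\<^sup>2)"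
  by (simp add: sq_int_def)

lemma sq_int_bound:
  assumes "sq_int M f" "g \<in> borel_measurable M" "AE x in M. norm (g x) \<le> c * norm (f x)"
  shows "sq_int M g"
  unfolding sq_int_def
proof
  show "integrable M (\<lambda>x. (norm (g x))\<^sup>2)"
  proof (rule Bochner_Integration.integrable_bound[OF integrable_mult_right[OF sq_int_integrable[OF assms(1)], of "c\<^sup>2"]])
    show "AE x in M. norm ((norm (g x))\<^sup>2) \<le> norm (c\<^sup>2 * (norm (f x))\<^sup>2)"
      using assms(3)
    proof eventually_elim
      fix x assume "norm (g x) \<le> c * norm (f x)"
      then have "(norm (g x))\<^sup>2 \<le> (c * norm (f x))\<^sup>2" by (rule power_mono) simp
      then show "norm ((norm (g x))\<^sup>2) \<le> norm (c\<^sup>2 * (norm (f x))\<^sup>2)"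
        by (simp add: power_mult_distrib)
    qed
  qed (use assms(2) in measurable)
qed (rule assms(2))

lemma sq_int_cong_AE:
  assumes "sq_int M f" "g \<in> borel_measurable M" "AE x in M. g x = f x"
  shows "sq_int M g" "l2 M g = l2 M f"
proof -
  show "sq_int M g"
    by (rule sq_int_bound[OF assms(1,2), of 1]) (use assms(3) in auto)
  show "l2 M g = l2 M f"
    unfolding l2_def using assms sq_int_measurable[OF assms(1)] by (intro arg_cong[where f = sqrt] integral_cong_AE) auto
qed

lemma sq_int_add:
  assumes "sq_int M f" "sq_int M g" shows "sq_int M (\<lambda>x. f x + g x)"
  unfolding sq_int_def
proof
  have [measurable]: "f \<in> borel_measurable M" "g \<in> borel_measurable M" using assms by (auto simp: sq_int_def)
  show "(\<lambda>x. f x + g x) \<in> borel_measurable M" by measurable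
  have "integrable M (\<lambda>x. 2 * (norm (f x))\<^sup>2 + 2 * (norm (g x))\<^sup>2)"
    using assms by (auto simp: sq_int_def)
  then show "integrable M (\<lambda>x. (norm (f x + g x))\<^sup>2)"
  proof (rule Bochner_Integration.integrable_bound)
    show "AE x in M. norm ((norm (f x + g x))\<^sup>2) \<le> norm (2 * (norm (f x))\<^sup>2 + 2 * (norm (g x))\<^sup>2)"
    proof (intro AE_I2)
      fix x
      have "(norm (f x + g x))\<^sup>2 \<le> (norm (f x) + norm (g x))\<^sup>2"
        by (intro power_mono norm_triangle_ineq) simp
      also have "\<dots> \<le> 2 * (norm (f x))\<^sup>2 + 2 * (norm (g x))\<^sup>2"
        using sum_squares_bound[of "norm (f x)" "norm (g x)"] by (simp add: power2_sum)
      finally show "norm ((norm (f x + g x))\<^sup>2) \<le> norm (2 * (norm (f x))\<^sup>2 + 2 * (norm (g x))\<^sup>2)" by simp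
    qed
  qed measurable
qed

lemma sq_int_scaleR:
  assumes "sq_int M f" shows "sq_int M (\<lambda>x. c *\<^sub>R f x)"
  using assms by (auto simp: sq_int_def power_mult_distrib)

lemma sq_int_minus: "sq_int M f \<Longrightarrow> sq_int M (\<lambda>x. - f x)"
  using sq_int_scaleR[of M f "-1"] by simp

lemma sq_int_diff:
  assumes "sq_int M f" "sq_int M g" shows "sq_int M (\<lambda>x. f x - g x)"
  using sq_int_add[OF assms(1) sq_int_minus[OF assms(2)]] by simp

lemma nn_integral_norm_power2:
  "sq_int M f \<Longrightarrow> (\<integral>\<^sup>+x. ennreal (norm (f x)) ^ 2 \<partial>M) = ennreal ((l2 M f)\<^sup>2)"
  unfolding l2_power2 sq_int_def by (subst nn_integral_eq_integral[symmetric]) (auto simp: ennreal_power)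

lemma Cauchy_Schwarz_l2_nn:
  assumes "sq_int M f" "sq_int M g"
  shows "(\<integral>\<^sup>+x. ennreal (norm (f x) * norm (g x)) \<partial>M) \<le> ennreal (l2 M f * l2 M g)"
proof -
  have [measurable]: "f \<in> borel_measurable M" "g \<in> borel_measurable M" using assms by (auto simp: sq_int_def)
  have "(\<integral>\<^sup>+x. ennreal (norm (f x) * norm (g x)) \<partial>M)\<^sup>2 \<le> ennreal ((l2 M f)\<^sup>2) * ennreal ((l2 M g)\<^sup>2)"
    using Cauchy_Schwarz_nn_integral[of "\<lambda>x. ennreal (norm (f x))" M "\<lambda>x. ennreal (norm (g x))"]
    by (simp add: nn_integral_norm_power2 assms ennreal_mult')
  also have "\<dots> = (ennreal (l2 M f * l2 M g))\<^sup>2"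
    by (simp add: ennreal_power power_mult_distrib flip: ennreal_mult)
  finally have le: "(\<integral>\<^sup>+x. ennreal (norm (f x) * norm (g x)) \<partial>M)\<^sup>2 \<le> (ennreal (l2 M f * l2 M g))\<^sup>2" .
  show ?thesis
  proof (cases "\<integral>\<^sup>+x. ennreal (norm (f x) * norm (g x)) \<partial>M")
    case (real r)
    then have "r\<^sup>2 \<le> (l2 M f * l2 M g)\<^sup>2" using le by (simp add: ennreal_power ennreal_le_iff)
    then show ?thesis using real power2_le_imp_le[of r "l2 M f * l2 M g"] by (simp add: ennreal_leI)
  next
    case top
    then show ?thesis using le by (simp add: ennreal_power power2_eq_square top_unique flip: ennreal_mult)
  qed
qed

lemma Cauchy_Schwarz_l2_norm:
  assumes "sq_int M f" "sq_int M g"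
  shows "integrable M (\<lambda>x. norm (f x) * norm (g x))" "(\<integral>x. norm (f x) * norm (g x) \<partial>M) \<le> l2 M f * l2 M g"
proof -
  have [measurable]: "f \<in> borel_measurable M" "g \<in> borel_measurable M" using assms by (auto simp: sq_int_def)
  show *: "integrable M (\<lambda>x. norm (f x) * norm (g x))"
    by (rule integrableI_bounded)
       (use le_less_trans[OF Cauchy_Schwarz_l2_nn[OF assms] ennreal_less_top] in \<open>auto simp: abs_mult\<close>)
  have "ennreal (\<integral>x. norm (f x) * norm (g x) \<partial>M) \<le> ennreal (l2 M f * l2 M g)"
    using Cauchy_Schwarz_l2_nn[OF assms] by (subst nn_integral_eq_integral[OF *, symmetric]) auto
  then show "(\<integral>x. norm (f x) * norm (g x) \<partial>M) \<le> l2 M f * l2 M g"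
    by (simp add: ennreal_le_iff)
qed

lemma integrable_bilinear_l2:
  fixes h :: "'a \<Rightarrow> real"
  assumes "sq_int M f" "sq_int M g" "h \<in> borel_measurable M" "AE x in M. norm (h x) \<le> norm (f x) * norm (g x)"
  shows "integrable M h" "norm (\<integral>x. h x \<partial>M) \<le> l2 M f * l2 M g"
proof -
  show *: "integrable M h"
    using assms(4) by (intro Bochner_Integration.integrable_bound[OF Cauchy_Schwarz_l2_norm(1)[OF assms(1,2)] assms(3)]) auto
  have "norm (\<integral>x. h x \<partial>M) \<le> (\<integral>x. norm (h x) \<partial>M)" by simp
  also have "\<dots> \<le> (\<integral>x. norm (f x) * norm (g x) \<partial>M)"
    using * assms Cauchy_Schwarz_l2_norm(1)[OF assms(1,2)] by (intro integral_mono_AE) auto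
  finally show "norm (\<integral>x. h x \<partial>M) \<le> l2 M f * l2 M g" using Cauchy_Schwarz_l2_norm(2)[OF assms(1,2)] by simp
qed

lemma Cauchy_Schwarz_l2:
  assumes "sq_int M f" "sq_int M g"
  shows "integrable M (\<lambda>x. f x \<bullet> g x)" "\<bar>\<integral>x. f x \<bullet> g x \<partial>M\<bar> \<le> l2 M f * l2 M g"
proof -
  have m: "(\<lambda>x. f x \<bullet> g x) \<in> borel_measurable M"
    using assms by (auto simp: sq_int_def)
  have "AE x in M. norm (f x \<bullet> g x) \<le> norm (f x) * norm (g x)"
    by (simp add: Cauchy_Schwarz_ineq2)
  from integrable_bilinear_l2[OF assms m this]
  show "integrable M (\<lambda>x. f x \<bullet> g x)" "\<bar>\<integral>x. f x \<bullet> g x \<partial>M\<bar> \<le> l2 M f * l2 M g" by auto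
qed

lemma l2_scaleR: "l2 M (\<lambda>x. c *\<^sub>R f x) = \<bar>c\<bar> * l2 M f"
  by (simp add: l2_def power_mult_distrib real_sqrt_mult)

lemma l2_triangle:
  assumes "sq_int M f" "sq_int M g" shows "l2 M (\<lambda>x. f x + g x) \<le> l2 M f + l2 M g"
proof -
  have "(l2 M (\<lambda>x. f x + g x))\<^sup>2 = (\<integral>x. (norm (f x))\<^sup>2 + (norm (g x))\<^sup>2 + 2 * (f x \<bullet> g x) \<partial>M)"
    unfolding l2_power2 by (intro Bochner_Integration.integral_cong refl)
      (simp add: power2_norm_eq_inner inner_add inner_commute)
  also have "\<dots> = (l2 M f)\<^sup>2 + (l2 M g)\<^sup>2 + 2 * (\<integral>x. f x \<bullet> g x \<partial>M)"
    using assms Cauchy_Schwarz_l2(1)[OF assms] by (simp add: l2_power2 sq_int_def)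
  also have "\<dots> \<le> (l2 M f + l2 M g)\<^sup>2"
    using Cauchy_Schwarz_l2(2)[OF assms] by (simp add: power2_sum)
  finally show ?thesis by (rule power2_le_imp_le) (simp add: add_nonneg_nonneg)
qed

lemma l2_triangle_diff:
  assumes "sq_int M f" "sq_int M g" shows "\<bar>l2 M f - l2 M g\<bar> \<le> l2 M (\<lambda>x. f x - g x)"
proof -
  have *: "l2 M (\<lambda>x. g x - f x) = l2 M (\<lambda>x. f x - g x)" by (simp add: l2_def norm_minus_commute)
  show ?thesis
    using l2_triangle[OF sq_int_diff[OF assms] assms(2)] l2_triangle[OF sq_int_diff[OF assms(2,1)] assms(1)]
    by (simp add: *)
qed

lemma l2_mono:
  assumes "sq_int M f" "g \<in> borel_measurable M" "AE x in M. norm (g x) \<le> norm (f x)"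
  shows "l2 M g \<le> l2 M f"
proof -
  have "sq_int M g" by (rule sq_int_bound[OF assms(1,2), of 1]) (use assms(3) in auto)
  then show ?thesis unfolding l2_def
    using assms by (intro real_sqrt_le_mono integral_mono_AE) (auto simp: sq_int_def elim!: eventually_mono intro: power_mono)
qed

lemma tendsto_l2:
  assumes "sq_int M f" "\<And>n. sq_int M (g n)" "(\<lambda>n. l2 M (\<lambda>x. f x - g n x)) \<longlonglongrightarrow> 0"
  shows "(\<lambda>n. l2 M (g n)) \<longlonglongrightarrow> l2 M f"
proof (rule LIM_zero_cancel, rule tendsto_rabs_zero_cancel, rule tendsto_sandwich[OF _ _ tendsto_const assms(3)])
  show "\<forall>\<^sub>F n in sequentially. \<bar>l2 M (g n) - l2 M f\<bar> \<le> l2 M (\<lambda>x. f x - g n x)"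
    using l2_triangle_diff[OF assms(1,2)] by (simp add: abs_minus_commute)
qed simp

lemma sq_int_of_finite:
  assumes "finite_measure M" "f \<in> borel_measurable M" "\<And>x. norm (f x) \<le> C"
  shows "sq_int M f"
  unfolding sq_int_def
proof
  show "integrable M (\<lambda>x. (norm (f x))\<^sup>2)"
    by (rule finite_measure.integrable_const_bound[OF assms(1), where B = "C\<^sup>2"])
       (use assms(2,3) in \<open>auto intro!: power_mono\<close>)
qed (rule assms(2))

text \<open>A product of one factor converging in norm and another converging only pointwise but
  boundedly. With \<open>g\<close> in place of \<open>gn n\<close> dominated convergence applies,
  and the error of this replacement is at most K times the norm of \<open>h\<close> times that of
  \<open>g - gn n\<close>.\<close>

lemma tendsto_integral_l2_pairing:
  fixes h g :: "'a \<Rightarrow> 'b::euclidean_space" and gn :: "nat \<Rightarrow> 'a \<Rightarrow> 'b"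
  assumes h: "sq_int M h" and g: "sq_int M g" "\<And>n. sq_int M (gn n)" "(\<lambda>n. l2 M (\<lambda>x. g x - gn n x)) \<longlonglongrightarrow> 0"
    and s: "\<And>n. s n \<in> borel_measurable M" "s' \<in> borel_measurable M" "\<And>n x. \<bar>s n x\<bar> \<le> (K::real)"
      "AE x in M. (\<lambda>n. s n x) \<longlonglongrightarrow> s' x"
  shows "(\<lambda>n. \<integral>x. (h x \<bullet> gn n x) * s n x \<partial>M) \<longlonglongrightarrow> (\<integral>x. (h x \<bullet> g x) * s' x \<partial>M)"
proof -
  have [measurable]: "h \<in> borel_measurable M" "g \<in> borel_measurable M" "gn n \<in> borel_measurable M"
    "s n \<in> borel_measurable M" "s' \<in> borel_measurable M" for n
    using assms by (auto simp: sq_int_def)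
  have lim1: "(\<lambda>n. \<integral>x. (h x \<bullet> g x) * s n x \<partial>M) \<longlonglongrightarrow> (\<integral>x. (h x \<bullet> g x) * s' x \<partial>M)"
  proof (rule integral_dominated_convergence[where w = "\<lambda>x. K * norm (h x \<bullet> g x)"])
    show "integrable M (\<lambda>x. K * norm (h x \<bullet> g x))"
      using Cauchy_Schwarz_l2(1)[OF h g(1)] by auto
    show "AE x in M. (\<lambda>n. (h x \<bullet> g x) * s n x) \<longlonglongrightarrow> (h x \<bullet> g x) * s' x"
      using s(4) by eventually_elim (intro tendsto_intros)
    show "AE x in M. norm ((h x \<bullet> g x) * s n x) \<le> K * norm (h x \<bullet> g x)" for n
      using s(3) by (intro AE_I2) (simp add: abs_mult mult.commute mult_right_mono)
  qed measurable
  have int1: "integrable M (\<lambda>x. (h x \<bullet> k x) * s n x)" if k: "sq_int M k" for k n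
  proof (rule Bochner_Integration.integrable_bound[OF integrable_mult_right[OF integrable_norm[OF Cauchy_Schwarz_l2(1)[OF h k]], of K]])
    show "AE x in M. norm ((h x \<bullet> k x) * s n x) \<le> norm (K * norm (h x \<bullet> k x))"
    proof (intro AE_I2)
      fix x
      have "\<bar>h x \<bullet> k x\<bar> * \<bar>s n x\<bar> \<le> \<bar>h x \<bullet> k x\<bar> * \<bar>K\<bar>"
        by (intro mult_left_mono order_trans[OF s(3)]) auto
      then show "norm ((h x \<bullet> k x) * s n x) \<le> norm (K * norm (h x \<bullet> k x))"
        by (simp add: abs_mult mult.commute)
    qed
  qed (use k in \<open>auto simp: sq_int_def\<close>)
  have K0: "0 \<le> K" using s(3)[of 0 undefined] by linarith
  have "(\<lambda>n. (\<integral>x. (h x \<bullet> gn n x) * s n x \<partial>M) - (\<integral>x. (h x \<bullet> g x) * s n x \<partial>M)) \<longlonglongrightarrow> 0"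
  proof (rule Lim_null_comparison)
    have "(\<lambda>n. (l2 M (\<lambda>x. K *\<^sub>R h x)) * l2 M (\<lambda>x. g x - gn n x)) \<longlonglongrightarrow> l2 M (\<lambda>x. K *\<^sub>R h x) * 0"
      by (intro tendsto_intros g(3))
    then show "(\<lambda>n. (l2 M (\<lambda>x. K *\<^sub>R h x)) * l2 M (\<lambda>x. g x - gn n x)) \<longlonglongrightarrow> 0" by simp
    show "\<forall>\<^sub>F n in sequentially. norm ((\<integral>x. (h x \<bullet> gn n x) * s n x \<partial>M) - (\<integral>x. (h x \<bullet> g x) * s n x \<partial>M))
        \<le> (l2 M (\<lambda>x. K *\<^sub>R h x)) * l2 M (\<lambda>x. g x - gn n x)"
    proof (intro always_eventually allI)
      fix n
      have eq: "(\<integral>x. (h x \<bullet> gn n x) * s n x \<partial>M) - (\<integral>x. (h x \<bullet> g x) * s n x \<partial>M) = (\<integral>x. (h x \<bullet> (gn n x - g x)) * s n x \<partial>M)"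
        by (subst Bochner_Integration.integral_diff[symmetric])
           (auto intro!: int1 g simp: inner_diff_right left_diff_distrib)
      show "norm ((\<integral>x. (h x \<bullet> gn n x) * s n x \<partial>M) - (\<integral>x. (h x \<bullet> g x) * s n x \<partial>M))
          \<le> (l2 M (\<lambda>x. K *\<^sub>R h x)) * l2 M (\<lambda>x. g x - gn n x)"
        unfolding eq
      proof (rule integrable_bilinear_l2(2)[OF sq_int_scaleR[OF h] sq_int_diff[OF g(1,2)]])
        show "AE x in M. norm ((h x \<bullet> (gn n x - g x)) * s n x) \<le> norm (K *\<^sub>R h x) * norm (g x - gn n x)"
        proof (intro AE_I2)
          fix x
          have "\<bar>h x \<bullet> (gn n x - g x)\<bar> * \<bar>s n x\<bar> \<le> (norm (h x) * norm (g x - gn n x)) * K"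
            using Cauchy_Schwarz_ineq2[of "h x" "gn n x - g x"] s(3) by (intro mult_mono) (auto simp: norm_minus_commute)
          then show "norm ((h x \<bullet> (gn n x - g x)) * s n x) \<le> norm (K *\<^sub>R h x) * norm (g x - gn n x)"
            using K0 by (simp add: abs_mult mult_ac)
        qed
      qed measurable
    qed
  qed
  from tendsto_add[OF this lim1] show ?thesis by simp
qed

lemma integral_bounded_convergence:
  fixes r :: "'a \<Rightarrow> real"
  assumes r: "integrable M r" and s: "\<And>n. s n \<in> borel_measurable M" "s' \<in> borel_measurable M" "\<And>n x. \<bar>s n x\<bar> \<le> (K::real)"
      "AE x in M. (\<lambda>n. s n x) \<longlonglongrightarrow> s' x"
  shows "(\<lambda>n. \<integral>x. r x * s n x \<partial>M) \<longlonglongrightarrow> (\<integral>x. r x * s' x \<partial>M)"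
proof (rule integral_dominated_convergence[where w = "\<lambda>x. K * norm (r x)"])
  show "AE x in M. (\<lambda>n. r x * s n x) \<longlonglongrightarrow> r x * s' x"
    using s(4) by eventually_elim (intro tendsto_intros)
  show "AE x in M. norm (r x * s n x) \<le> K * norm (r x)" for n
    using s(3) by (intro AE_I2) (simp add: abs_mult mult.commute[of K] mult_left_mono)
qed (use r s in auto)

lemma integrable_times_bounded:
  fixes r :: "'a \<Rightarrow> real"
  assumes "integrable M r" "s \<in> borel_measurable M" "\<And>x. \<bar>s x\<bar> \<le> (K::real)"
  shows "integrable M (\<lambda>x. r x * s x)"
proof (rule Bochner_Integration.integrable_bound[OF integrable_mult_right[OF integrable_norm[OF assms(1)], of K]])
  show "AE x in M. norm (r x * s x) \<le> norm (K * norm (r x))"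
  proof (intro AE_I2)
    fix x
    have "\<bar>r x\<bar> * \<bar>s x\<bar> \<le> \<bar>r x\<bar> * \<bar>K\<bar>"
      by (intro mult_left_mono order_trans[OF assms(3)]) auto
    then show "norm (r x * s x) \<le> norm (K * norm (r x))" by (simp add: abs_mult mult.commute)
  qed
qed (use assms in auto)

section \<open>Weak gradients and approximation by test functions\<close>

locale bounded_open =
  fixes U :: "(real^'d::finite) set"
  assumes open_U: "open U" and bounded_U: "bounded U"
begin

abbreviation LU :: "(real^'d) measure" where "LU \<equiv> lebesgue_on U"

lemma U_lmeasurable: "U \<in> lmeasurable"
  using open_U bounded_U by (rule lmeasurable_open[rotated])

lemma U_sets: "U \<in> sets lebesgue"
  using U_lmeasurable by blast

lemma finite_LU: "finite_measure LU"
  by (rule finite_measure_lebesgue_on[OF U_lmeasurable])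

lemma measure_LU: "measure LU U = measure lebesgue U"
  using U_sets by (simp add: measure_restrict_space)

lemma measurable_LU:
  fixes f :: "real^'d \<Rightarrow> 'b::euclidean_space"
  assumes "continuous_on UNIV f" shows "f \<in> borel_measurable LU"
  using assms by (intro measurable_restrict_space1 measurable_completion) (simp add: borel_measurable_continuous_onI)

lemma smooth_measurable: "smooth \<phi> \<Longrightarrow> \<phi> \<in> borel_measurable LU"
  by (rule measurable_LU[OF smooth_continuous])

lemma smooth_measurable_grad: "smooth \<phi> \<Longrightarrow> grad \<phi> \<in> borel_measurable LU"
  by (rule measurable_LU[OF smooth_continuous_grad])

lemma test_measurable:
  assumes "test_function V \<phi>"
  shows "\<phi> \<in> borel_measurable LU" "grad \<phi> \<in> borel_measurable LU"
  using assms by (auto intro: smooth_measurable smooth_measurable_grad test_function_smooth)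

lemma sq_int_bounded:
  assumes "f \<in> borel_measurable LU" "\<And>x. norm (f x) \<le> C" shows "sq_int LU f"
  by (rule sq_int_of_finite[OF finite_LU assms])

lemma test_sq_int:
  assumes "test_function U \<phi>" shows "sq_int LU \<phi>" "sq_int LU (grad \<phi>)"
proof -
  obtain C where C: "\<And>x. \<bar>\<phi> x\<bar> \<le> C" "\<And>x. norm (grad \<phi> x) \<le> C"
    using test_function_bounded[OF assms] by metis
  show "sq_int LU \<phi>" "sq_int LU (grad \<phi>)"
    using C by (auto intro!: sq_int_bounded test_measurable[OF assms])
qed

lemma sq_int_imp_integrable:
  fixes f :: "real^'d \<Rightarrow> real"
  assumes "sq_int LU f" shows "integrable LU f"
proof -
  have one: "sq_int LU (\<lambda>x. 1 :: real)" by (rule sq_int_bounded[of _ 1]) auto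
  from Cauchy_Schwarz_l2(1)[OF assms one] show ?thesis by simp
qed

lemma set_integrable_continuous_compact:
  fixes f :: "real^'d \<Rightarrow> 'b::euclidean_space"
  assumes "continuous_on UNIV f" "compact K" shows "f absolutely_integrable_on K"
proof -
  have "integrable lborel (\<lambda>x. indicator K x *\<^sub>R f x)"
    using assms by (intro borel_integrable_compact) (auto intro: continuous_on_subset)
  then show ?thesis
    unfolding set_integrable_def by (subst integrable_completion) auto
qed

lemma set_integrable_component:
  "g absolutely_integrable_on K \<Longrightarrow> (\<lambda>x. (g x :: real^'d) $ i) absolutely_integrable_on K"
  unfolding set_integrable_def by (drule integrable_bounded_linear[OF bounded_linear_vec_nth[of i]]) simp

lemma local_integrable_times:
  assumes h: "\<And>K. compact K \<Longrightarrow> K \<subseteq> U \<Longrightarrow> h absolutely_integrable_on K" and \<psi>: "test_function U \<psi>"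
  shows "integrable LU (\<lambda>x. h x * \<psi> x)" "integrable LU (\<lambda>x. h x * partial i \<psi> x)"
proof -
  let ?K = "closure {x. \<psi> x \<noteq> 0}"
  have K: "compact ?K" "?K \<subseteq> U" and s: "smooth \<psi>" using \<psi> by (auto simp: test_function_def)
  show "integrable LU (\<lambda>x. h x * \<psi> x)"
    using closure_subset[of "{x. \<psi> x \<noteq> 0}"]
    by (intro absolutely_integrable_times_test(1)[OF K U_sets h[OF K]] smooth_continuous s) blast
  have "partial i \<psi> x = 0" if "x \<notin> ?K" for x
    using grad_eq_0_outside[OF s that] by (simp add: grad_def vec_eq_iff)
  then show "integrable LU (\<lambda>x. h x * partial i \<psi> x)"
    by (intro absolutely_integrable_times_test(1)[OF K U_sets h[OF K]] smooth_continuous smooth_partial s) auto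
qed

text \<open>Makes the choice hidden in \<open>weak_grad\<close> harmless: any weak gradient known
  explicitly agrees with the chosen one almost everywhere.\<close>

lemma weak_gradient_unique:
  assumes "has_weak_gradient U f g" "has_weak_gradient U f g'"
  shows "AE x in LU. g x = g' x"
proof -
  have gi: "\<And>K. compact K \<Longrightarrow> K \<subseteq> U \<Longrightarrow> g absolutely_integrable_on K"
    "\<And>K. compact K \<Longrightarrow> K \<subseteq> U \<Longrightarrow> g' absolutely_integrable_on K"
    using assms by (auto simp: has_weak_gradient_def)
  have "AE x in LU. g x $ i - g' x $ i = 0" for i
  proof (rule fundamental_lemma_variations[OF open_U])
    show "(\<lambda>x. g x $ i - g' x $ i) absolutely_integrable_on K" if "compact K" "K \<subseteq> U" for K
      using gi[OF that] by (intro set_integral_diff set_integrable_component)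
    show "(\<integral>x. (g x $ i - g' x $ i) * \<phi> x \<partial>LU) = 0" if \<phi>: "test_function U \<phi>" for \<phi>
    proof -
      have "(\<integral>x. (g x $ i - g' x $ i) * \<phi> x \<partial>LU) = (\<integral>x. g x $ i * \<phi> x \<partial>LU) - (\<integral>x. g' x $ i * \<phi> x \<partial>LU)"
        by (subst Bochner_Integration.integral_diff[symmetric])
           (auto intro!: local_integrable_times \<phi> set_integrable_component gi simp: left_diff_distrib)
      moreover have "(\<integral>x. f x * partial i \<phi> x \<partial>LU) = - (\<integral>x. g x $ i * \<phi> x \<partial>LU)"
        "(\<integral>x. f x * partial i \<phi> x \<partial>LU) = - (\<integral>x. g' x $ i * \<phi> x \<partial>LU)"
        using assms \<phi> by (auto simp: has_weak_gradient_def)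
      ultimately show ?thesis by simp
    qed
  qed
  then have "AE x in LU. \<forall>i. g x $ i - g' x $ i = 0"
    by (simp add: AE_all_countable)
  then show ?thesis by eventually_elim (simp add: vec_eq_iff)
qed

text \<open>The product of two test functions is a test function, so its partial derivatives have
  integral zero; the product rule turns this into the defining identity.\<close>

lemma test_has_weak_gradient:
  assumes \<phi>: "test_function U \<phi>" shows "has_weak_gradient U \<phi> (grad \<phi>)"
  unfolding has_weak_gradient_def
proof (intro conjI allI impI)
  have s: "smooth \<phi>" using \<phi> by (rule test_function_smooth)
  fix K assume K: "compact K \<and> K \<subseteq> U"
  then show "\<phi> absolutely_integrable_on K" "grad \<phi> absolutely_integrable_on K"
    using s by (auto intro!: set_integrable_continuous_compact smooth_continuous smooth_continuous_grad)
next
  fix \<psi> i assume \<psi>: "test_function U \<psi>"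
  have s: "smooth \<phi>" "smooth \<psi>" using \<phi> \<psi> by (auto simp: test_function_smooth)
  have loc: "\<phi> absolutely_integrable_on K" "partial i \<phi> absolutely_integrable_on K" if "compact K" for K
    using s that by (auto intro!: set_integrable_continuous_compact smooth_continuous smooth_partial)
  have tp: "test_function U (\<lambda>x. \<phi> x * \<psi> x)"
    by (rule test_function_subset[OF \<phi> smooth_mult[OF s]]) simp
  have prod: "partial i (\<lambda>x. \<phi> x * \<psi> x) = (\<lambda>x. \<phi> x * partial i \<psi> x + partial i \<phi> x * \<psi> x)"
    using partial_eqI[OF has_derivative_mult[OF s(1)[THEN smooth_has_derivative] s(2)[THEN smooth_has_derivative]]]
    by (auto simp: inner_axis grad_def fun_eq_iff)
  have "partial i (\<lambda>x. \<phi> x * \<psi> x) x = 0" if "x \<notin> U" for x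
    using test_function_eq_0(2)[OF tp that] by (simp add: grad_def vec_eq_iff)
  then have ind: "indicator U x * partial i (\<lambda>x. \<phi> x * \<psi> x) x = partial i (\<lambda>x. \<phi> x * \<psi> x) x" for x
    by (auto split: split_indicator)
  have "(\<integral>x. \<phi> x * partial i \<psi> x \<partial>LU) + (\<integral>x. partial i \<phi> x * \<psi> x \<partial>LU) = (\<integral>x. partial i (\<lambda>x. \<phi> x * \<psi> x) x \<partial>LU)"
    unfolding prod by (intro Bochner_Integration.integral_add[symmetric] local_integrable_times \<psi> loc)
  also have "\<dots> = (\<integral>x. partial i (\<lambda>x. \<phi> x * \<psi> x) x \<partial>lebesgue)"
    using U_sets by (simp add: integral_restrict_space ind)
  also have "\<dots> = (\<integral>x. partial i (\<lambda>x. \<phi> x * \<psi> x) x \<partial>lborel)"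
    by (rule integral_completion)
       (simp add: borel_measurable_continuous_onI smooth_continuous smooth_partial smooth_mult s)
  also have "\<dots> = 0"
    using tp by (intro integral_partial_eq_0) (auto simp: test_function_def)
  finally show "(\<integral>x. \<phi> x * partial i \<psi> x \<partial>LU) = - (\<integral>x. grad \<phi> x $ i * \<psi> x \<partial>LU)"
    by (simp add: grad_def)
qed

lemma has_weak_gradient_diff:
  assumes "has_weak_gradient U f g" "has_weak_gradient U f' g'"
  shows "has_weak_gradient U (\<lambda>x. f x - f' x) (\<lambda>x. g x - g' x)"
  unfolding has_weak_gradient_def
proof (intro conjI allI impI)
  have loc: "f absolutely_integrable_on K" "f' absolutely_integrable_on K"
    "g absolutely_integrable_on K" "g' absolutely_integrable_on K" if "compact K" "K \<subseteq> U" for K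
    using assms that by (auto simp: has_weak_gradient_def)
  fix K assume K: "compact K \<and> K \<subseteq> U"
  show "(\<lambda>x. f x - f' x) absolutely_integrable_on K" "(\<lambda>x. g x - g' x) absolutely_integrable_on K"
    using K by (auto intro!: set_integral_diff loc)
next
  have loc: "f absolutely_integrable_on K" "f' absolutely_integrable_on K"
    "g absolutely_integrable_on K" "g' absolutely_integrable_on K" if "compact K" "K \<subseteq> U" for K
    using assms that by (auto simp: has_weak_gradient_def)
  fix \<psi> i assume \<psi>: "test_function U \<psi>"
  have "(\<integral>x. (f x - f' x) * partial i \<psi> x \<partial>LU) = (\<integral>x. f x * partial i \<psi> x \<partial>LU) - (\<integral>x. f' x * partial i \<psi> x \<partial>LU)"
    by (subst Bochner_Integration.integral_diff[symmetric])
       (auto intro!: local_integrable_times \<psi> loc simp: left_diff_distrib)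
  moreover have "(\<integral>x. (g x - g' x) $ i * \<psi> x \<partial>LU) = (\<integral>x. g x $ i * \<psi> x \<partial>LU) - (\<integral>x. g' x $ i * \<psi> x \<partial>LU)"
    by (subst Bochner_Integration.integral_diff[symmetric])
       (auto intro!: local_integrable_times \<psi> loc set_integrable_component simp: left_diff_distrib)
  ultimately show "(\<integral>x. (f x - f' x) * partial i \<psi> x \<partial>LU) = - (\<integral>x. (g x - g' x) $ i * \<psi> x \<partial>LU)"
    using assms \<psi> by (simp add: has_weak_gradient_def)
qed

lemma has_weak_gradient_weak_grad: "has_weak_gradient U f g \<Longrightarrow> has_weak_gradient U f (weak_grad U f)"
  unfolding weak_grad_def by (rule someI[where P = "has_weak_gradient U f"])

text \<open>Only integrability on compact subsets is given, so measurability on \<open>U\<close> is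
  glued together from countably many closed boxes.\<close>

lemma has_weak_gradient_measurable:
  assumes "has_weak_gradient U f g" shows "g \<in> borel_measurable LU"
proof -
  obtain \<D> where \<D>: "countable \<D>" "\<D> \<subseteq> Pow U" "\<And>X. X \<in> \<D> \<Longrightarrow> \<exists>a b. X = cbox a b" "\<Union>\<D> = U"
    using open_countable_Union_open_cbox[OF open_U] by blast
  have wk: "\<And>K. compact K \<Longrightarrow> K \<subseteq> U \<Longrightarrow> g absolutely_integrable_on K"
    using assms by (simp add: has_weak_gradient_def)
  have X: "X \<in> sets lebesgue" "X \<subseteq> U" "g \<in> borel_measurable (restrict_space LU X)" if X: "X \<in> \<D>" for X
  proof -
    obtain a b where ab: "X = cbox a b" using \<D>(3)[OF X] by blast
    show Xs: "X \<in> sets lebesgue" by (simp add: ab)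
    show XU: "X \<subseteq> U" using \<D>(2) X by blast
    have "g absolutely_integrable_on X"
      using wk[OF compact_cbox XU[unfolded ab]] by (simp add: ab)
    then have "integrable (lebesgue_on X) g"
      using Xs by (simp add: set_integrable_def integrable_restrict_space)
    moreover have "restrict_space LU X = lebesgue_on X"
    proof -
      have "U \<inter> X = X" using XU by blast
      then show ?thesis using U_sets Xs by (subst restrict_restrict_space) (simp_all add: Int_commute)
    qed
    ultimately show "g \<in> borel_measurable (restrict_space LU X)" by simp
  qed
  show ?thesis
  proof (rule measurable_piecewise_restrict[OF \<D>(1)])
    show "space LU \<subseteq> \<Union>\<D>" using \<D>(4) by simp
    show "X \<inter> space LU \<in> sets LU" if "X \<in> \<D>" for X
      using X(1,2)[OF that] U_sets by (simp add: sets_restrict_space_iff Int_absorb2)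
  qed (rule X(3))
qed

section \<open>Real valued norms for the Sobolev space\<close>

lemma Lp_norm_2:
  assumes "f \<in> borel_measurable LU"
  shows "in_Lp 2 U f \<longleftrightarrow> sq_int LU f" "sq_int LU f \<Longrightarrow> Lp_norm 2 U f = ennreal (l2 LU f)"
proof -
  have eq: "Lp_norm 2 U f = epowr (\<integral>\<^sup>+x. ennreal ((norm (f x))\<^sup>2) \<partial>LU) (1/2)"
    by (simp add: Lp_norm_def powr_numeral)
  show 2: "Lp_norm 2 U f = ennreal (l2 LU f)" if "sq_int LU f"
    unfolding eq using nn_integral_norm_power2[OF that]
    by (simp add: ennreal_power epowr_ennreal powr_half_sqrt)
  show "in_Lp 2 U f \<longleftrightarrow> sq_int LU f"
  proof
    assume "in_Lp 2 U f"
    then have "(\<integral>\<^sup>+x. ennreal ((norm (f x))\<^sup>2) \<partial>LU) < \<infinity>"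
      unfolding in_Lp_def eq by (simp add: less_top[symmetric])
    then show "sq_int LU f"
      using assms by (auto simp: sq_int_def intro!: integrableI_bounded)
  next
    assume "sq_int LU f"
    then show "in_Lp 2 U f" using assms 2 by (simp add: in_Lp_def)
  qed
qed

lemma in_Lp_2_iff: "in_Lp 2 U f \<longleftrightarrow> sq_int LU f"
  using Lp_norm_2(1)[of f] by (auto simp: in_Lp_def sq_int_def)

lemma l2_power2_components:
  fixes g :: "real^'d \<Rightarrow> real^'d"
  assumes "sq_int LU g"
  shows "(l2 LU g)\<^sup>2 = (\<Sum>i\<in>UNIV. (l2 LU (\<lambda>x. g x $ i))\<^sup>2)" "sq_int LU (\<lambda>x. g x $ i)"
proof -
  have [measurable]: "g \<in> borel_measurable LU" using assms by (rule sq_int_measurable)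
  have [measurable]: "(\<lambda>x. g x $ i) \<in> borel_measurable LU" for i
    by (simp add: cart_eq_inner_axis)
  show *: "sq_int LU (\<lambda>x. g x $ i)" for i
    by (rule sq_int_bound[OF assms, of _ 1]) (auto simp: component_le_norm_cart)
  have "(l2 LU g)\<^sup>2 = (\<integral>x. (\<Sum>i\<in>UNIV. (norm (g x $ i))\<^sup>2) \<partial>LU)"
    unfolding l2_power2
    by (intro Bochner_Integration.integral_cong refl) (simp add: power2_norm_eq_inner inner_vec_def flip: power2_eq_square)
  also have "\<dots> = (\<Sum>i\<in>UNIV. (l2 LU (\<lambda>x. g x $ i))\<^sup>2)"
    unfolding l2_power2 using * by (intro Bochner_Integration.integral_sum) (auto simp: sq_int_def)
  finally show "(l2 LU g)\<^sup>2 = (\<Sum>i\<in>UNIV. (l2 LU (\<lambda>x. g x $ i))\<^sup>2)" .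
qed

text \<open>Allows the Sobolev norm to be computed from any weak gradient. Equality almost
  everywhere transfers square integrability to the chosen representative only once that one is known
  to be measurable.\<close>

lemma H12_norm_eq:
  assumes "has_weak_gradient U v g" "sq_int LU v" "sq_int LU g"
  shows "H12_norm U v = ennreal (sqrt ((l2 LU v)\<^sup>2 + (l2 LU g)\<^sup>2))" "v \<in> H12 U" "sq_int LU (weak_grad U v)"
    "l2 LU (weak_grad U v) = l2 LU g"
proof -
  let ?w = "weak_grad U v"
  have w: "has_weak_gradient U v ?w" by (rule has_weak_gradient_weak_grad[OF assms(1)])
  have ae: "AE x in LU. ?w x = g x" by (rule weak_gradient_unique[OF w assms(1)])
  show sw: "sq_int LU ?w" and l2w: "l2 LU ?w = l2 LU g"
    using sq_int_cong_AE[OF assms(3) has_weak_gradient_measurable[OF w] ae] by auto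
  have "(\<Sum>i\<in>UNIV. (Lp_norm 2 U (\<lambda>x. ?w x $ i))\<^sup>2) = (\<Sum>i\<in>UNIV. ennreal ((l2 LU (\<lambda>x. ?w x $ i))\<^sup>2))"
    using l2_power2_components(2)[OF sw]
    by (intro sum.cong refl) (simp add: Lp_norm_2 sq_int_measurable ennreal_power)
  also have "\<dots> = ennreal ((l2 LU ?w)\<^sup>2)"
    unfolding l2_power2_components(1)[OF sw] by (rule sum_ennreal) simp
  finally have "(\<Sum>i\<in>UNIV. (Lp_norm 2 U (\<lambda>x. ?w x $ i))\<^sup>2) = ennreal ((l2 LU g)\<^sup>2)" by (simp add: l2w)
  then show "H12_norm U v = ennreal (sqrt ((l2 LU v)\<^sup>2 + (l2 LU g)\<^sup>2))"
    unfolding H12_norm_def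
    using assms(2) by (simp add: Lp_norm_2 sq_int_measurable ennreal_power epowr_ennreal powr_half_sqrt flip: ennreal_plus)
  show "v \<in> H12 U"
    using assms sw by (auto simp: H12_def in_Lp_2_iff)
qed

lemma test_H12_0:
  assumes "test_function U \<phi>"
  shows "\<phi> \<in> H12_0 U" "AE x in LU. weak_grad U \<phi> x = grad \<phi> x"
    "H12_norm U \<phi> = ennreal (sqrt ((l2 LU \<phi>)\<^sup>2 + (l2 LU (grad \<phi>))\<^sup>2))"
proof -
  note wg = test_has_weak_gradient[OF assms]
  show "AE x in LU. weak_grad U \<phi> x = grad \<phi> x"
    by (rule weak_gradient_unique[OF has_weak_gradient_weak_grad[OF wg] wg])
  show "H12_norm U \<phi> = ennreal (sqrt ((l2 LU \<phi>)\<^sup>2 + (l2 LU (grad \<phi>))\<^sup>2))"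
    by (rule H12_norm_eq(1)[OF wg test_sq_int[OF assms]])
  have wg0: "has_weak_gradient U (\<lambda>x. \<phi> x - \<phi> x) (\<lambda>x. grad \<phi> x - grad \<phi> x)"
    by (rule has_weak_gradient_diff[OF wg wg])
  have "H12_norm U (\<lambda>x. \<phi> x - \<phi> x) = ennreal (sqrt ((l2 LU (\<lambda>x. \<phi> x - \<phi> x))\<^sup>2 + (l2 LU (\<lambda>x. grad \<phi> x - grad \<phi> x))\<^sup>2))"
    by (intro H12_norm_eq(1)[OF wg0] sq_int_diff test_sq_int assms)
  then have "H12_norm U (\<lambda>x. \<phi> x - \<phi> x) = 0" by (simp add: l2_def)
  then show "\<phi> \<in> H12_0 U"
    using H12_norm_eq(2)[OF wg test_sq_int[OF assms]] assms unfolding H12_0_def by auto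
qed

text \<open>The gradient \<open>g\<close> is carried along explicitly instead of as
  \<open>weak_grad\<close>, so truncations can be handled by approximation alone. Convergence almost
  everywhere is included because nonlinear functions of the approximants have to converge
  too.\<close>

definition sobolev_approx ::
    "(real^'d \<Rightarrow> real) \<Rightarrow> (real^'d \<Rightarrow> real^'d) \<Rightarrow> (nat \<Rightarrow> real^'d \<Rightarrow> real) \<Rightarrow> bool" where
  "sobolev_approx w g \<phi> \<longleftrightarrow> (\<forall>j. test_function U (\<phi> j)) \<and> sq_int LU w \<and> sq_int LU g \<and>
     (\<lambda>j. l2 LU (\<lambda>x. w x - \<phi> j x)) \<longlonglongrightarrow> 0 \<and> (\<lambda>j. l2 LU (\<lambda>x. g x - grad (\<phi> j) x)) \<longlonglongrightarrow> 0 \<and>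
     (AE x in LU. (\<lambda>j. \<phi> j x) \<longlonglongrightarrow> w x)"

text \<open>Convergence in L^2 yields convergence almost everywhere only along a
  subsequence.\<close>

lemma sobolev_approx_subseq:
  assumes "\<And>j. test_function U (\<phi> j)" "sq_int LU w" "sq_int LU g"
    "(\<lambda>j. l2 LU (\<lambda>x. w x - \<phi> j x)) \<longlonglongrightarrow> 0" "(\<lambda>j. l2 LU (\<lambda>x. g x - grad (\<phi> j) x)) \<longlonglongrightarrow> 0"
  obtains r where "sobolev_approx w g (\<lambda>j. \<phi> (r j))"
proof -
  have "(\<lambda>j. (l2 LU (\<lambda>x. w x - \<phi> j x))\<^sup>2) \<longlonglongrightarrow> 0\<^sup>2" by (intro tendsto_intros assms)
  then have "(\<lambda>j. \<integral>x. norm ((norm (w x - \<phi> j x))\<^sup>2) \<partial>LU) \<longlonglongrightarrow> 0" by (simp add: l2_power2)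
  moreover have "integrable LU (\<lambda>x. (norm (w x - \<phi> j x))\<^sup>2)" for j
    by (intro sq_int_integrable sq_int_diff assms test_sq_int)
  ultimately obtain r :: "nat \<Rightarrow> nat" where r: "strict_mono r" "AE x in LU. (\<lambda>j. (norm (w x - \<phi> (r j) x))\<^sup>2) \<longlonglongrightarrow> 0"
    using tendsto_L1_AE_subseq[of LU "\<lambda>j x. (norm (w x - \<phi> j x))\<^sup>2"] by auto
  have "AE x in LU. (\<lambda>j. \<phi> (r j) x) \<longlonglongrightarrow> w x"
    using r(2)
  proof eventually_elim
    fix x assume "(\<lambda>j. (norm (w x - \<phi> (r j) x))\<^sup>2) \<longlonglongrightarrow> 0"
    then have "(\<lambda>j. sqrt ((norm (w x - \<phi> (r j) x))\<^sup>2)) \<longlonglongrightarrow> sqrt 0" by (intro tendsto_intros)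
    then have "(\<lambda>j. w x - \<phi> (r j) x) \<longlonglongrightarrow> 0" by (simp add: tendsto_rabs_zero_iff)
    from tendsto_diff[OF tendsto_const[of "w x"] this] show "(\<lambda>j. \<phi> (r j) x) \<longlonglongrightarrow> w x" by simp
  qed
  moreover have "(\<lambda>j. l2 LU (\<lambda>x. w x - \<phi> (r j) x)) \<longlonglongrightarrow> 0" "(\<lambda>j. l2 LU (\<lambda>x. g x - grad (\<phi> (r j)) x)) \<longlonglongrightarrow> 0"
    using LIMSEQ_subseq_LIMSEQ[OF assms(4) r(1)] LIMSEQ_subseq_LIMSEQ[OF assms(5) r(1)] by (auto simp: o_def)
  ultimately show thesis
    using assms by (intro that[of r]) (auto simp: sobolev_approx_def)
qed

lemma H12_0_sobolev_approx:
  assumes "u \<in> H12_0 U"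
  obtains \<phi> where "sobolev_approx u (weak_grad U u) \<phi>"
proof -
  let ?g = "weak_grad U u"
  have u: "sq_int LU u" "sq_int LU ?g" and wg: "has_weak_gradient U u ?g"
    using assms has_weak_gradient_weak_grad by (auto simp: H12_0_def H12_def in_Lp_2_iff)
  have "\<exists>\<phi>. test_function U \<phi> \<and> H12_norm U (\<lambda>x. u x - \<phi> x) < ennreal (1 / Suc n)" for n
    using assms by (auto simp: H12_0_def)
  then obtain \<phi> where \<phi>: "\<And>n. test_function U (\<phi> n)" "\<And>n. H12_norm U (\<lambda>x. u x - \<phi> n x) < ennreal (1 / Suc n)"
    by metis
  have small: "l2 LU (\<lambda>x. u x - \<phi> n x) \<le> 1 / Suc n" "l2 LU (\<lambda>x. ?g x - grad (\<phi> n) x) \<le> 1 / Suc n" for n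
  proof -
    let ?a = "l2 LU (\<lambda>x. u x - \<phi> n x)" and ?b = "l2 LU (\<lambda>x. ?g x - grad (\<phi> n) x)"
    have "ennreal (sqrt (?a\<^sup>2 + ?b\<^sup>2)) < ennreal (1 / Suc n)"
      using \<phi>(2)[of n] H12_norm_eq(1)[OF has_weak_gradient_diff[OF wg test_has_weak_gradient[OF \<phi>(1)]]
          sq_int_diff[OF u(1) test_sq_int(1)[OF \<phi>(1)]] sq_int_diff[OF u(2) test_sq_int(2)[OF \<phi>(1)]], of n] by simp
    then have "sqrt (?a\<^sup>2 + ?b\<^sup>2) < 1 / Suc n" by (simp add: ennreal_less_iff)
    moreover have "?a \<le> sqrt (?a\<^sup>2 + ?b\<^sup>2)" "?b \<le> sqrt (?a\<^sup>2 + ?b\<^sup>2)"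
      by (auto intro: real_le_rsqrt)
    ultimately show "?a \<le> 1 / Suc n" "?b \<le> 1 / Suc n" by linarith+
  qed
  have lim: "f \<longlonglongrightarrow> 0" if "\<And>n. 0 \<le> f n" "\<And>n. f n \<le> 1 / Suc n" for f :: "nat \<Rightarrow> real"
    by (rule tendsto_sandwich[OF _ _ tendsto_const LIMSEQ_inverse_real_of_nat])
       (use that in \<open>auto simp: divide_inverse\<close>)
  obtain r where "sobolev_approx u ?g (\<lambda>j. \<phi> (r j))"
    using sobolev_approx_subseq[OF \<phi>(1) u lim[OF l2_nonneg small(1)] lim[OF l2_nonneg small(2)]] by blast
  then show thesis by (rule that)
qed

end

section \<open>The Sobolev inequality\<close>

text \<open>The derivative is \<gamma> sgn(y) |y|^(\<gamma> - 1), written with positive and negative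
  parts so that its continuity at 0 is evident. At 0 the difference quotient is bounded by
  |h|^(\<gamma> - 1), which tends to 0 as \<gamma> > 1.\<close>

lemma has_real_derivative_abs_powr:
  fixes \<gamma> y :: real
  assumes "\<gamma> > 1"
  shows "((\<lambda>y. \<bar>y\<bar> powr \<gamma>) has_real_derivative \<gamma> * (max y 0 powr (\<gamma> - 1) - max (- y) 0 powr (\<gamma> - 1))) (at y)"
proof -
  consider "y > 0" | "y < 0" | "y = 0" by linarith
  then show ?thesis
  proof cases
    case 1
    have "((\<lambda>y. y powr \<gamma>) has_real_derivative \<gamma> * y powr (\<gamma> - 1)) (at y)"
      using 1 by (auto intro!: derivative_eq_intros)
    then show ?thesis
      using 1 by (auto intro: has_field_derivative_transform_within_open[of _ _ _ "{0<..}"] simp: max_def)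
  next
    case 2
    have "((\<lambda>y. (- y) powr \<gamma>) has_real_derivative - (\<gamma> * (- y) powr (\<gamma> - 1))) (at y)"
      using 2 by (auto intro!: derivative_eq_intros)
    then show ?thesis
      using 2 by (auto intro: has_field_derivative_transform_within_open[of _ _ _ "{..<0}"] simp: max_def)
  next
    case 3
    have "((\<lambda>h. (\<bar>h\<bar> powr \<gamma> - \<bar>0\<bar> powr \<gamma>) / (h - 0)) \<longlongrightarrow> 0) (at (0::real))"
    proof (rule Lim_null_comparison)
      show "\<forall>\<^sub>F h in at 0. norm ((\<bar>h\<bar> powr \<gamma> - \<bar>0\<bar> powr \<gamma>) / (h - 0)) \<le> \<bar>h\<bar> powr (\<gamma> - 1)"
      proof (intro always_eventually allI)
        fix h :: real
        show "norm ((\<bar>h\<bar> powr \<gamma> - \<bar>0\<bar> powr \<gamma>) / (h - 0)) \<le> \<bar>h\<bar> powr (\<gamma> - 1)"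
          by (cases "h = 0") (auto simp: powr_diff)
      qed
      have "continuous_on UNIV (\<lambda>h::real. \<bar>h\<bar> powr (\<gamma> - 1))"
        using assms by (intro continuous_on_powr' continuous_intros) auto
      then show "((\<lambda>h. \<bar>h\<bar> powr (\<gamma> - 1)) \<longlongrightarrow> 0) (at (0::real))"
        using assms unfolding continuous_on_def by (drule_tac bspec[of _ _ 0]) auto
    qed
    then show ?thesis using 3 by (simp add: has_field_derivative_iff)
  qed
qed

text \<open>Provides the hypothesis of \<open>Gagliardo_Nirenberg\<close> for |\<phi>|^\<gamma>: the
  fundamental theorem of calculus along a coordinate line, started at a point outside the
  support.\<close>

lemma powr_le_line_integral:
  fixes \<phi> :: "real^'d::finite \<Rightarrow> real"
  assumes s: "smooth \<phi>" and K: "compact (closure {x. \<phi> x \<noteq> 0})" and \<gamma>: "\<gamma> > 1" and b: "b \<in> Basis"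
  shows "ennreal (\<bar>\<phi> x\<bar> powr \<gamma>) \<le> (\<integral>\<^sup>+t. ennreal (\<gamma> * \<bar>\<phi> (x + (t - x \<bullet> b) *\<^sub>R b)\<bar> powr (\<gamma> - 1)
            * norm (grad \<phi> (x + (t - x \<bullet> b) *\<^sub>R b))) \<partial>lborel)"
proof -
  let ?l = "\<lambda>t. x + (t - x \<bullet> b) *\<^sub>R b"
  define k where "k y = \<gamma> * (max y 0 powr (\<gamma> - 1) - max (- y) 0 powr (\<gamma> - 1))" for y
  define G where "G t = \<bar>\<phi> (?l t)\<bar> powr \<gamma>" for t
  define G' where "G' t = k (\<phi> (?l t)) * (grad \<phi> (?l t) \<bullet> b)" for t
  have nb: "norm b = 1" using b by simp
  have D: "(G has_real_derivative G' t) (at t)" for t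
  proof -
    have "(?l has_derivative (\<lambda>s. s *\<^sub>R b)) (at t)"
      by (auto intro!: derivative_eq_intros)
    from has_derivative_compose[OF this smooth_has_derivative[OF s]]
    have "((\<lambda>t. \<phi> (?l t)) has_real_derivative grad \<phi> (?l t) \<bullet> b) (at t)"
      by (simp add: has_field_derivative_def mult_commute_abs)
    from DERIV_chain2[OF has_real_derivative_abs_powr[OF \<gamma>] this]
    show ?thesis unfolding G_def G'_def k_def .
  qed
  have contl: "continuous_on S ?l" for S by (intro continuous_intros)
  have contk: "continuous_on UNIV k"
    unfolding k_def using \<gamma> by (intro continuous_intros continuous_on_powr') auto
  have cont: "continuous_on S G'" for S
    unfolding G'_def
    by (intro continuous_intros continuous_on_compose2[OF contk] continuous_on_compose2[OF smooth_continuous[OF s] contl]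
       continuous_on_compose2[OF smooth_continuous_grad[OF s] contl]) auto
  obtain R where R: "\<And>x. x \<in> closure {x. \<phi> x \<noteq> 0} \<Longrightarrow> norm x \<le> R"
    using compact_imp_bounded[OF K] by (auto simp: bounded_iff)
  \<comment> \<open>Far enough to leave the support: the displacement |R| + |x| + 1 exceeds R even
    after losing |x| in the triangle inequality.\<close>
  define a where "a = x \<bullet> b - (\<bar>R\<bar> + norm x + 1)"
  have ab: "a \<le> x \<bullet> b"
    using norm_ge_zero[of x] abs_ge_zero[of R] unfolding a_def by linarith
  have "norm (?l a) \<ge> \<bar>a - x \<bullet> b\<bar> - norm x"
    using norm_diff_ineq[of "(a - x \<bullet> b) *\<^sub>R b" x] nb by (simp add: add.commute)
  moreover have "\<bar>a - x \<bullet> b\<bar> = \<bar>R\<bar> + norm x + 1"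
    using norm_ge_zero[of x] unfolding a_def by linarith
  ultimately have "norm (?l a) > R" by linarith
  then have "\<phi> (?l a) = 0" using R[of "?l a"] closure_subset[of "{x. \<phi> x \<noteq> 0}"] by force
  then have Ga: "G a = 0" by (simp add: G_def)
  have "\<bar>\<phi> x\<bar> powr \<gamma> = G (x \<bullet> b) - G a" by (simp add: Ga) (simp add: G_def)
  also have "\<dots> = (\<integral>t. indicator {a..x \<bullet> b} t *\<^sub>R G' t \<partial>lborel)"
    using D cont by (intro integral_FTC_Icc[OF ab, symmetric])
      (auto simp: has_real_derivative_iff_has_vector_derivative intro: has_vector_derivative_at_within)
  also have "\<dots> \<le> (\<integral>t. norm (indicator {a..x \<bullet> b} t *\<^sub>R G' t) \<partial>lborel)"
    using integral_norm_bound[of lborel "\<lambda>t. indicator {a..x \<bullet> b} t *\<^sub>R G' t"]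
    unfolding real_norm_def by linarith
  finally have "ennreal (\<bar>\<phi> x\<bar> powr \<gamma>) \<le> ennreal (\<integral>t. norm (indicator {a..x \<bullet> b} t *\<^sub>R G' t) \<partial>lborel)"
    by (rule ennreal_leI)
  also have "\<dots> = (\<integral>\<^sup>+t. ennreal (norm (indicator {a..x \<bullet> b} t *\<^sub>R G' t)) \<partial>lborel)"
    by (intro nn_integral_eq_integral[symmetric] integrable_norm borel_integrable_compact cont) auto
  also have "\<dots> \<le> (\<integral>\<^sup>+t. ennreal (\<gamma> * \<bar>\<phi> (?l t)\<bar> powr (\<gamma> - 1) * norm (grad \<phi> (?l t))) \<partial>lborel)"
  proof (intro nn_integral_mono ennreal_leI)
    fix t
    have "\<bar>k y\<bar> = \<gamma> * \<bar>y\<bar> powr (\<gamma> - 1)" for y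
      using \<gamma> by (cases "y > 0"; cases "y = 0") (auto simp: k_def abs_mult)
    then have "\<bar>G' t\<bar> \<le> \<gamma> * \<bar>\<phi> (?l t)\<bar> powr (\<gamma> - 1) * norm (grad \<phi> (?l t))"
      unfolding G'_def abs_mult using Cauchy_Schwarz_ineq2[of "grad \<phi> (?l t)" b] nb \<gamma>
      by (intro mult_mono) auto
    then show "norm (indicator {a..x \<bullet> b} t *\<^sub>R G' t) \<le> \<gamma> * \<bar>\<phi> (?l t)\<bar> powr (\<gamma> - 1) * norm (grad \<phi> (?l t))"
      using \<gamma> by (auto split: split_indicator)
  qed
  finally show ?thesis .
qed

lemma nn_integral_Holder2:
  fixes f g :: "'a \<Rightarrow> ennreal"
  assumes "0 < a" "0 < b" "a + b = (1::real)" "f \<in> borel_measurable M" "g \<in> borel_measurable M"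
  shows "(\<integral>\<^sup>+x. epowr (f x) a * epowr (g x) b \<partial>M) \<le> epowr (\<integral>\<^sup>+x. f x \<partial>M) a * epowr (\<integral>\<^sup>+x. g x \<partial>M) b"
proof -
  define h where "h i = (if i then f else g)" for i
  define e where "e i = (if i then a else b)" for i
  have "(\<integral>\<^sup>+x. (\<Prod>i\<in>(UNIV::bool set). epow (h i x) (e i)) \<partial>M) \<le> (\<Prod>i\<in>(UNIV::bool set). epow (\<integral>\<^sup>+x. h i x \<partial>M) (e i))"
    using assms by (intro nn_integral_prod_epow_le) (auto simp: h_def e_def UNIV_bool)
  then show ?thesis
    using assms by (simp add: UNIV_bool h_def e_def epow_def mult.commute)
qed

lemma Holder_integral:
  fixes f g :: "'a \<Rightarrow> real"
  assumes a: "0 < a" "0 < b" "a + b = (1::real)" and f: "integrable M f" "\<And>x. 0 \<le> f x" and g: "integrable M g" "\<And>x. 0 \<le> g x"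
  shows "integrable M (\<lambda>x. f x powr a * g x powr b)"
    "(\<integral>x. f x powr a * g x powr b \<partial>M) \<le> (\<integral>x. f x \<partial>M) powr a * (\<integral>x. g x \<partial>M) powr b"
proof -
  have [measurable]: "f \<in> borel_measurable M" "g \<in> borel_measurable M" using f g by auto
  have "(\<integral>\<^sup>+x. ennreal (f x powr a * g x powr b) \<partial>M) = (\<integral>\<^sup>+x. epowr (ennreal (f x)) a * epowr (ennreal (g x)) b \<partial>M)"
    using f g by (intro nn_integral_cong) (simp add: epowr_ennreal ennreal_mult)
  also have "\<dots> \<le> epowr (\<integral>\<^sup>+x. ennreal (f x) \<partial>M) a * epowr (\<integral>\<^sup>+x. ennreal (g x) \<partial>M) b"
    using a by (intro nn_integral_Holder2) auto
  also have "\<dots> = ennreal ((\<integral>x. f x \<partial>M) powr a * (\<integral>x. g x \<partial>M) powr b)"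
    using f g by (simp add: nn_integral_eq_integral epowr_ennreal integral_nonneg_AE ennreal_mult)
  finally have le: "(\<integral>\<^sup>+x. ennreal (f x powr a * g x powr b) \<partial>M) \<le> ennreal ((\<integral>x. f x \<partial>M) powr a * (\<integral>x. g x \<partial>M) powr b)" .
  show int: "integrable M (\<lambda>x. f x powr a * g x powr b)"
    by (rule integrableI_bounded) (use le_less_trans[OF le ennreal_less_top] in \<open>auto simp: abs_mult\<close>)
  show "(\<integral>x. f x powr a * g x powr b \<partial>M) \<le> (\<integral>x. f x \<partial>M) powr a * (\<integral>x. g x \<partial>M) powr b"
    using le by (subst (asm) nn_integral_eq_integral[OF int]) (auto simp: ennreal_le_iff)
qed

lemma lower_exponent_gt_1:
  assumes "lower_exponent d p" "d \<ge> 2" shows "1 < p" "p < 2" "1 < p / (p - 1)" "1 / p + 1 / (p / (p - 1)) = 1" "2 < p / (p - 1)"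
proof -
  show p: "1 < p" "p < 2"
  proof -
    have "1 < 2 * real d / (real d + 2) \<and> 2 * real d / (real d + 2) < 2" if "d \<noteq> 2"
      using that assms(2) by (simp add: field_simps)
    then show "1 < p" "p < 2"
      using assms by (auto simp: lower_exponent_def split: if_splits)
  qed
  then show "1 < p / (p - 1)" "1 / p + 1 / (p / (p - 1)) = 1" "2 < p / (p - 1)"
    by (auto simp: field_simps)
qed

context bounded_open
begin

lemma nn_integral_LU:
  assumes "g \<in> borel_measurable borel" "\<And>x. x \<notin> U \<Longrightarrow> g x = 0"
  shows "(\<integral>\<^sup>+x. g x \<partial>LU) = (\<integral>\<^sup>+x. g x \<partial>lborel)"
proof -
  have "(\<integral>\<^sup>+x. g x \<partial>LU) = (\<integral>\<^sup>+x. g x * indicator U x \<partial>lebesgue)"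
    using U_sets by (simp add: nn_integral_restrict_space)
  also have "\<dots> = (\<integral>\<^sup>+x. g x \<partial>lebesgue)"
    using assms(2) by (intro nn_integral_cong) (auto split: split_indicator)
  finally show ?thesis by (simp add: nn_integral_completion)
qed

lemma integrable_bounded_LU:
  fixes f :: "real^'d \<Rightarrow> real"
  assumes "f \<in> borel_measurable LU" "\<And>x. \<bar>f x\<bar> \<le> C" shows "integrable LU f"
  by (rule finite_measure.integrable_const_bound[OF finite_LU, where B = C]) (use assms in auto)

text \<open>After the Gagliardo-Nirenberg step for |\<phi>|^\<gamma>, the Cauchy-Schwarz inequality
  splits off the gradient and leaves |\<phi>|^(2 (\<gamma> - 1)). The exponent \<gamma> stays free,
  because it is matched differently in dimension two and in higher dimensions.\<close>

lemma sobolev_powr: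
  assumes \<phi>: "test_function U \<phi>" and \<gamma>: "\<gamma> > 1" and d: "CARD('d) \<ge> 2"
  defines "\<kappa> \<equiv> real CARD('d) / (real CARD('d) - 1)"
  shows "(\<integral>x. \<bar>\<phi> x\<bar> powr (\<gamma> * \<kappa>) \<partial>LU) \<le> (\<gamma> * sqrt (\<integral>x. \<bar>\<phi> x\<bar> powr (2 * (\<gamma> - 1)) \<partial>LU) * l2 LU (grad \<phi>)) powr \<kappa>"
proof -
  have s: "smooth \<phi>" and K: "compact (closure {x. \<phi> x \<noteq> 0})" using \<phi> by (auto simp: test_function_def)
  have [measurable]: "\<phi> \<in> borel_measurable borel" "grad \<phi> \<in> borel_measurable borel"
    using s by (auto intro!: borel_measurable_continuous_onI smooth_continuous smooth_continuous_grad)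
  have [measurable]: "\<phi> \<in> borel_measurable LU" "grad \<phi> \<in> borel_measurable LU"
    using test_measurable[OF \<phi>] by auto
  have \<kappa>: "\<kappa> > 1" using d by (simp add: \<kappa>_def)
  obtain C where C: "\<And>x. \<bar>\<phi> x\<bar> \<le> C" using test_function_bounded[OF \<phi>] by metis
  have int: "integrable LU (\<lambda>x. \<bar>\<phi> x\<bar> powr r)" if "r > 0" for r
    using C that by (intro integrable_bounded_LU[of _ "C powr r"]) (auto intro!: powr_mono2)
  let ?h = "\<lambda>x. \<gamma> * \<bar>\<phi> x\<bar> powr (\<gamma> - 1) * norm (grad \<phi> x)"
  let ?f = "\<lambda>x. \<gamma> * \<bar>\<phi> x\<bar> powr (\<gamma> - 1)"
  have f: "sq_int LU ?f"
    using C \<gamma> by (intro sq_int_bounded[of _ "\<gamma> * C powr (\<gamma> - 1)"]) (auto simp: abs_mult intro!: powr_mono2)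
  have "ennreal (\<integral>x. \<bar>\<phi> x\<bar> powr (\<gamma> * \<kappa>) \<partial>LU) = (\<integral>\<^sup>+x. ennreal (\<bar>\<phi> x\<bar> powr (\<gamma> * \<kappa>)) \<partial>LU)"
    using int \<gamma> \<kappa> by (intro nn_integral_eq_integral[symmetric]) auto
  also have "\<dots> = (\<integral>\<^sup>+x. ennreal (\<bar>\<phi> x\<bar> powr (\<gamma> * \<kappa>)) \<partial>lborel)"
    using test_function_eq_0[OF \<phi>] by (intro nn_integral_LU) auto
  also have "\<dots> = (\<integral>\<^sup>+x. epowr (ennreal (\<bar>\<phi> x\<bar> powr \<gamma>)) \<kappa> \<partial>lborel)"
    by (simp add: epowr_ennreal powr_powr)
  also have "\<dots> \<le> epowr (\<integral>\<^sup>+x. ennreal (?h x) \<partial>lborel) \<kappa>"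
  proof -
    have DIM: "DIM(real^'d) = CARD('d)" by simp
    show ?thesis
      using Gagliardo_Nirenberg[of "\<lambda>x. ennreal (\<bar>\<phi> x\<bar> powr \<gamma>)" "\<lambda>x. ennreal (?h x)"] d
        powr_le_line_integral[OF s K \<gamma>] unfolding DIM \<kappa>_def by simp
  qed
  also have "(\<integral>\<^sup>+x. ennreal (?h x) \<partial>lborel) = (\<integral>\<^sup>+x. ennreal (norm (?f x) * norm (grad \<phi> x)) \<partial>LU)"
    using test_function_eq_0[OF \<phi>] \<gamma> by (subst nn_integral_LU[symmetric]) (auto simp: abs_mult)
  also have "epowr \<dots> \<kappa> \<le> epowr (ennreal (l2 LU ?f * l2 LU (grad \<phi>))) \<kappa>"
    using \<kappa> by (intro epowr_mono Cauchy_Schwarz_l2_nn f test_sq_int(2)[OF \<phi>]) auto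
  also have "l2 LU ?f = \<gamma> * sqrt (\<integral>x. \<bar>\<phi> x\<bar> powr (2 * (\<gamma> - 1)) \<partial>LU)"
  proof -
    have "(norm (?f x))\<^sup>2 = \<gamma>\<^sup>2 * \<bar>\<phi> x\<bar> powr (2 * (\<gamma> - 1))" for x
      by (simp add: power_mult_distrib power2_eq_square flip: powr_add)
    then show ?thesis using \<gamma> by (simp add: l2_def real_sqrt_mult)
  qed
  finally show ?thesis
    using \<gamma> by (simp add: epowr_ennreal ennreal_le_iff mult.assoc)
qed

theorem sobolev_inequality_test:
  assumes \<phi>: "test_function U \<phi>" and d: "CARD('d) \<ge> 2" and p: "lower_exponent CARD('d) p"
  defines "q \<equiv> p / (p - 1)"
  shows "(\<integral>x. \<bar>\<phi> x\<bar> powr q \<partial>LU) powr (1 / q) \<le> N_const CARD('d) p (measure lebesgue U) * l2 LU (grad \<phi>)"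
proof -
  let ?J = "\<integral>x. \<bar>\<phi> x\<bar> powr q \<partial>LU" and ?X = "l2 LU (grad \<phi>)" and ?v = "measure lebesgue U"
  have [measurable]: "\<phi> \<in> borel_measurable LU"
    using test_measurable[OF \<phi>] by auto
  have q: "q > 2" using lower_exponent_gt_1[OF p d] by (simp add: q_def)
  obtain C where C: "\<And>x. \<bar>\<phi> x\<bar> \<le> C" using test_function_bounded[OF \<phi>] by metis
  have int: "integrable LU (\<lambda>x. \<bar>\<phi> x\<bar> powr q)"
    using C q by (intro integrable_bounded_LU[of _ "C powr q"]) (auto intro!: powr_mono2)
  have J0: "0 \<le> ?J" by (rule integral_nonneg_AE) auto
  show ?thesis
  proof (cases "?J = 0")
    case True
    have "0 \<le> N_const CARD('d) p ?v"
      using d q by (auto simp: N_const_def q_def[symmetric] Let_def)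
    then show ?thesis using True by simp
  next
    case False
    then have J: "?J > 0" using J0 by (simp add: less_le)
    show ?thesis
    proof (cases "CARD('d) = 2")
      case True
      \<comment> \<open>For d = 2 the power \<kappa> of \<open>sobolev_powr\<close> is 2, so this
        choice puts q on the left.\<close>
      define \<gamma> where "\<gamma> = q / 2"
      have \<gamma>: "\<gamma> > 1" "q = 2 * \<gamma>" using q by (auto simp: \<gamma>_def)
      \<comment> \<open>On the right the exponent 2 (\<gamma> - 1) = q - 2 is smaller than q;
        Hoelder's inequality against the constant 1 restores q, and this is where the power of |U|
        in \<open>N\<close> comes from.\<close>
      have H: "(\<integral>x. \<bar>\<phi> x\<bar> powr (2 * (\<gamma> - 1)) \<partial>LU) \<le> ?J powr ((\<gamma> - 1) / \<gamma>) * ?v powr (1 / \<gamma>)"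
      proof -
        have "(\<integral>x. (\<bar>\<phi> x\<bar> powr q) powr ((\<gamma> - 1) / \<gamma>) * 1 powr (1 / \<gamma>) \<partial>LU) \<le> ?J powr ((\<gamma> - 1) / \<gamma>) * (\<integral>x. 1 \<partial>LU) powr (1 / \<gamma>)"
          using \<gamma>(1) int finite_measure.integrable_const[OF finite_LU]
          by (intro Holder_integral) (auto simp: field_simps)
        moreover have "(\<bar>\<phi> x\<bar> powr q) powr ((\<gamma> - 1) / \<gamma>) * 1 powr (1 / \<gamma>) = \<bar>\<phi> x\<bar> powr (2 * (\<gamma> - 1))" for x
          using \<gamma> by (simp add: powr_powr)
        ultimately show ?thesis by (simp add: measure_LU)
      qed
      have "?J \<le> (\<gamma> * sqrt (\<integral>x. \<bar>\<phi> x\<bar> powr (2 * (\<gamma> - 1)) \<partial>LU) * ?X) powr 2"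
        using sobolev_powr[OF \<phi> \<gamma>(1) d] by (simp add: True \<gamma>(2) mult.commute)
      also have "\<dots> = \<gamma>\<^sup>2 * (\<integral>x. \<bar>\<phi> x\<bar> powr (2 * (\<gamma> - 1)) \<partial>LU) * ?X\<^sup>2"
        using \<gamma>(1) by (simp add: powr_numeral power_mult_distrib)
      also have "\<dots> \<le> \<gamma>\<^sup>2 * (?J powr ((\<gamma> - 1) / \<gamma>) * ?v powr (1 / \<gamma>)) * ?X\<^sup>2"
        by (intro mult_right_mono mult_left_mono H) auto
      finally have "?J \<le> ?J powr ((\<gamma> - 1) / \<gamma>) * (\<gamma>\<^sup>2 * ?v powr (1 / \<gamma>) * ?X\<^sup>2)" by (simp add: mult_ac)
      moreover have "?J = ?J powr ((\<gamma> - 1) / \<gamma>) * ?J powr (1 / \<gamma>)"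
        using J \<gamma>(1) by (simp add: powr_add[symmetric] add_divide_distrib[symmetric])
      ultimately have "?J powr ((\<gamma> - 1) / \<gamma>) * ?J powr (1 / \<gamma>) \<le> ?J powr ((\<gamma> - 1) / \<gamma>) * (\<gamma>\<^sup>2 * ?v powr (1 / \<gamma>) * ?X\<^sup>2)"
        by simp
      then have "?J powr (1 / \<gamma>) \<le> \<gamma>\<^sup>2 * ?v powr (1 / \<gamma>) * ?X\<^sup>2"
        using J by simp
      moreover have "r powr (1 / \<gamma>) = (r powr (1 / q))\<^sup>2" for r
        using \<gamma> by (simp add: powr_powr flip: powr_numeral)
      ultimately have "(?J powr (1 / q))\<^sup>2 \<le> (\<gamma> * ?v powr (1 / q) * ?X)\<^sup>2"
        by (simp add: power_mult_distrib)
      then have "?J powr (1 / q) \<le> \<gamma> * ?v powr (1 / q) * ?X"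
        using \<gamma>(1) by (intro power2_le_imp_le[of "?J powr (1 / q)"]) auto
      then show ?thesis using True by (simp add: N_const_def q_def[symmetric] Let_def \<gamma>_def)
    next
      case False
      define D where "D = real CARD('d)"
      have D: "D \<ge> 3" using False d by (simp add: D_def)
      have pD: "p = 2 * D / (D + 2)" using p False by (simp add: lower_exponent_def D_def)
      have "p - 1 = (D - 2) / (D + 2)" using D by (simp add: pD field_simps)
      then have qD: "q = 2 * D / (D - 2)" using D by (simp add: q_def pD)
      \<comment> \<open>The value for which \<gamma> \<kappa> and 2 (\<gamma> - 1) coincide. Both
        equal q, so the same integral appears on both sides, and since 1 / \<kappa> = 1 / q + 1 / 2
        cancelling its square root leaves the power 1 / q with constant \<gamma>.\<close>
      define \<gamma> where "\<gamma> = 2 * (D - 1) / (D - 2)"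
      define \<kappa> where "\<kappa> = D / (D - 1)"
      have \<gamma>: "\<gamma> > 1" "\<gamma> * \<kappa> = q" "2 * (\<gamma> - 1) = q" and \<kappa>: "\<kappa> > 0" "1 / \<kappa> = 1 / q + 1 / 2"
      proof -
        have ne: "D - 1 \<noteq> 0" "D - 2 \<noteq> 0" using D by auto
        have "\<gamma> * \<kappa> = (D - 1) * (2 * D) / ((D - 1) * (D - 2))" by (simp add: \<gamma>_def \<kappa>_def mult_ac)
        then show "\<gamma> * \<kappa> = q" using nonzero_mult_divide_mult_cancel_left[OF ne(1), of "2 * D" "D - 2"] by (simp only: qD)
        show "\<gamma> > 1" "2 * (\<gamma> - 1) = q" "\<kappa> > 0" "1 / \<kappa> = 1 / q + 1 / 2"
          using D by (auto simp: \<gamma>_def \<kappa>_def qD field_simps)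
      qed
      have "?J \<le> (\<gamma> * sqrt ?J * ?X) powr \<kappa>"
        using sobolev_powr[OF \<phi> \<gamma>(1) d] by (simp only: \<gamma>(2,3) flip: D_def \<kappa>_def)
      then have "?J powr (1 / \<kappa>) \<le> ((\<gamma> * sqrt ?J * ?X) powr \<kappa>) powr (1 / \<kappa>)"
        using \<kappa>(1) J0 by (intro powr_mono2) auto
      also have "\<dots> = \<gamma> * sqrt ?J * ?X" using \<kappa>(1) \<gamma>(1) J0 by (simp add: powr_powr)
      finally have "sqrt ?J * ?J powr (1 / q) \<le> sqrt ?J * (\<gamma> * ?X)"
        using J0 by (simp add: \<kappa>(2) powr_add powr_half_sqrt mult_ac)
      then have "?J powr (1 / q) \<le> \<gamma> * ?X" using J by simp
      then show ?thesis using False by (simp add: N_const_def \<gamma>_def D_def)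
    qed
  qed
qed

text \<open>Fatou's lemma along the approximating sequence, which converges almost everywhere;
  integrability of |w|^q is part of the outcome, since nothing beyond L^2 was known of
  \<open>w\<close>.\<close>

theorem sobolev_inequality:
  assumes w: "sobolev_approx w g \<phi>" and d: "CARD('d) \<ge> 2" and p: "lower_exponent CARD('d) p"
  defines "q \<equiv> p / (p - 1)"
  shows "integrable LU (\<lambda>x. \<bar>w x\<bar> powr q)"
    "(\<integral>x. \<bar>w x\<bar> powr q \<partial>LU) powr (1 / q) \<le> N_const CARD('d) p (measure lebesgue U) * l2 LU g"
proof -
  let ?N = "N_const CARD('d) p (measure lebesgue U)"
  have q: "q > 2" using lower_exponent_gt_1[OF p d] by (simp add: q_def)
  have N: "0 \<le> ?N"
    using d q by (auto simp: N_const_def q_def[symmetric] Let_def)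
  have \<phi>: "test_function U (\<phi> j)" and g: "sq_int LU g" for j using w by (auto simp: sobolev_approx_def)
  have [measurable]: "\<phi> j \<in> borel_measurable LU" "w \<in> borel_measurable LU" for j
    using w test_measurable[OF \<phi>] by (auto simp: sobolev_approx_def sq_int_def)
  have lim: "(\<lambda>j. l2 LU (grad (\<phi> j))) \<longlonglongrightarrow> l2 LU g"
    using w by (intro tendsto_l2 g test_sq_int \<phi>) (auto simp: sobolev_approx_def)
  have bd: "(\<integral>\<^sup>+x. ennreal (\<bar>\<phi> j x\<bar> powr q) \<partial>LU) \<le> ennreal ((?N * l2 LU (grad (\<phi> j))) powr q)" for j
  proof -
    let ?J = "\<integral>x. \<bar>\<phi> j x\<bar> powr q \<partial>LU"
    obtain C where C: "\<And>x. \<bar>\<phi> j x\<bar> \<le> C" using test_function_bounded[OF \<phi>] by metis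
    have int: "integrable LU (\<lambda>x. \<bar>\<phi> j x\<bar> powr q)"
      using C q by (intro integrable_bounded_LU[of _ "C powr q"]) (auto intro!: powr_mono2)
    have J: "0 \<le> ?J" by (rule integral_nonneg_AE) auto
    have "(?J powr (1 / q)) powr q \<le> (?N * l2 LU (grad (\<phi> j))) powr q"
      using sobolev_inequality_test[OF \<phi> d p] q by (intro powr_mono2) (auto simp: q_def)
    then have "?J \<le> (?N * l2 LU (grad (\<phi> j))) powr q" using q J by (simp add: powr_powr)
    then show ?thesis using nn_integral_eq_integral[OF int] by (simp add: ennreal_leI)
  qed
  have "(\<integral>\<^sup>+x. ennreal (\<bar>w x\<bar> powr q) \<partial>LU) = (\<integral>\<^sup>+x. liminf (\<lambda>j. ennreal (\<bar>\<phi> j x\<bar> powr q)) \<partial>LU)"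
  proof (rule nn_integral_cong_AE)
    have "AE x in LU. (\<lambda>j. \<phi> j x) \<longlonglongrightarrow> w x" using w by (simp add: sobolev_approx_def)
    then show "AE x in LU. ennreal (\<bar>w x\<bar> powr q) = liminf (\<lambda>j. ennreal (\<bar>\<phi> j x\<bar> powr q))"
    proof eventually_elim
      fix x assume "(\<lambda>j. \<phi> j x) \<longlonglongrightarrow> w x"
      then have "(\<lambda>j. ennreal (\<bar>\<phi> j x\<bar> powr q)) \<longlonglongrightarrow> ennreal (\<bar>w x\<bar> powr q)"
        using q by (intro tendsto_ennrealI tendsto_powr' tendsto_intros) auto
      then show "ennreal (\<bar>w x\<bar> powr q) = liminf (\<lambda>j. ennreal (\<bar>\<phi> j x\<bar> powr q))"
        by (rule lim_imp_Liminf[OF trivial_limit_sequentially, symmetric])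
    qed
  qed
  also have "\<dots> \<le> liminf (\<lambda>j. \<integral>\<^sup>+x. ennreal (\<bar>\<phi> j x\<bar> powr q) \<partial>LU)"
    by (rule nn_integral_liminf) measurable
  also have "\<dots> \<le> liminf (\<lambda>j. ennreal ((?N * l2 LU (grad (\<phi> j))) powr q))"
    by (intro Liminf_mono always_eventually allI bd)
  also have "\<dots> = ennreal ((?N * l2 LU g) powr q)"
    using q N by (intro lim_imp_Liminf tendsto_ennrealI tendsto_powr' tendsto_intros lim) auto
  finally have le: "(\<integral>\<^sup>+x. ennreal (\<bar>w x\<bar> powr q) \<partial>LU) \<le> ennreal ((?N * l2 LU g) powr q)" .
  show int: "integrable LU (\<lambda>x. \<bar>w x\<bar> powr q)"
    by (rule integrableI_bounded) (use le_less_trans[OF le ennreal_less_top] in auto)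
  let ?J = "\<integral>x. \<bar>w x\<bar> powr q \<partial>LU"
  have "?J \<le> (?N * l2 LU g) powr q" using le nn_integral_eq_integral[OF int] by (simp add: ennreal_le_iff)
  moreover have "0 \<le> ?J" by (rule integral_nonneg_AE) auto
  ultimately have "?J powr (1 / q) \<le> ((?N * l2 LU g) powr q) powr (1 / q)" using q by (intro powr_mono2) auto
  then show "?J powr (1 / q) \<le> ?N * l2 LU g" using q N by (simp add: powr_powr)
qed

end

section \<open>Testing with a truncation of the solution\<close>

text \<open>
  \<open>soft_cut k\<close> is a smooth truncation of the identity at height \<open>k\<close>. It is explicit enough for
  \<open>soft_cut_defect\<close>, on which the \<open>L\<^sup>1\<close> estimate with the sharp constant rests.
\<close>

definition soft_cut :: "real \<Rightarrow> real \<Rightarrow> real" where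
  "soft_cut k t = k * t / sqrt (k\<^sup>2 + t\<^sup>2)"

definition soft_cut' :: "real \<Rightarrow> real \<Rightarrow> real" where
  "soft_cut' k t = (k / sqrt (k\<^sup>2 + t\<^sup>2)) ^ 3"

text \<open>The primitive of \<open>soft_cut k\<close> that vanishes at 0. This normalisation keeps
  the support, so composition with a test function gives a nonnegative test function, to which the
  divergence condition applies.\<close>

definition soft_cut_integral :: "real \<Rightarrow> real \<Rightarrow> real" where
  "soft_cut_integral k t = k * (sqrt (k\<^sup>2 + t\<^sup>2) - k)"

context
  fixes k :: real assumes k: "k > 0"
begin

lemma soft_cut_sqrt: "0 < k\<^sup>2 + t\<^sup>2" "0 < sqrt (k\<^sup>2 + t\<^sup>2)" "k \<le> sqrt (k\<^sup>2 + t\<^sup>2)" "\<bar>t\<bar> \<le> sqrt (k\<^sup>2 + t\<^sup>2)"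
proof -
  show *: "0 < k\<^sup>2 + t\<^sup>2" using k by (simp add: add_pos_nonneg)
  then show "0 < sqrt (k\<^sup>2 + t\<^sup>2)" by simp
  show "k \<le> sqrt (k\<^sup>2 + t\<^sup>2)" "\<bar>t\<bar> \<le> sqrt (k\<^sup>2 + t\<^sup>2)"
    by (auto intro: real_le_rsqrt)
qed

lemma soft_cut_0 [simp]: "soft_cut k 0 = 0" "soft_cut_integral k 0 = 0"
  using k by (auto simp: soft_cut_def soft_cut_integral_def)

lemma soft_cut_le: "\<bar>soft_cut k t\<bar> \<le> k"
proof -
  have "k * \<bar>t\<bar> \<le> k * sqrt (k\<^sup>2 + t\<^sup>2)" using k soft_cut_sqrt(4) by (intro mult_left_mono) auto
  then show ?thesis using k soft_cut_sqrt(2)[of t] by (simp add: soft_cut_def abs_mult divide_le_eq)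
qed

lemma soft_cut_integral_nonneg: "0 \<le> soft_cut_integral k t"
  using k soft_cut_sqrt(3)[of t] by (simp add: soft_cut_integral_def)

lemma soft_cut'_bounds: "0 \<le> soft_cut' k t" "soft_cut' k t \<le> 1"
proof -
  have "0 \<le> k / sqrt (k\<^sup>2 + t\<^sup>2)" "k / sqrt (k\<^sup>2 + t\<^sup>2) \<le> 1"
    using k soft_cut_sqrt[of t] by auto
  then show "0 \<le> soft_cut' k t" "soft_cut' k t \<le> 1"
    by (auto simp: soft_cut'_def power_le_one)
qed

lemma soft_cut_mult_nonneg: "0 \<le> t * soft_cut k t" "t * soft_cut k t = \<bar>t\<bar> * \<bar>soft_cut k t\<bar>"
proof -
  have "t * soft_cut k t = k * t\<^sup>2 / sqrt (k\<^sup>2 + t\<^sup>2)" by (simp add: soft_cut_def power2_eq_square)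
  then show "0 \<le> t * soft_cut k t" using k by simp
  then show "t * soft_cut k t = \<bar>t\<bar> * \<bar>soft_cut k t\<bar>" by (simp add: abs_mult[symmetric])
qed

text \<open>The right side is |t| (|t| + k) / sqrt(k^2 + t^2), so the claim reduces to sqrt(k^2 +
  t^2) \<le> |t| + k. For large |t| the first summand recovers |t|, for small |t| the
  second.\<close>

lemma soft_cut_defect: "\<bar>t\<bar> \<le> t * soft_cut k t / k + \<bar>soft_cut k t\<bar>"
proof -
  let ?s = "sqrt (k\<^sup>2 + t\<^sup>2)"
  have "k\<^sup>2 + t\<^sup>2 \<le> (\<bar>t\<bar> + k)\<^sup>2" using k by (simp add: power2_sum)
  then have "?s \<le> \<bar>t\<bar> + k" using k by (intro real_le_lsqrt) auto
  then have "\<bar>t\<bar> * ?s \<le> \<bar>t\<bar> * (\<bar>t\<bar> + k)" by (intro mult_left_mono) auto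
  then have "\<bar>t\<bar> \<le> \<bar>t\<bar> * (\<bar>t\<bar> + k) / ?s" using soft_cut_sqrt(2)[of t] by (simp add: pos_le_divide_eq)
  also have "\<dots> = t * soft_cut k t / k + \<bar>soft_cut k t\<bar>"
    using k soft_cut_sqrt(2)[of t] by (simp add: soft_cut_def abs_mult add_divide_distrib distrib_left mult.commute)
  finally show ?thesis .
qed

lemma soft_cut_deriv: "(soft_cut k has_real_derivative soft_cut' k t) (at t)"
proof -
  let ?s = "sqrt (k\<^sup>2 + t\<^sup>2)"
  have s: "?s > 0" "?s\<^sup>2 = k\<^sup>2 + t\<^sup>2" using soft_cut_sqrt[of t] by auto
  have "((\<lambda>t. sqrt (k\<^sup>2 + t\<^sup>2)) has_real_derivative t / ?s) (at t)"
    using soft_cut_sqrt(1)[of t] by (auto intro!: derivative_eq_intros simp: field_simps)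
  moreover have "?s \<noteq> 0" by (rule less_imp_neq[OF s(1), symmetric])
  ultimately have "(soft_cut k has_real_derivative (k * 1 * ?s - k * t * (t / ?s)) / (?s * ?s)) (at t)"
    unfolding soft_cut_def[abs_def] by (intro DERIV_divide DERIV_cmult DERIV_ident)
  also have "(k * 1 * ?s - k * t * (t / ?s)) / (?s * ?s) = k * (?s\<^sup>2 - t\<^sup>2) / ?s ^ 3"
  proof -
    have "(k * 1 * y - k * t * (t / y)) / (y * y) = k * (y\<^sup>2 - t\<^sup>2) / y ^ 3" if "y > 0" for y
      using that by (simp add: field_simps power2_eq_square power3_eq_cube)
    then show ?thesis using s(1) by blast
  qed
  also have "\<dots> = soft_cut' k t"
    unfolding s(2) soft_cut'_def by (simp add: power_divide power2_eq_square power3_eq_cube)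
  finally show ?thesis .
qed

lemma soft_cut_integral_deriv: "(soft_cut_integral k has_real_derivative soft_cut k t) (at t)"
proof -
  have "((\<lambda>t. sqrt (k\<^sup>2 + t\<^sup>2)) has_real_derivative t / sqrt (k\<^sup>2 + t\<^sup>2)) (at t)"
    using soft_cut_sqrt(1)[of t] by (auto intro!: derivative_eq_intros simp: field_simps)
  from DERIV_cmult[OF DERIV_diff[OF this DERIV_const[of k]], of k]
  show ?thesis by (simp add: soft_cut_integral_def[abs_def] soft_cut_def)
qed

lemma soft_cut_continuous: "continuous_on S (soft_cut k)"
  using soft_cut_deriv by (meson DERIV_isCont continuous_at_imp_continuous_on)

lemma soft_cut'_continuous: "continuous_on S (soft_cut' k)"
  unfolding soft_cut'_def using soft_cut_sqrt(2) by (intro continuous_intros) (auto simp: less_imp_neq[symmetric])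

lemma soft_cut_Lipschitz: "\<bar>soft_cut k s - soft_cut k t\<bar> \<le> \<bar>s - t\<bar>"
proof -
  have *: "\<bar>soft_cut k s - soft_cut k t\<bar> \<le> \<bar>s - t\<bar>" if "s < t" for s t
  proof -
    obtain z where "soft_cut k t - soft_cut k s = (t - s) * soft_cut' k z"
      using MVT2[OF \<open>s < t\<close>, of "soft_cut k" "soft_cut' k"] soft_cut_deriv by blast
    then have "\<bar>soft_cut k t - soft_cut k s\<bar> = (t - s) * soft_cut' k z"
      using that soft_cut'_bounds(1)[of z] by (simp add: abs_mult)
    also have "\<dots> \<le> (t - s) * 1" using that soft_cut'_bounds(2)[of z] by (intro mult_left_mono) auto
    finally show ?thesis using that by (simp add: abs_minus_commute)
  qed
  show ?thesis
    using *[of s t] *[of t s] by (cases s t rule: linorder_cases) (auto simp: abs_minus_commute)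
qed

text \<open>The base k^2 + \<phi>^2 is bounded away from 0, so its powers 1/2 and -1/2 are smooth by
  \<open>smooth_powr\<close>.\<close>

lemma smooth_soft_cut:
  assumes "smooth \<phi>"
  shows "smooth (\<lambda>x. soft_cut k (\<phi> x))" "smooth (\<lambda>x. soft_cut_integral k (\<phi> x))"
    "grad (\<lambda>x. soft_cut k (\<phi> x)) x = soft_cut' k (\<phi> x) *\<^sub>R grad \<phi> x"
    "grad (\<lambda>x. soft_cut_integral k (\<phi> x)) x = soft_cut k (\<phi> x) *\<^sub>R grad \<phi> x"
proof -
  have sq: "smooth (\<lambda>x. k\<^sup>2 + \<phi> x * \<phi> x)" by (intro smooth_add smooth_const smooth_mult assms)
  have pos: "0 < k\<^sup>2 + \<phi> x * \<phi> x" for x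
    using soft_cut_sqrt(1)[of "\<phi> x"] by (simp add: power2_eq_square)
  have "smooth (\<lambda>x. k * \<phi> x * (k\<^sup>2 + \<phi> x * \<phi> x) powr (- (1/2)))"
    by (intro smooth_mult smooth_const assms smooth_powr sq pos)
  moreover have "k * \<phi> x * (k\<^sup>2 + \<phi> x * \<phi> x) powr (- (1/2)) = soft_cut k (\<phi> x)" for x
  proof -
    have "(k\<^sup>2 + \<phi> x * \<phi> x) powr (- (1/2)) = inverse (sqrt (k\<^sup>2 + \<phi> x * \<phi> x))"
      using pos[of x] by (simp only: powr_minus powr_half_sqrt less_imp_le)
    then show ?thesis by (simp only: soft_cut_def divide_inverse power2_eq_square[of "\<phi> x"])
  qed
  ultimately show "smooth (\<lambda>x. soft_cut k (\<phi> x))" by simp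
  have "smooth (\<lambda>x. k * ((k\<^sup>2 + \<phi> x * \<phi> x) powr (1/2) + (- k)))"
    by (intro smooth_mult smooth_const smooth_add smooth_powr sq pos)
  moreover have "k * ((k\<^sup>2 + \<phi> x * \<phi> x) powr (1/2) + (- k)) = soft_cut_integral k (\<phi> x)" for x
  proof -
    have "(k\<^sup>2 + \<phi> x * \<phi> x) powr (1/2) = sqrt (k\<^sup>2 + \<phi> x * \<phi> x)"
      using pos[of x] by (simp only: powr_half_sqrt less_imp_le)
    then show ?thesis by (simp add: soft_cut_integral_def power2_eq_square[of "\<phi> x"])
  qed
  ultimately show "smooth (\<lambda>x. soft_cut_integral k (\<phi> x))" by simp
  have chain: "grad (\<lambda>x. h (\<phi> x)) x = h' *\<^sub>R grad \<phi> x" if "(h has_real_derivative h') (at (\<phi> x))" for h h'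
    using has_derivative_compose[OF smooth_has_derivative[OF assms] that[unfolded has_field_derivative_def]]
    by (intro grad_eqI) (simp add: inner_scaleR_left)
  show "grad (\<lambda>x. soft_cut k (\<phi> x)) x = soft_cut' k (\<phi> x) *\<^sub>R grad \<phi> x"
    by (rule chain[OF soft_cut_deriv])
  show "grad (\<lambda>x. soft_cut_integral k (\<phi> x)) x = soft_cut k (\<phi> x) *\<^sub>R grad \<phi> x"
    by (rule chain[OF soft_cut_integral_deriv])
qed

lemma test_soft_cut:
  assumes "test_function U \<phi>"
  shows "test_function U (\<lambda>x. soft_cut k (\<phi> x))" "test_function U (\<lambda>x. soft_cut_integral k (\<phi> x))"
  using smooth_soft_cut[OF test_function_smooth[OF assms]] by (auto intro: test_function_subset[OF assms])

end

lemma soft_cut'_tendsto: "(\<lambda>n. soft_cut' (real (Suc n)) t) \<longlonglongrightarrow> 1"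
proof -
  have "(\<lambda>n. (1 / sqrt (1 + (t * inverse (real (Suc n)))\<^sup>2)) ^ 3) \<longlonglongrightarrow> (1 / sqrt (1 + (t * 0)\<^sup>2)) ^ 3"
    by (intro tendsto_intros LIMSEQ_inverse_real_of_nat) auto
  moreover have "(1 / sqrt (1 + (t * inverse k)\<^sup>2)) ^ 3 = soft_cut' k t" if k: "k > 0" for k
  proof -
    have "k * sqrt (1 + (t * inverse k)\<^sup>2) = sqrt (k\<^sup>2 * (1 + (t * inverse k)\<^sup>2))"
      using k by (simp add: real_sqrt_mult)
    also have "k\<^sup>2 * (1 + (t * inverse k)\<^sup>2) = k\<^sup>2 + t\<^sup>2"
      using k by (simp add: field_simps)
    finally have "k / sqrt (k\<^sup>2 + t\<^sup>2) = 1 / sqrt (1 + (t * inverse k)\<^sup>2)"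
      using k by (metis mult.right_neutral nonzero_mult_divide_mult_cancel_left less_imp_neq)
    then show ?thesis by (simp add: soft_cut'_def)
  qed
  ultimately show ?thesis by (simp del: of_nat_Suc)
qed

section \<open>Truncation of Sobolev functions and the tested equation\<close>

context bounded_open
begin

text \<open>The chain rule for the truncation, in the form of an explicit approximating sequence. It
  makes the Poincare and Sobolev inequalities available for \<open>soft_cut k\<close> of
  \<open>w\<close>.\<close>

lemma sobolev_approx_soft_cut:
  assumes w: "sobolev_approx w g \<phi>" and k: "k > 0"
  shows "sobolev_approx (\<lambda>x. soft_cut k (w x)) (\<lambda>x. soft_cut' k (w x) *\<^sub>R g x) (\<lambda>j x. soft_cut k (\<phi> j x))"
proof -
  have \<phi>: "test_function U (\<phi> j)" and sw: "sq_int LU w" and sg: "sq_int LU g"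
    and lw: "(\<lambda>j. l2 LU (\<lambda>x. w x - \<phi> j x)) \<longlonglongrightarrow> 0" and lg: "(\<lambda>j. l2 LU (\<lambda>x. g x - grad (\<phi> j) x)) \<longlonglongrightarrow> 0"
    and ae: "AE x in LU. (\<lambda>j. \<phi> j x) \<longlonglongrightarrow> w x" for j
    using w by (auto simp: sobolev_approx_def)
  have [measurable]: "\<phi> j \<in> borel_measurable LU" "grad (\<phi> j) \<in> borel_measurable LU"
    "w \<in> borel_measurable LU" "g \<in> borel_measurable LU" for j
    using test_measurable[OF \<phi>] sw sg by (auto simp: sq_int_def)
  have [measurable]: "soft_cut k \<in> borel_measurable borel" "soft_cut' k \<in> borel_measurable borel"
    using soft_cut_continuous[OF k] soft_cut'_continuous[OF k] by (auto intro: borel_measurable_continuous_onI)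
  note test = test_soft_cut(1)[OF k \<phi>]
  have gr: "grad (\<lambda>x. soft_cut k (\<phi> j x)) x = soft_cut' k (\<phi> j x) *\<^sub>R grad (\<phi> j) x" for j x
    by (rule smooth_soft_cut(3)[OF k test_function_smooth[OF \<phi>]])
  have s'1: "\<bar>soft_cut' k t\<bar> \<le> 1" for t using soft_cut'_bounds[OF k, of t] by simp
  have s1: "sq_int LU (\<lambda>x. soft_cut k (w x))"
    by (rule sq_int_bounded[where C = k]) (use soft_cut_le[OF k] in auto)
  have sc: "sq_int LU (\<lambda>x. soft_cut' k (v x) *\<^sub>R h x)"
    if "sq_int LU h" "v \<in> borel_measurable LU" for v and h :: "real^'d \<Rightarrow> real^'d"
    using that s'1 by (intro sq_int_bound[OF that(1), where c = 1])
       (auto simp: sq_int_def intro!: mult_left_le_one_le)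
  have 1: "(\<lambda>j. l2 LU (\<lambda>x. soft_cut k (w x) - soft_cut k (\<phi> j x))) \<longlonglongrightarrow> 0"
  proof (rule tendsto_sandwich[OF _ _ tendsto_const lw])
    show "\<forall>\<^sub>F j in sequentially. l2 LU (\<lambda>x. soft_cut k (w x) - soft_cut k (\<phi> j x)) \<le> l2 LU (\<lambda>x. w x - \<phi> j x)"
      using soft_cut_Lipschitz[OF k]
      by (intro always_eventually allI l2_mono sq_int_diff sw test_sq_int \<phi>) auto
  qed simp
  have 2: "(\<lambda>j. l2 LU (\<lambda>x. soft_cut' k (w x) *\<^sub>R g x - soft_cut' k (\<phi> j x) *\<^sub>R grad (\<phi> j) x)) \<longlonglongrightarrow> 0"
  proof (rule tendsto_sandwich[OF _ _ tendsto_const])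
    \<comment> \<open>The gradient error is split into one part where only the derivative factor
      changes, small by dominated convergence against 4 |g|^2, and one where only the gradient
      changes, small because the factor is at most 1.\<close>
    let ?a = "\<lambda>j x. (soft_cut' k (w x) - soft_cut' k (\<phi> j x)) *\<^sub>R g x"
    let ?b = "\<lambda>j x. soft_cut' k (\<phi> j x) *\<^sub>R (g x - grad (\<phi> j) x)"
    have sa: "sq_int LU (?a j)" for j
      using sq_int_diff[OF sc[OF sg, of w] sc[OF sg, of "\<phi> j"]] by (simp add: scaleR_left_diff_distrib)
    have sb: "sq_int LU (?b j)" for j
      by (intro sc sq_int_diff sg test_sq_int \<phi>) auto
    have "l2 LU (\<lambda>x. soft_cut' k (w x) *\<^sub>R g x - soft_cut' k (\<phi> j x) *\<^sub>R grad (\<phi> j) x)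
        \<le> l2 LU (?a j) + l2 LU (\<lambda>x. g x - grad (\<phi> j) x)" for j
    proof -
      have "l2 LU (\<lambda>x. soft_cut' k (w x) *\<^sub>R g x - soft_cut' k (\<phi> j x) *\<^sub>R grad (\<phi> j) x) = l2 LU (\<lambda>x. ?a j x + ?b j x)"
        by (simp add: algebra_simps)
      also have "\<dots> \<le> l2 LU (?a j) + l2 LU (?b j)" by (rule l2_triangle[OF sa sb])
      also have "l2 LU (?b j) \<le> l2 LU (\<lambda>x. g x - grad (\<phi> j) x)"
        using s'1 by (intro l2_mono sq_int_diff sg test_sq_int \<phi>) (auto intro!: mult_left_le_one_le)
      finally show ?thesis by simp
    qed
    then show "\<forall>\<^sub>F j in sequentially. l2 LU (\<lambda>x. soft_cut' k (w x) *\<^sub>R g x - soft_cut' k (\<phi> j x) *\<^sub>R grad (\<phi> j) x)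
        \<le> l2 LU (?a j) + l2 LU (\<lambda>x. g x - grad (\<phi> j) x)" by (intro always_eventually allI)
    have "(\<lambda>j. \<integral>x. (norm (?a j x))\<^sup>2 \<partial>LU) \<longlonglongrightarrow> (\<integral>x. 0 \<partial>LU)"
    proof (rule integral_dominated_convergence[where w = "\<lambda>x. 4 * (norm (g x))\<^sup>2"])
      show "integrable LU (\<lambda>x. 4 * (norm (g x))\<^sup>2)" using sg by (auto simp: sq_int_def)
      show "AE x in LU. (\<lambda>j. (norm (?a j x))\<^sup>2) \<longlonglongrightarrow> 0"
        using ae
      proof eventually_elim
        fix x assume "(\<lambda>j. \<phi> j x) \<longlonglongrightarrow> w x"
        then have "(\<lambda>j. soft_cut' k (\<phi> j x)) \<longlonglongrightarrow> soft_cut' k (w x)"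
          using continuous_on_tendsto_compose[OF soft_cut'_continuous[OF k, of UNIV]] by auto
        then have "(\<lambda>j. (norm (?a j x))\<^sup>2) \<longlonglongrightarrow> (norm ((soft_cut' k (w x) - soft_cut' k (w x)) *\<^sub>R g x))\<^sup>2"
          by (intro tendsto_intros)
        then show "(\<lambda>j. (norm (?a j x))\<^sup>2) \<longlonglongrightarrow> 0" by simp
      qed
      show "AE x in LU. norm ((norm (?a j x))\<^sup>2) \<le> 4 * (norm (g x))\<^sup>2" for j
      proof (intro AE_I2)
        fix x
        have "\<bar>soft_cut' k (w x) - soft_cut' k (\<phi> j x)\<bar> \<le> 2"
          using s'1[of "w x"] s'1[of "\<phi> j x"] by linarith
        then have "norm (?a j x) \<le> 2 * norm (g x)" by (simp add: mult_right_mono)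
        then have "(norm (?a j x))\<^sup>2 \<le> (2 * norm (g x))\<^sup>2" by (intro power_mono) auto
        then show "norm ((norm (?a j x))\<^sup>2) \<le> 4 * (norm (g x))\<^sup>2" by (simp add: power_mult_distrib)
      qed
    qed measurable
    then have "(\<lambda>j. sqrt (\<integral>x. (norm (?a j x))\<^sup>2 \<partial>LU)) \<longlonglongrightarrow> sqrt 0" by (intro tendsto_intros) simp
    then have "(\<lambda>j. l2 LU (?a j)) \<longlonglongrightarrow> 0" by (simp add: l2_def)
    from tendsto_add[OF this lg]
    show "(\<lambda>j. l2 LU (?a j) + l2 LU (\<lambda>x. g x - grad (\<phi> j) x)) \<longlonglongrightarrow> 0" by simp
  qed simp
  have 3: "AE x in LU. (\<lambda>j. soft_cut k (\<phi> j x)) \<longlonglongrightarrow> soft_cut k (w x)"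
    using ae by eventually_elim (use continuous_on_tendsto_compose[OF soft_cut_continuous[OF k, of UNIV]] in auto)
  show ?thesis
    unfolding sobolev_approx_def gr using test s1 sc[OF sg, of w] 1 2 3 by auto
qed

text \<open>The truncated approximants are admissible in the equation and converge well enough for
  every term. \<sigma> stands for the flux A g and \<open>e\<close> for the zero order term, so
  neither the matrix nor the coefficient c has to be mentioned.\<close>

lemma tested_inequality:
  assumes w: "sobolev_approx w g \<phi>" and \<sigma>: "sq_int LU \<sigma>" and B: "sq_int LU B" "weak_div_nonpos U B"
    and e: "integrable LU e" and r: "integrable LU r" and G: "sq_int LU G"
    and eq: "\<And>\<psi>. test_function U \<psi> \<Longrightarrow> (\<integral>x. \<sigma> x \<bullet> grad \<psi> x + (B x \<bullet> g x + e x) * \<psi> x \<partial>LU)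
        = (\<integral>x. r x * \<psi> x + G x \<bullet> grad \<psi> x \<partial>LU)"
    and k: "k > 0"
  shows "(\<integral>x. (\<sigma> x \<bullet> g x) * soft_cut' k (w x) \<partial>LU) + (\<integral>x. e x * soft_cut k (w x) \<partial>LU)
       \<le> (\<integral>x. r x * soft_cut k (w x) \<partial>LU) + (\<integral>x. (G x \<bullet> g x) * soft_cut' k (w x) \<partial>LU)"
proof -
  have \<phi>: "test_function U (\<phi> j)" and sw: "sq_int LU w" and sg: "sq_int LU g"
    and lg: "(\<lambda>j. l2 LU (\<lambda>x. g x - grad (\<phi> j) x)) \<longlonglongrightarrow> 0"
    and ae: "AE x in LU. (\<lambda>j. \<phi> j x) \<longlonglongrightarrow> w x" for j
    using w by (auto simp: sobolev_approx_def)
  have [measurable]: "\<phi> j \<in> borel_measurable LU" "w \<in> borel_measurable LU" for j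
    using test_measurable[OF \<phi>] sw by (auto simp: sq_int_def)
  have [measurable]: "soft_cut k \<in> borel_measurable borel" "soft_cut' k \<in> borel_measurable borel"
    using soft_cut_continuous[OF k] soft_cut'_continuous[OF k] by (auto intro: borel_measurable_continuous_onI)
  have Bg: "integrable LU (\<lambda>x. B x \<bullet> g x)" by (rule Cauchy_Schwarz_l2(1)[OF B(1) sg])
  have s'1: "\<bar>soft_cut' k t\<bar> \<le> 1" for t using soft_cut'_bounds[OF k, of t] by simp
  have ae1: "AE x in LU. (\<lambda>j. soft_cut k (\<phi> j x)) \<longlonglongrightarrow> soft_cut k (w x)"
    using ae by eventually_elim (use continuous_on_tendsto_compose[OF soft_cut_continuous[OF k, of UNIV]] in auto)
  have ae2: "AE x in LU. (\<lambda>j. soft_cut' k (\<phi> j x)) \<longlonglongrightarrow> soft_cut' k (w x)"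
    using ae by eventually_elim (use continuous_on_tendsto_compose[OF soft_cut'_continuous[OF k, of UNIV]] in auto)
  have bnd: "(\<lambda>j. \<integral>x. f x * soft_cut k (\<phi> j x) \<partial>LU) \<longlonglongrightarrow> (\<integral>x. f x * soft_cut k (w x) \<partial>LU)" if "integrable LU f" for f
    using soft_cut_le[OF k] by (intro integral_bounded_convergence[OF that _ _ _ ae1, where K = k]) auto
  have pair: "(\<lambda>j. \<integral>x. (h x \<bullet> grad (\<phi> j) x) * soft_cut' k (\<phi> j x) \<partial>LU) \<longlonglongrightarrow> (\<integral>x. (h x \<bullet> g x) * soft_cut' k (w x) \<partial>LU)"
    if "sq_int LU h" for h
    using s'1 by (intro tendsto_integral_l2_pairing[OF that sg test_sq_int(2)[OF \<phi>] lg _ _ _ ae2, where K = 1]) auto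
  have "(\<lambda>j. \<integral>x. (B x \<bullet> grad (\<phi> j) x) * soft_cut k (\<phi> j x) \<partial>LU) \<longlonglongrightarrow> (\<integral>x. (B x \<bullet> g x) * soft_cut k (w x) \<partial>LU)"
    using soft_cut_le[OF k] by (intro tendsto_integral_l2_pairing[OF B(1) sg test_sq_int(2)[OF \<phi>] lg _ _ _ ae1, where K = k]) auto
  moreover have "0 \<le> (\<integral>x. (B x \<bullet> grad (\<phi> j) x) * soft_cut k (\<phi> j x) \<partial>LU)" for j
  proof -
    have "0 \<le> (\<integral>x. B x \<bullet> grad (\<lambda>x. soft_cut_integral k (\<phi> j x)) x \<partial>LU)"
      using B(2) test_soft_cut(2)[OF k \<phi>] soft_cut_integral_nonneg[OF k] unfolding weak_div_nonpos_def by blast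
    then show ?thesis
      by (simp add: smooth_soft_cut(4)[OF k test_function_smooth[OF \<phi>]] mult.commute)
  qed
  ultimately have Bpos: "0 \<le> (\<integral>x. (B x \<bullet> g x) * soft_cut k (w x) \<partial>LU)"
    by (intro LIMSEQ_le_const) auto
  have inth: "integrable LU (\<lambda>x. (h x \<bullet> grad (\<phi> j) x) * soft_cut' k (\<phi> j x))" if "sq_int LU h" for h j
    using s'1 by (intro integrable_times_bounded[OF Cauchy_Schwarz_l2(1)[OF that test_sq_int(2)[OF \<phi>]], where K = 1]) auto
  have intf: "integrable LU (\<lambda>x. f x * soft_cut k (\<phi> j x))" if "integrable LU f" for f j
    using soft_cut_le[OF k] by (intro integrable_times_bounded[OF that, where K = k]) auto
  \<comment> \<open>The drift is paired here with the limit gradient \<open>g\<close> and not with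
    that of \<phi>_j, so it has no evident sign for fixed \<open>j\<close>; only in the limit does
    it become the quantity of \<open>Bpos\<close>.\<close>
  have id: "(\<integral>x. (\<sigma> x \<bullet> grad (\<phi> j) x) * soft_cut' k (\<phi> j x) \<partial>LU)
      + ((\<integral>x. (B x \<bullet> g x) * soft_cut k (\<phi> j x) \<partial>LU) + (\<integral>x. e x * soft_cut k (\<phi> j x) \<partial>LU))
      = (\<integral>x. r x * soft_cut k (\<phi> j x) \<partial>LU) + (\<integral>x. (G x \<bullet> grad (\<phi> j) x) * soft_cut' k (\<phi> j x) \<partial>LU)" for j
  proof -
    have "(\<integral>x. (\<sigma> x \<bullet> grad (\<phi> j) x) * soft_cut' k (\<phi> j x) + ((B x \<bullet> g x) * soft_cut k (\<phi> j x) + e x * soft_cut k (\<phi> j x)) \<partial>LU)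
       = (\<integral>x. r x * soft_cut k (\<phi> j x) + (G x \<bullet> grad (\<phi> j) x) * soft_cut' k (\<phi> j x) \<partial>LU)"
      using eq[OF test_soft_cut(1)[OF k \<phi>[of j]]]
      by (simp add: smooth_soft_cut(3)[OF k test_function_smooth[OF \<phi>]] algebra_simps)
    then show ?thesis
      by (simp add: Bochner_Integration.integral_add inth[OF \<sigma>] inth[OF G] intf[OF Bg] intf[OF e] intf[OF r])
  qed
  have "(\<integral>x. (\<sigma> x \<bullet> g x) * soft_cut' k (w x) \<partial>LU)
      + ((\<integral>x. (B x \<bullet> g x) * soft_cut k (w x) \<partial>LU) + (\<integral>x. e x * soft_cut k (w x) \<partial>LU))
      = (\<integral>x. r x * soft_cut k (w x) \<partial>LU) + (\<integral>x. (G x \<bullet> g x) * soft_cut' k (w x) \<partial>LU)"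
    by (rule LIMSEQ_unique[OF tendsto_add[OF pair[OF \<sigma>] tendsto_add[OF bnd[OF Bg] bnd[OF e]]]])
       (unfold id, intro tendsto_add bnd[OF r] pair[OF G])
  then show ?thesis using Bpos by linarith
qed

end

section \<open>Energy and \<open>L\<^sup>1\<close> estimates\<close>

context bounded_open
begin

lemma poincare_approx:
  assumes P: "\<And>\<psi>. test_function U \<psi> \<Longrightarrow> l2 LU \<psi> \<le> P * l2 LU (grad \<psi>)" and w: "sobolev_approx w g \<phi>"
  shows "l2 LU w \<le> P * l2 LU g"
proof (rule LIMSEQ_le)
  have \<phi>: "test_function U (\<phi> j)" for j using w by (auto simp: sobolev_approx_def)
  show "(\<lambda>j. l2 LU (\<phi> j)) \<longlonglongrightarrow> l2 LU w"
    using w by (intro tendsto_l2) (auto simp: sobolev_approx_def intro: test_sq_int)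
  have "(\<lambda>j. l2 LU (grad (\<phi> j))) \<longlonglongrightarrow> l2 LU g"
    using w by (intro tendsto_l2) (auto simp: sobolev_approx_def intro: test_sq_int)
  then show "(\<lambda>j. P * l2 LU (grad (\<phi> j))) \<longlonglongrightarrow> P * l2 LU g" by (intro tendsto_intros)
  show "\<exists>N. \<forall>n\<ge>N. l2 LU (\<phi> n) \<le> P * l2 LU (grad (\<phi> n))" using P[OF \<phi>] by auto
qed

lemma soft_cut_measurable:
  assumes k: "k > 0" and [measurable]: "w \<in> borel_measurable LU"
  shows "(\<lambda>x. soft_cut k (w x)) \<in> borel_measurable LU" "(\<lambda>x. soft_cut' k (w x)) \<in> borel_measurable LU"
proof -
  have [measurable]: "soft_cut k \<in> borel_measurable borel" "soft_cut' k \<in> borel_measurable borel"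
    using soft_cut_continuous[OF k] soft_cut'_continuous[OF k] by (auto intro: borel_measurable_continuous_onI)
  show "(\<lambda>x. soft_cut k (w x)) \<in> borel_measurable LU" "(\<lambda>x. soft_cut' k (w x)) \<in> borel_measurable LU"
    by measurable
qed

text \<open>The weight \<open>soft_cut'\<close> appears to the first power in the coercive term,
  which gives X^2, and squared in the norm of the truncated gradient. Since it lies between 0 and 1,
  the latter norm is at most X, so one quantity serves both and also bounds the term with
  \<open>G\<close>. The contribution of c is dropped, as \<open>w\<close> and
  \<open>soft_cut k\<close> of \<open>w\<close> have the same sign.\<close>

lemma tested_estimate:
  assumes w: "sobolev_approx w g \<phi>" and \<sigma>: "sq_int LU \<sigma>" "AE x in LU. lam * (norm (g x))\<^sup>2 \<le> \<sigma> x \<bullet> g x"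
    and B: "sq_int LU B" "weak_div_nonpos U B"
    and c: "AE x in LU. 0 \<le> c x" "integrable LU (\<lambda>x. (c x + \<alpha>) * w x)"
    and r: "integrable LU r" and G: "sq_int LU G"
    and eq: "\<And>\<psi>. test_function U \<psi> \<Longrightarrow> (\<integral>x. \<sigma> x \<bullet> grad \<psi> x + (B x \<bullet> g x + (c x + \<alpha>) * w x) * \<psi> x \<partial>LU)
        = (\<integral>x. r x * \<psi> x + G x \<bullet> grad \<psi> x \<partial>LU)"
    and k: "k > 0"
  defines "X \<equiv> sqrt (\<integral>x. (norm (g x))\<^sup>2 * soft_cut' k (w x) \<partial>LU)"
  shows "lam * X\<^sup>2 + \<alpha> * (\<integral>x. w x * soft_cut k (w x) \<partial>LU) \<le> (\<integral>x. r x * soft_cut k (w x) \<partial>LU) + l2 LU G * X"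
    and "l2 LU (\<lambda>x. soft_cut' k (w x) *\<^sub>R g x) \<le> X" and "0 \<le> X"
    and "X\<^sup>2 = (\<integral>x. (norm (g x))\<^sup>2 * soft_cut' k (w x) \<partial>LU)"
proof -
  have sw: "sq_int LU w" and sg: "sq_int LU g" using w by (auto simp: sobolev_approx_def)
  have [measurable]: "w \<in> borel_measurable LU" "g \<in> borel_measurable LU" using sw sg by (auto simp: sq_int_def)
  note m[measurable] = soft_cut_measurable[OF k \<open>w \<in> borel_measurable LU\<close>]
  note s' = soft_cut'_bounds[OF k]
  have s'1: "\<bar>soft_cut' k t\<bar> \<le> 1" for t using s'[of t] by simp
  have int': "integrable LU (\<lambda>x. f x * soft_cut' k (w x))" if "integrable LU f" for f
    by (rule integrable_times_bounded[OF that m(2) s'1])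
  have int: "integrable LU (\<lambda>x. f x * soft_cut k (w x))" if "integrable LU f" for f
    by (rule integrable_times_bounded[OF that m(1) soft_cut_le[OF k]])
  note intX = int'[OF sq_int_integrable[OF sg]]
  have "0 \<le> (\<integral>x. (norm (g x))\<^sup>2 * soft_cut' k (w x) \<partial>LU)"
    using s' by (intro integral_nonneg_AE) auto
  then show X2: "X\<^sup>2 = (\<integral>x. (norm (g x))\<^sup>2 * soft_cut' k (w x) \<partial>LU)" and X0: "0 \<le> X" by (auto simp: X_def)
  have sg': "sq_int LU (\<lambda>x. soft_cut' k (w x) *\<^sub>R g x)"
    using s'1 by (intro sq_int_bound[OF sg, where c = 1]) (auto intro!: mult_left_le_one_le)
  show lX: "l2 LU (\<lambda>x. soft_cut' k (w x) *\<^sub>R g x) \<le> X"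
    unfolding l2_def X_def
  proof (intro real_sqrt_le_mono integral_mono_AE sq_int_integrable[OF sg'] intX AE_I2)
    fix x
    have "(soft_cut' k (w x))\<^sup>2 \<le> soft_cut' k (w x)"
      using s'[of "w x"] by (simp add: power2_eq_square mult_left_le_one_le)
    then have "(norm (g x))\<^sup>2 * (soft_cut' k (w x))\<^sup>2 \<le> (norm (g x))\<^sup>2 * soft_cut' k (w x)"
      by (intro mult_left_mono) auto
    then show "(norm (soft_cut' k (w x) *\<^sub>R g x))\<^sup>2 \<le> (norm (g x))\<^sup>2 * soft_cut' k (w x)"
      by (simp add: power_mult_distrib mult.commute)
  qed
  have "lam * X\<^sup>2 \<le> (\<integral>x. (\<sigma> x \<bullet> g x) * soft_cut' k (w x) \<partial>LU)"
  proof -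
    have "lam * X\<^sup>2 = (\<integral>x. lam * (norm (g x))\<^sup>2 * soft_cut' k (w x) \<partial>LU)"
      by (simp add: X2 mult.assoc)
    also have "\<dots> \<le> (\<integral>x. (\<sigma> x \<bullet> g x) * soft_cut' k (w x) \<partial>LU)"
    proof (rule integral_mono_AE)
      show "integrable LU (\<lambda>x. lam * (norm (g x))\<^sup>2 * soft_cut' k (w x))"
        using integrable_mult_right[OF intX, of lam] by (simp add: mult.assoc)
      show "integrable LU (\<lambda>x. (\<sigma> x \<bullet> g x) * soft_cut' k (w x))"
        by (rule int'[OF Cauchy_Schwarz_l2(1)[OF \<sigma>(1) sg]])
      show "AE x in LU. lam * (norm (g x))\<^sup>2 * soft_cut' k (w x) \<le> (\<sigma> x \<bullet> g x) * soft_cut' k (w x)"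
        using \<sigma>(2) by eventually_elim (use s'(1) in \<open>auto intro: mult_right_mono\<close>)
    qed
    finally show ?thesis .
  qed
  moreover have "\<alpha> * (\<integral>x. w x * soft_cut k (w x) \<partial>LU) \<le> (\<integral>x. ((c x + \<alpha>) * w x) * soft_cut k (w x) \<partial>LU)"
  proof -
    have iw: "integrable LU (\<lambda>x. w x * soft_cut k (w x))" by (rule int[OF sq_int_imp_integrable[OF sw]])
    have "\<alpha> * (\<integral>x. w x * soft_cut k (w x) \<partial>LU) = (\<integral>x. \<alpha> * (w x * soft_cut k (w x)) \<partial>LU)" by simp
    also have "\<dots> \<le> (\<integral>x. ((c x + \<alpha>) * w x) * soft_cut k (w x) \<partial>LU)"
    proof (rule integral_mono_AE[OF integrable_mult_right[OF iw] int[OF c(2)]])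
      show "AE x in LU. \<alpha> * (w x * soft_cut k (w x)) \<le> ((c x + \<alpha>) * w x) * soft_cut k (w x)"
        using c(1)
      proof eventually_elim
        fix x assume "0 \<le> c x"
        then have "0 \<le> c x * (w x * soft_cut k (w x))"
          using soft_cut_mult_nonneg(1)[OF k, of "w x"] by (rule mult_nonneg_nonneg)
        then show "\<alpha> * (w x * soft_cut k (w x)) \<le> ((c x + \<alpha>) * w x) * soft_cut k (w x)" by (simp add: algebra_simps)
      qed
    qed
    finally show ?thesis .
  qed
  moreover have "(\<integral>x. (G x \<bullet> g x) * soft_cut' k (w x) \<partial>LU) \<le> l2 LU G * X"
  proof -
    have "(\<integral>x. (G x \<bullet> g x) * soft_cut' k (w x) \<partial>LU) = (\<integral>x. G x \<bullet> (soft_cut' k (w x) *\<^sub>R g x) \<partial>LU)"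
      by (simp add: mult.commute)
    also have "\<dots> \<le> l2 LU G * l2 LU (\<lambda>x. soft_cut' k (w x) *\<^sub>R g x)"
      using Cauchy_Schwarz_l2(2)[OF G sg'] by simp
    also have "\<dots> \<le> l2 LU G * X" by (intro mult_left_mono lX) simp
    finally show ?thesis .
  qed
  ultimately show "lam * X\<^sup>2 + \<alpha> * (\<integral>x. w x * soft_cut k (w x) \<partial>LU) \<le> (\<integral>x. r x * soft_cut k (w x) \<partial>LU) + l2 LU G * X"
    using tested_inequality[OF w \<sigma>(1) B c(2) r G eq k] by linarith
qed

text \<open>
  For \<open>k = \<Gamma> / (\<alpha> m P)\<close> the terms containing the truncated gradient norm \<open>X\<close> are the claimed constant
  minus the square \<open>\<alpha> m P (lam / \<Gamma>) (X - \<Gamma> / lam)\<^sup>2\<close>.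
\<close>

theorem L1_estimate:
  assumes w: "sobolev_approx w g \<phi>" and \<sigma>: "sq_int LU \<sigma>" "AE x in LU. lam * (norm (g x))\<^sup>2 \<le> \<sigma> x \<bullet> g x"
    and B: "sq_int LU B" "weak_div_nonpos U B"
    and c: "AE x in LU. 0 \<le> c x" "integrable LU (\<lambda>x. (c x + \<alpha>) * w x)"
    and r: "integrable LU r" and G: "sq_int LU G"
    and eq: "\<And>\<psi>. test_function U \<psi> \<Longrightarrow> (\<integral>x. \<sigma> x \<bullet> grad \<psi> x + (B x \<bullet> g x + (c x + \<alpha>) * w x) * \<psi> x \<partial>LU)
        = (\<integral>x. r x * \<psi> x + G x \<bullet> grad \<psi> x \<partial>LU)"
    and pos: "lam > 0" "\<alpha> > 0" "P > 0" and P: "\<And>\<psi>. test_function U \<psi> \<Longrightarrow> l2 LU \<psi> \<le> P * l2 LU (grad \<psi>)"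
  shows "\<alpha> * (\<integral>x. \<bar>w x\<bar> \<partial>LU) \<le> (\<integral>x. \<bar>r x\<bar> \<partial>LU) + \<alpha> * sqrt (measure lebesgue U) * (P / lam) * l2 LU G"
proof -
  define m where "m = sqrt (measure lebesgue U)"
  have m0: "0 \<le> m" by (simp add: m_def)
  have sw: "sq_int LU w" using w by (auto simp: sobolev_approx_def)
  have mw: "w \<in> borel_measurable LU" using sw by (auto simp: sq_int_def)
  have one: "sq_int LU (\<lambda>x. 1 :: real)" "l2 LU (\<lambda>x. 1 :: real) = m"
    by (auto simp: l2_def m_def measure_LU intro: sq_int_bounded[of _ 1])
  have L1L2: "integrable LU (\<lambda>x. \<bar>v x\<bar>)" "(\<integral>x. \<bar>v x\<bar> \<partial>LU) \<le> m * l2 LU v" if "sq_int LU v" for v :: "real^'d \<Rightarrow> real"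
    using Cauchy_Schwarz_l2_norm[OF one(1) that] by (auto simp: one(2))
  \<comment> \<open>The truncation height will be proportional to \<Gamma>, so \<Gamma> has to be
    positive even if \<open>G\<close> vanishes; the norm of \<open>G\<close> itself is reached at
    the end by a limit from above.\<close>
  have bound: "\<alpha> * (\<integral>x. \<bar>w x\<bar> \<partial>LU) \<le> (\<integral>x. \<bar>r x\<bar> \<partial>LU) + \<alpha> * m * (P / lam) * \<Gamma>"
    if \<Gamma>: "l2 LU G \<le> \<Gamma>" "\<Gamma> > 0" for \<Gamma>
  \<comment> \<open>The height \<open>k\<close> has \<open>m\<close> in its denominator. If
    \<open>U\<close> is a null set the left side is already zero.\<close>
  proof (cases "m = 0")
    case True
    have "(\<integral>x. \<bar>w x\<bar> \<partial>LU) \<le> 0" using L1L2(2)[OF sw] True by simp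
    then have "\<alpha> * (\<integral>x. \<bar>w x\<bar> \<partial>LU) \<le> 0" using pos by (simp add: mult_le_0_iff)
    moreover have "0 \<le> (\<integral>x. \<bar>r x\<bar> \<partial>LU)" by (rule integral_nonneg_AE) auto
    ultimately have "\<alpha> * (\<integral>x. \<bar>w x\<bar> \<partial>LU) \<le> (\<integral>x. \<bar>r x\<bar> \<partial>LU)" by linarith
    then show ?thesis by (simp add: True)
  next
    case False
    then have m: "m > 0" using m0 by simp
    define k where "k = \<Gamma> / (\<alpha> * m * P)"
    have k: "k > 0" using m pos \<Gamma> by (simp add: k_def)
    define X where "X = sqrt (\<integral>x. (norm (g x))\<^sup>2 * soft_cut' k (w x) \<partial>LU)"
    note est = tested_estimate[OF w \<sigma> B c r G eq k, folded X_def]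
    let ?Q = "\<integral>x. w x * soft_cut k (w x) \<partial>LU"
    have iw: "integrable LU (\<lambda>x. w x * soft_cut k (w x))"
      by (rule integrable_times_bounded[OF sq_int_imp_integrable[OF sw] soft_cut_measurable(1)[OF k mw] soft_cut_le[OF k]])
    have sS: "sq_int LU (\<lambda>x. soft_cut k (w x))"
      by (rule sq_int_bounded[OF soft_cut_measurable(1)[OF k mw]]) (use soft_cut_le[OF k] in auto)
    have lS: "l2 LU (\<lambda>x. soft_cut k (w x)) \<le> P * X"
    proof -
      have "l2 LU (\<lambda>x. soft_cut k (w x)) \<le> P * l2 LU (\<lambda>x. soft_cut' k (w x) *\<^sub>R g x)"
        by (rule poincare_approx[OF P sobolev_approx_soft_cut[OF w k]])
      also have "\<dots> \<le> P * X" using est(2) pos by (intro mult_left_mono) auto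
      finally show ?thesis .
    qed
    have "(\<integral>x. \<bar>w x\<bar> \<partial>LU) \<le> (\<integral>x. w x * soft_cut k (w x) / k + \<bar>soft_cut k (w x)\<bar> \<partial>LU)"
      using iw L1L2(1)[OF sw] L1L2(1)[OF sS] soft_cut_defect[OF k] by (intro integral_mono_AE) auto
    also have "\<dots> = ?Q / k + (\<integral>x. \<bar>soft_cut k (w x)\<bar> \<partial>LU)"
      using iw L1L2(1)[OF sS] by simp
    also have "\<dots> \<le> ?Q / k + m * (P * X)"
      using L1L2(2)[OF sS] mult_left_mono[OF lS m0] by linarith
    finally have "\<alpha> * (\<integral>x. \<bar>w x\<bar> \<partial>LU) \<le> \<alpha> * (?Q / k + m * (P * X))"
      using pos by (intro mult_left_mono) auto
    also have "\<dots> = (\<alpha> * ?Q) / k + \<alpha> * m * P * X" by (simp add: algebra_simps)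
    \<comment> \<open>Because the truncation is bounded by exactly \<open>k\<close>, division by
      \<open>k\<close> leaves the L^1 norm of \<open>r\<close> with constant one. The negative
      quadratic term is kept to absorb the terms linear in X.\<close>
    also have "(\<alpha> * ?Q) / k \<le> (k * (\<integral>x. \<bar>r x\<bar> \<partial>LU) + \<Gamma> * X - lam * X\<^sup>2) / k"
    proof (rule divide_right_mono)
      have "(\<integral>x. r x * soft_cut k (w x) \<partial>LU) \<le> (\<integral>x. k * \<bar>r x\<bar> \<partial>LU)"
      proof (rule integral_mono_AE)
        show "integrable LU (\<lambda>x. r x * soft_cut k (w x))"
          by (rule integrable_times_bounded[OF r soft_cut_measurable(1)[OF k mw] soft_cut_le[OF k]])
        show "AE x in LU. r x * soft_cut k (w x) \<le> k * \<bar>r x\<bar>"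
        proof (intro AE_I2)
          fix x
          have "r x * soft_cut k (w x) \<le> \<bar>r x\<bar> * \<bar>soft_cut k (w x)\<bar>" by (metis abs_ge_self abs_mult)
          also have "\<dots> \<le> \<bar>r x\<bar> * k" by (intro mult_left_mono soft_cut_le[OF k]) auto
          finally show "r x * soft_cut k (w x) \<le> k * \<bar>r x\<bar>" by (simp add: mult.commute)
        qed
      qed (use r in auto)
      moreover have "l2 LU G * X \<le> \<Gamma> * X" using \<Gamma>(1) est(3) by (rule mult_right_mono)
      ultimately show "\<alpha> * ?Q \<le> k * (\<integral>x. \<bar>r x\<bar> \<partial>LU) + \<Gamma> * X - lam * X\<^sup>2"
        using est(1) by simp
    qed (use k in simp)
    also have "(k * (\<integral>x. \<bar>r x\<bar> \<partial>LU) + \<Gamma> * X - lam * X\<^sup>2) / k + \<alpha> * m * P * X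
        = (\<integral>x. \<bar>r x\<bar> \<partial>LU) + \<alpha> * m * P * (2 * X - lam * X\<^sup>2 / \<Gamma>)"
    proof -
      have "(k * (\<integral>x. \<bar>r x\<bar> \<partial>LU) + \<Gamma> * X - lam * X\<^sup>2) / k = (\<integral>x. \<bar>r x\<bar> \<partial>LU) + (\<Gamma> * X - lam * X\<^sup>2) * (1 / k)"
        using k by (simp add: field_simps)
      also have "1 / k = \<alpha> * m * P / \<Gamma>" by (simp add: k_def)
      finally show ?thesis using \<Gamma>(2) by (simp add: field_simps)
    qed
    also have "\<dots> \<le> (\<integral>x. \<bar>r x\<bar> \<partial>LU) + \<alpha> * m * P * (\<Gamma> / lam)"
    proof -
      have "0 \<le> (lam / \<Gamma>) * (X - \<Gamma> / lam)\<^sup>2" using pos \<Gamma> by simp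
      also have "\<dots> = \<Gamma> / lam - (2 * X - lam * X\<^sup>2 / \<Gamma>)"
        using pos \<Gamma> by (simp add: power2_eq_square field_simps)
      finally show ?thesis using pos m by (intro add_left_mono mult_left_mono) auto
    qed
    finally show ?thesis by (simp add: mult_ac)
  qed
  have "(\<lambda>n. (\<integral>x. \<bar>r x\<bar> \<partial>LU) + \<alpha> * m * (P / lam) * (l2 LU G + inverse (real (Suc n))))
      \<longlonglongrightarrow> (\<integral>x. \<bar>r x\<bar> \<partial>LU) + \<alpha> * m * (P / lam) * (l2 LU G + 0)"
    by (intro tendsto_intros LIMSEQ_inverse_real_of_nat)
  moreover have "\<alpha> * (\<integral>x. \<bar>w x\<bar> \<partial>LU) \<le> (\<integral>x. \<bar>r x\<bar> \<partial>LU) + \<alpha> * m * (P / lam) * (l2 LU G + inverse (real (Suc n)))" for n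
    by (rule bound) (auto simp: add_nonneg_pos)
  ultimately have "\<alpha> * (\<integral>x. \<bar>w x\<bar> \<partial>LU) \<le> (\<integral>x. \<bar>r x\<bar> \<partial>LU) + \<alpha> * m * (P / lam) * (l2 LU G + 0)"
    by (intro LIMSEQ_le_const) auto
  then show ?thesis by (simp add: m_def)
qed

section \<open>Pairings controlled by Hoelder's and Sobolev's inequalities\<close>

definition lp :: "real \<Rightarrow> (real^'d \<Rightarrow> real) \<Rightarrow> real" where
  "lp p f = (\<integral>x. \<bar>f x\<bar> powr p \<partial>LU) powr (1 / p)"

lemma lp_nonneg [simp]: "0 \<le> lp p f"
  by (simp add: lp_def)

lemma Lp_norm_eq_lp:
  fixes f :: "real^'d \<Rightarrow> real"
  assumes "0 < p"
  shows "in_Lp p U f \<longleftrightarrow> f \<in> borel_measurable LU \<and> integrable LU (\<lambda>x. \<bar>f x\<bar> powr p)"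
    and "in_Lp p U f \<Longrightarrow> Lp_norm p U f = ennreal (lp p f)"
proof -
  have *: "Lp_norm p U f = ennreal (lp p f)" if "integrable LU (\<lambda>x. \<bar>f x\<bar> powr p)"
    using that by (simp add: Lp_norm_def lp_def nn_integral_eq_integral epowr_ennreal integral_nonneg_AE)
  show iff: "in_Lp p U f \<longleftrightarrow> f \<in> borel_measurable LU \<and> integrable LU (\<lambda>x. \<bar>f x\<bar> powr p)"
  proof
    assume "in_Lp p U f"
    then have "f \<in> borel_measurable LU" "(\<integral>\<^sup>+x. ennreal (\<bar>f x\<bar> powr p) \<partial>LU) < \<infinity>"
      by (auto simp: in_Lp_def Lp_norm_def less_top[symmetric])
    then show "f \<in> borel_measurable LU \<and> integrable LU (\<lambda>x. \<bar>f x\<bar> powr p)"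
      by (auto intro!: integrableI_bounded)
  next
    assume "f \<in> borel_measurable LU \<and> integrable LU (\<lambda>x. \<bar>f x\<bar> powr p)"
    then show "in_Lp p U f" using * by (simp add: in_Lp_def)
  qed
  show "Lp_norm p U f = ennreal (lp p f)" if "in_Lp p U f" using that iff * by blast
qed

lemma Holder_lp:
  assumes p: "1 < p" and f: "f \<in> borel_measurable LU" "integrable LU (\<lambda>x. \<bar>f x\<bar> powr p)"
    and v: "v \<in> borel_measurable LU" "integrable LU (\<lambda>x. \<bar>v x\<bar> powr (p / (p - 1)))"
  shows "integrable LU (\<lambda>x. f x * v x)" "(\<integral>x. \<bar>f x * v x\<bar> \<partial>LU) \<le> lp p f * lp (p / (p - 1)) v"
proof -
  let ?q = "p / (p - 1)"
  have q: "0 < 1 / p" "0 < 1 / ?q" "1 / p + 1 / ?q = 1" using p by (auto simp: field_simps)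
  have eq: "(\<bar>f x\<bar> powr p) powr (1 / p) * (\<bar>v x\<bar> powr ?q) powr (1 / ?q) = \<bar>f x * v x\<bar>" for x
    using p by (simp add: powr_powr abs_mult)
  have "integrable LU (\<lambda>x. \<bar>f x * v x\<bar>)"
    using Holder_integral(1)[OF q f(2) _ v(2)] unfolding eq by simp
  then show "integrable LU (\<lambda>x. f x * v x)"
    using f(1) v(1) by (subst (asm) integrable_abs_iff) auto
  show "(\<integral>x. \<bar>f x * v x\<bar> \<partial>LU) \<le> lp p f * lp ?q v"
    using Holder_integral(2)[OF q f(2) _ v(2)] unfolding eq lp_def by simp
qed

text \<open>p and p / (p - 1) are conjugate, and the latter is the Sobolev exponent. This single
  bound serves the perturbation (c - c_n) u, the zero order terms, and the datum f in the energy
  estimate.\<close>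

lemma sobolev_lp:
  assumes w: "sobolev_approx w g \<phi>" and d: "CARD('d) \<ge> 2" and p: "lower_exponent CARD('d) p"
    and f: "f \<in> borel_measurable LU" "integrable LU (\<lambda>x. \<bar>f x\<bar> powr p)"
  shows "integrable LU (\<lambda>x. f x * w x)"
    "(\<integral>x. \<bar>f x * w x\<bar> \<partial>LU) \<le> lp p f * (N_const CARD('d) p (measure lebesgue U) * l2 LU g)"
proof -
  have m: "w \<in> borel_measurable LU" using w by (auto simp: sobolev_approx_def sq_int_def)
  note p1 = lower_exponent_gt_1(1)[OF p d]
  note sob = sobolev_inequality[OF w d p]
  show "integrable LU (\<lambda>x. f x * w x)" by (rule Holder_lp(1)[OF p1 f m sob(1)])
  have "(\<integral>x. \<bar>f x * w x\<bar> \<partial>LU) \<le> lp p f * lp (p / (p - 1)) w" by (rule Holder_lp(2)[OF p1 f m sob(1)])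
  also have "\<dots> \<le> lp p f * (N_const CARD('d) p (measure lebesgue U) * l2 LU g)"
    using sob(2) by (intro mult_left_mono) (auto simp: lp_def)
  finally show "(\<integral>x. \<bar>f x * w x\<bar> \<partial>LU) \<le> lp p f * (N_const CARD('d) p (measure lebesgue U) * l2 LU g)" .
qed

lemma N_const_nonneg:
  assumes d: "CARD('d) \<ge> 2" and p: "lower_exponent CARD('d) p"
  shows "0 \<le> N_const CARD('d) p (measure lebesgue U)"
  using lower_exponent_gt_1[OF p d] d by (auto simp: N_const_def Let_def)

text \<open>Formally one tests with the solution itself, but the drift term need not be integrable
  then. The truncated estimate is uniform in \<open>k\<close>, and the weight
  \<open>soft_cut'\<close> tends to 1 as \<open>k\<close> grows.\<close>

theorem energy_estimate:
  assumes w: "sobolev_approx w g \<phi>" and \<sigma>: "sq_int LU \<sigma>" "AE x in LU. lam * (norm (g x))\<^sup>2 \<le> \<sigma> x \<bullet> g x"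
    and B: "sq_int LU B" "weak_div_nonpos U B"
    and c: "AE x in LU. 0 \<le> c x" "integrable LU (\<lambda>x. (c x + \<alpha>) * w x)"
    and f: "f \<in> borel_measurable LU" "integrable LU (\<lambda>x. \<bar>f x\<bar> powr p)" "integrable LU f" and G: "sq_int LU G"
    and eq: "\<And>\<psi>. test_function U \<psi> \<Longrightarrow> (\<integral>x. \<sigma> x \<bullet> grad \<psi> x + (B x \<bullet> g x + (c x + \<alpha>) * w x) * \<psi> x \<partial>LU)
        = (\<integral>x. f x * \<psi> x + G x \<bullet> grad \<psi> x \<partial>LU)"
    and pos: "lam > 0" "\<alpha> \<ge> 0" and d: "CARD('d) \<ge> 2" and p: "lower_exponent CARD('d) p"
  shows "lam * l2 LU g \<le> N_const CARD('d) p (measure lebesgue U) * lp p f + l2 LU G"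
proof -
  let ?N = "N_const CARD('d) p (measure lebesgue U)"
  have N: "0 \<le> ?N" by (rule N_const_nonneg[OF d p])
  define Q where "Q = ?N * lp p f + l2 LU G"
  have Q: "0 \<le> Q" using N by (simp add: Q_def)
  have sw: "sq_int LU w" and sg: "sq_int LU g" using w by (auto simp: sobolev_approx_def)
  have mw[measurable]: "w \<in> borel_measurable LU" "g \<in> borel_measurable LU" using sw sg by (auto simp: sq_int_def)
  have bound: "(\<integral>x. (norm (g x))\<^sup>2 * soft_cut' k (w x) \<partial>LU) \<le> (Q / lam)\<^sup>2" if k: "k > 0" for k
  proof -
    define X where "X = sqrt (\<integral>x. (norm (g x))\<^sup>2 * soft_cut' k (w x) \<partial>LU)"
    note est = tested_estimate[OF w \<sigma> B c f(3) G eq k, folded X_def]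
    note S = sobolev_approx_soft_cut[OF w k]
    have "0 \<le> (\<integral>x. w x * soft_cut k (w x) \<partial>LU)"
      using soft_cut_mult_nonneg(1)[OF k] by (intro integral_nonneg_AE) auto
    then have "lam * X\<^sup>2 \<le> (\<integral>x. f x * soft_cut k (w x) \<partial>LU) + l2 LU G * X"
      using est(1) pos(2) by (smt (verit) mult_nonneg_nonneg)
    also have "(\<integral>x. f x * soft_cut k (w x) \<partial>LU) \<le> (\<integral>x. \<bar>f x * soft_cut k (w x)\<bar> \<partial>LU)"
      using integral_norm_bound[of LU "\<lambda>x. f x * soft_cut k (w x)"] unfolding real_norm_def by linarith
    also have "\<dots> \<le> lp p f * (?N * l2 LU (\<lambda>x. soft_cut' k (w x) *\<^sub>R g x))"
      by (rule sobolev_lp(2)[OF S d p f(1,2)])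
    also have "\<dots> \<le> lp p f * (?N * X)" using est(2) N by (intro mult_left_mono) auto
    \<comment> \<open>Both data terms are linear in X, the one with f by the Sobolev inequality for
      the truncation, so a factor X cancels.\<close>
    finally have "X * (lam * X) \<le> X * Q" by (simp add: Q_def algebra_simps power2_eq_square)
    then have "lam * X \<le> Q" using est(3) Q by (cases "X = 0") auto
    then have "X \<le> Q / lam" using pos by (simp add: pos_le_divide_eq mult.commute)
    then have "X\<^sup>2 \<le> (Q / lam)\<^sup>2" using est(3) by (rule power_mono)
    then show ?thesis using est(4) by simp
  qed
  have "(\<lambda>n. \<integral>x. (norm (g x))\<^sup>2 * soft_cut' (real (Suc n)) (w x) \<partial>LU) \<longlonglongrightarrow> (\<integral>x. (norm (g x))\<^sup>2 * 1 \<partial>LU)"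
  proof (rule integral_bounded_convergence[OF sq_int_integrable[OF sg], where K = 1])
    show "(\<lambda>x. soft_cut' (real (Suc n)) (w x)) \<in> borel_measurable LU" for n
      by (rule soft_cut_measurable(2)[OF _ mw(1)]) simp
    show "\<bar>soft_cut' (real (Suc n)) (w x)\<bar> \<le> 1" for n x
      using soft_cut'_bounds[of "real (Suc n)" "w x"] by simp
    show "AE x in LU. (\<lambda>n. soft_cut' (real (Suc n)) (w x)) \<longlonglongrightarrow> 1"
      by (intro AE_I2 soft_cut'_tendsto)
  qed simp
  then have "(\<integral>x. (norm (g x))\<^sup>2 * 1 \<partial>LU) \<le> (Q / lam)\<^sup>2"
    by (rule LIMSEQ_le_const2) (use bound in \<open>auto simp del: of_nat_Suc\<close>)
  then have "(l2 LU g)\<^sup>2 \<le> (Q / lam)\<^sup>2" by (simp add: l2_power2)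
  then have "l2 LU g \<le> Q / lam" using Q pos by (intro power2_le_imp_le[of "l2 LU g"]) auto
  then show ?thesis using pos by (simp add: pos_le_divide_eq Q_def mult.commute)
qed

end

section \<open>Energy constants\<close>

lemma norm_matrix_vector_le:
  fixes A :: "real^'d^'d"
  assumes "\<And>i j. \<bar>A $ i $ j\<bar> \<le> C"
  shows "norm (A *v v) \<le> real CARD('d) * (real CARD('d) * (C * norm v))"
proof -
  have "norm (A *v v) \<le> (\<Sum>i\<in>UNIV. \<bar>(A *v v) $ i\<bar>)" by (rule norm_le_l1_cart)
  also have "\<dots> \<le> (\<Sum>(i::'d)\<in>UNIV. real CARD('d) * (C * norm v))"
  proof (rule sum_mono)
    fix i
    have "\<bar>(A *v v) $ i\<bar> \<le> (\<Sum>j\<in>UNIV. \<bar>A $ i $ j * v $ j\<bar>)"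
      unfolding matrix_vector_mult_def by simp
    also have "\<dots> \<le> (\<Sum>(j::'d)\<in>UNIV. C * norm v)"
      using assms component_le_norm_cart[of v] order_trans[OF abs_ge_zero assms]
      by (intro sum_mono) (auto simp: abs_mult intro!: mult_mono)
    finally show "\<bar>(A *v v) $ i\<bar> \<le> real CARD('d) * (C * norm v)" by simp
  qed
  finally show ?thesis by simp
qed

context bounded_open
begin

section \<open>Bounded coefficients and terms of the weak formulation\<close>

lemma in_Linf_AE_le:
  fixes f :: "real^'d \<Rightarrow> real"
  assumes "f \<in> borel_measurable LU" "Linf_norm U f \<le> ennreal C" "0 \<le> C"
  shows "AE x in LU. \<bar>f x\<bar> \<le> C"
proof -
  have "AE x in LU. ennreal (norm (f x)) \<le> Linf_norm U f"
    unfolding Linf_norm_def by (rule esssup_AE)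
  then show ?thesis
  proof eventually_elim
    fix x assume "ennreal (norm (f x)) \<le> Linf_norm U f"
    then have "ennreal (norm (f x)) \<le> ennreal C" using assms(2) by (rule order_trans)
    then show "\<bar>f x\<bar> \<le> C" using assms(3) by (simp add: ennreal_le_iff)
  qed
qed

lemma measurable_matrix_vector:
  fixes A :: "real^'d \<Rightarrow> real^'d^'d"
  assumes A: "\<And>i j. (\<lambda>x. A x $ i $ j) \<in> borel_measurable LU" and g: "g \<in> borel_measurable LU"
  shows "(\<lambda>x. A x *v g x) \<in> borel_measurable LU"
  unfolding borel_measurable_euclidean_space[of "\<lambda>x. A x *v g x"]
proof
  fix b :: "real^'d" assume "b \<in> Basis"
  then obtain i where b: "b = axis i 1" by (auto simp: Basis_vec_def)
  have "(\<lambda>x. g x $ j) \<in> borel_measurable LU" for j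
    using g by (simp add: cart_eq_inner_axis)
  then have "(\<lambda>x. (A x *v g x) $ i) \<in> borel_measurable LU"
    unfolding matrix_vector_mult_def using A by (simp add: borel_measurable_sum)
  then show "(\<lambda>x. (A x *v g x) \<bullet> b) \<in> borel_measurable LU"
    by (simp add: b inner_axis)
qed

lemma sq_int_matrix_vector:
  fixes A :: "real^'d \<Rightarrow> real^'d^'d"
  assumes A: "\<And>i j. in_Linf U (\<lambda>x. A x $ i $ j)" and g: "sq_int LU g"
  shows "sq_int LU (\<lambda>x. A x *v g x)"
proof -
  define C where "C = (\<Sum>i\<in>UNIV. \<Sum>j\<in>UNIV. enn2real (Linf_norm U (\<lambda>x. A x $ i $ j)))"
  have meas: "(\<lambda>x. A x $ i $ j) \<in> borel_measurable LU" for i j using A by (simp add: in_Linf_def)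
  have "AE x in LU. \<bar>A x $ i $ j\<bar> \<le> C" for i j
  proof (rule in_Linf_AE_le[OF meas])
    have "Linf_norm U (\<lambda>x. A x $ i $ j) = ennreal (enn2real (Linf_norm U (\<lambda>x. A x $ i $ j)))"
      using A[of i j] by (simp add: in_Linf_def)
    also have "\<dots> \<le> ennreal C"
    proof (rule ennreal_leI)
      have "enn2real (Linf_norm U (\<lambda>x. A x $ i $ j)) \<le> (\<Sum>j\<in>UNIV. enn2real (Linf_norm U (\<lambda>x. A x $ i $ j)))"
        by (rule member_le_sum) auto
      also have "\<dots> \<le> C" unfolding C_def
        by (rule member_le_sum[of i UNIV "\<lambda>i. \<Sum>j\<in>UNIV. enn2real (Linf_norm U (\<lambda>x. A x $ i $ j))"]) (auto intro: sum_nonneg)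
      finally show "enn2real (Linf_norm U (\<lambda>x. A x $ i $ j)) \<le> C" .
    qed
    finally show "Linf_norm U (\<lambda>x. A x $ i $ j) \<le> ennreal C" .
  qed (simp add: C_def sum_nonneg)
  then have "AE x in LU. \<forall>i. \<forall>j. \<bar>A x $ i $ j\<bar> \<le> C" by (simp add: AE_all_countable)
  then have "AE x in LU. norm (A x *v g x) \<le> (real CARD('d) * (real CARD('d) * C)) * norm (g x)"
  proof eventually_elim
    fix x assume "\<forall>i. \<forall>j. \<bar>A x $ i $ j\<bar> \<le> C"
    then show "norm (A x *v g x) \<le> (real CARD('d) * (real CARD('d) * C)) * norm (g x)"
      using norm_matrix_vector_le[of "A x" C "g x"] by (simp add: mult.assoc)
  qed
  then show ?thesis
    by (rule sq_int_bound[OF g measurable_matrix_vector[OF meas sq_int_measurable[OF g]]])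
qed

lemma elliptic_AE:
  assumes "elliptic lam U A" shows "AE x in LU. lam * (norm (g x))\<^sup>2 \<le> (A x *v g x) \<bullet> g x"
  using assms by (intro AE_I2) (auto simp: elliptic_def)

lemma weak_solution_D:
  assumes "weak_solution U A B c \<alpha> f F u"
  shows "u \<in> H12_0 U"
    and "test_function U \<psi> \<Longrightarrow> integrable LU (\<lambda>x. (A x *v weak_grad U u x) \<bullet> grad \<psi> x
                       + (B x \<bullet> weak_grad U u x + (c x + \<alpha>) * u x) * \<psi> x)"
    and "test_function U \<psi> \<Longrightarrow> integrable LU (\<lambda>x. f x * \<psi> x + F x \<bullet> grad \<psi> x)"
    and "test_function U \<psi> \<Longrightarrow> (\<integral>x. (A x *v weak_grad U u x) \<bullet> grad \<psi> x
                       + (B x \<bullet> weak_grad U u x + (c x + \<alpha>) * u x) * \<psi> x \<partial>LU)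
       = (\<integral>x. f x * \<psi> x + F x \<bullet> grad \<psi> x \<partial>LU)"
  using assms unfolding weak_solution_def Let_def by blast+

lemma integrable_zero_order_term:
  assumes w: "sobolev_approx w g \<phi>" and d: "CARD('d) \<ge> 2" and p: "lower_exponent CARD('d) p" and c: "in_Lp p U c"
  shows "integrable LU (\<lambda>x. (c x + \<alpha>) * w x)"
proof -
  have c': "c \<in> borel_measurable LU" "integrable LU (\<lambda>x. \<bar>c x\<bar> powr p)"
    using c lower_exponent_gt_1(1)[OF p d] by (auto simp: Lp_norm_eq_lp)
  have "integrable LU w" using w by (intro sq_int_imp_integrable) (auto simp: sobolev_approx_def)
  then have "integrable LU (\<lambda>x. c x * w x + \<alpha> * w x)"
    using sobolev_lp(1)[OF w d p c'] by simp
  then show ?thesis by (simp add: distrib_right)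
qed

lemma in_Lp_imp_integrable:
  fixes f :: "real^'d \<Rightarrow> real"
  assumes p: "1 < p" and f: "in_Lp p U f" shows "integrable LU f"
proof -
  have f': "f \<in> borel_measurable LU" "integrable LU (\<lambda>x. \<bar>f x\<bar> powr p)"
    using f p by (auto simp: Lp_norm_eq_lp)
  have "integrable LU (\<lambda>x. f x * 1)"
    by (rule Holder_lp(1)[OF p f']) (auto intro: finite_measure.integrable_const[OF finite_LU])
  then show ?thesis by simp
qed

lemma in_Lp_diff:
  fixes f h :: "real^'d \<Rightarrow> real"
  assumes p: "1 \<le> p" and f: "in_Lp p U f" and h: "in_Lp p U h"
  shows "in_Lp p U (\<lambda>x. f x - h x)"
proof -
  have f': "f \<in> borel_measurable LU" "integrable LU (\<lambda>x. \<bar>f x\<bar> powr p)"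
    and h': "h \<in> borel_measurable LU" "integrable LU (\<lambda>x. \<bar>h x\<bar> powr p)"
    using f h p by (auto simp: Lp_norm_eq_lp)
  have "integrable LU (\<lambda>x. 2 powr p * (\<bar>f x\<bar> powr p + \<bar>h x\<bar> powr p))"
    using f'(2) h'(2) by simp
  then have "integrable LU (\<lambda>x. \<bar>f x - h x\<bar> powr p)"
  proof (rule Bochner_Integration.integrable_bound)
    show "AE x in LU. norm (\<bar>f x - h x\<bar> powr p) \<le> norm (2 powr p * (\<bar>f x\<bar> powr p + \<bar>h x\<bar> powr p))"
    proof (intro AE_I2)
      fix x
      have "\<bar>f x - h x\<bar> powr p \<le> (2 * max \<bar>f x\<bar> \<bar>h x\<bar>) powr p" using p by (intro powr_mono2) auto
      also have "\<dots> = 2 powr p * max \<bar>f x\<bar> \<bar>h x\<bar> powr p" by (simp add: powr_mult)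
      also have "\<dots> \<le> 2 powr p * (\<bar>f x\<bar> powr p + \<bar>h x\<bar> powr p)" by (intro mult_left_mono) (auto simp: max_def)
      finally show "norm (\<bar>f x - h x\<bar> powr p) \<le> norm (2 powr p * (\<bar>f x\<bar> powr p + \<bar>h x\<bar> powr p))" by simp
    qed
  qed (use f'(1) h'(1) in measurable)
  then show ?thesis using p f'(1) h'(1) by (simp add: Lp_norm_eq_lp)
qed

text \<open>A Poincare inequality whose constant sees \<open>U\<close> only through its measure: L^q
  embeds into L^2 by Hoelder's inequality against 1, with weights 2 / q and 1 - 2 / q.\<close>

lemma l2_le_sobolev:
  assumes w: "sobolev_approx w g \<phi>" and d: "CARD('d) \<ge> 2" and p: "lower_exponent CARD('d) p"
  defines "q \<equiv> p / (p - 1)"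
  shows "l2 LU w \<le> N_const CARD('d) p (measure lebesgue U) * measure lebesgue U powr (1 / 2 - 1 / q) * l2 LU g"
proof -
  let ?N = "N_const CARD('d) p (measure lebesgue U)" and ?v = "measure lebesgue U"
  have q: "q > 2" using lower_exponent_gt_1[OF p d] by (simp add: q_def)
  note sob = sobolev_inequality[OF w d p, folded q_def]
  let ?J = "\<integral>x. \<bar>w x\<bar> powr q \<partial>LU"
  have J: "0 \<le> ?J" by (rule integral_nonneg_AE) auto
  have "(\<integral>x. (\<bar>w x\<bar> powr q) powr (2 / q) * 1 powr (1 - 2 / q) \<partial>LU) \<le> ?J powr (2 / q) * (\<integral>x. 1 \<partial>LU) powr (1 - 2 / q)"
    using q sob(1) finite_measure.integrable_const[OF finite_LU] by (intro Holder_integral) auto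
  moreover have "(\<bar>w x\<bar> powr q) powr (2 / q) * 1 powr (1 - 2 / q) = (norm (w x))\<^sup>2" for x
    using q by (simp add: powr_powr)
  ultimately have "(l2 LU w)\<^sup>2 \<le> ?J powr (2 / q) * ?v powr (1 - 2 / q)"
    by (simp add: l2_power2 measure_LU)
  also have "\<dots> = (?J powr (1 / q) * ?v powr (1 / 2 - 1 / q))\<^sup>2"
  proof -
    have "(?J powr (1 / q))\<^sup>2 = ?J powr (2 / q)" by (simp add: power2_eq_square flip: powr_add)
    moreover have "(?v powr (1 / 2 - 1 / q))\<^sup>2 = ?v powr (1 - 2 / q)" by (simp add: power2_eq_square flip: powr_add)
    ultimately show ?thesis by (simp add: power_mult_distrib)
  qed
  finally have "l2 LU w \<le> ?J powr (1 / q) * ?v powr (1 / 2 - 1 / q)"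
    by (rule power2_le_imp_le) simp
  also have "\<dots> \<le> (?N * l2 LU g) * ?v powr (1 / 2 - 1 / q)"
    using sob(2) by (rule mult_right_mono) simp
  finally show ?thesis by (simp add: mult_ac)
qed

lemma H12_norm_H12_0:
  assumes "u \<in> H12_0 U"
  shows "H12_norm U u = ennreal (sqrt ((l2 LU u)\<^sup>2 + (l2 LU (weak_grad U u))\<^sup>2))"
proof -
  have u: "sq_int LU u" "sq_int LU (weak_grad U u)" and wg: "has_weak_gradient U u (weak_grad U u)"
    using assms has_weak_gradient_weak_grad by (auto simp: H12_0_def H12_def in_Lp_2_iff)
  show ?thesis by (rule H12_norm_eq(1)[OF wg u])
qed

text \<open>The gradient is bounded by the energy estimate and the function by the Poincare factor
  \<open>E\<close> times the gradient. The constant is crude: only its dependence on p,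
  \<open>lam\<close>, the dimension and the measure matters.\<close>

lemma energy_bound:
  assumes p: "lower_exponent CARD('d) p" and A: "assumption_A p lam U A B c \<alpha>"
    and f: "in_Lp p U f" and F: "in_Lp 2 U F" and u: "weak_solution U A B c \<alpha> f F u"
  defines "N \<equiv> N_const CARD('d) p (measure lebesgue U)"
  defines "E \<equiv> N * measure lebesgue U powr (1 / 2 - 1 / (p / (p - 1)))"
  shows "H12_norm U u \<le> ennreal ((E + 1) * (N + 1) / lam) * (Lp_norm p U f + Lp_norm 2 U F)"
proof -
  let ?g = "weak_grad U u"
  have d: "CARD('d) \<ge> 2" and lam: "lam > 0" and el: "elliptic lam U A" and Ai: "\<And>i j. in_Linf U (\<lambda>x. A x $ i $ j)"
    and B: "sq_int LU B" "weak_div_nonpos U B" and \<alpha>: "\<alpha> \<ge> 0" and c: "in_Lp p U c" "AE x in LU. 0 \<le> c x"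
    using A by (auto simp: assumption_A_def in_Lp_2_iff)
  note p1 = lower_exponent_gt_1(1)[OF p d]
  note uD = weak_solution_D[OF u]
  obtain \<phi> where w: "sobolev_approx u ?g \<phi>" using H12_0_sobolev_approx[OF uD(1)] .
  have N: "0 \<le> N" unfolding N_def by (rule N_const_nonneg[OF d p])
  have E: "0 \<le> E" using N by (simp add: E_def)
  have f': "f \<in> borel_measurable LU" "integrable LU (\<lambda>x. \<bar>f x\<bar> powr p)"
    using f p1 by (auto simp: Lp_norm_eq_lp)
  have F': "sq_int LU F" using F by (simp add: in_Lp_2_iff)
  have g: "sq_int LU ?g" using w by (simp add: sobolev_approx_def)
  have "lam * l2 LU ?g \<le> N * lp p f + l2 LU F"
    unfolding N_def
    by (rule energy_estimate[OF w sq_int_matrix_vector[OF Ai g] elliptic_AE[OF el] B c(2)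
          integrable_zero_order_term[OF w d p c(1)] f' in_Lp_imp_integrable[OF p1 f] F' uD(4) lam \<alpha> d p])
  also have "\<dots> \<le> (N + 1) * (lp p f + l2 LU F)" using N by (simp add: algebra_simps)
  finally have lg: "l2 LU ?g \<le> (N + 1) * (lp p f + l2 LU F) / lam"
    using lam by (simp add: pos_le_divide_eq mult.commute)
  have "sqrt ((l2 LU u)\<^sup>2 + (l2 LU ?g)\<^sup>2) \<le> l2 LU u + l2 LU ?g"
    by (rule sqrt_sum_squares_le_sum) auto
  also have "l2 LU u \<le> E * l2 LU ?g" using l2_le_sobolev[OF w d p] by (simp add: E_def N_def)
  also have "E * l2 LU ?g + l2 LU ?g = (E + 1) * l2 LU ?g" by (simp add: algebra_simps)
  also have "\<dots> \<le> (E + 1) * ((N + 1) * (lp p f + l2 LU F) / lam)"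
    using E by (intro mult_left_mono lg) auto
  finally have "H12_norm U u \<le> ennreal ((E + 1) * (N + 1) / lam * (lp p f + l2 LU F))"
    unfolding H12_norm_H12_0[OF uD(1)] by (intro ennreal_leI) (simp add: mult_ac)
  also have "\<dots> = ennreal ((E + 1) * (N + 1) / lam) * ennreal (lp p f + l2 LU F)"
    using E N lam by (intro ennreal_mult) auto
  also have "ennreal (lp p f + l2 LU F) = Lp_norm p U f + Lp_norm 2 U F"
    using f p1 F' by (simp add: Lp_norm_eq_lp(2) Lp_norm_2(2) sq_int_measurable)
  finally show ?thesis .
qed

end

text \<open>\<open>E\<close> and \<open>N\<close> depend on the set only through its measure, so the
  constant computed for \<open>U\<close> serves every admissible \<open>V\<close> of the same
  measure.\<close>

lemma energy_constant_exists:
  fixes U :: "(real^'d::finite) set"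
  assumes p: "lower_exponent CARD('d) p" and lam: "lam > 0" and d: "CARD('d) \<ge> 2"
  shows "\<exists>C1. energy_constant p lam U C1"
proof -
  define N where "N = N_const CARD('d) p (measure lebesgue U)"
  define E where "E = N * measure lebesgue U powr (1 / 2 - 1 / (p / (p - 1)))"
  have "energy_constant p lam U ((E + 1) * (N + 1) / lam)"
    unfolding energy_constant_def
  proof (intro conjI allI impI)
    have "0 \<le> N" using lower_exponent_gt_1[OF p d] d by (auto simp: N_def N_const_def Let_def)
    then show "0 < (E + 1) * (N + 1) / lam" using lam by (simp add: E_def add_nonneg_pos)
  next
    fix V :: "(real^'d) set" and A B c \<alpha> f F u
    assume *: "measure lebesgue V = measure lebesgue U \<and> assumption_A p lam V A B c \<alpha> \<and>
        in_Lp p V f \<and> in_Lp 2 V F \<and> weak_solution V A B c \<alpha> f F u"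
    interpret bounded_open V using * by unfold_locales (auto simp: assumption_A_def)
    show "H12_norm V u \<le> ennreal ((E + 1) * (N + 1) / lam) * (Lp_norm p V f + Lp_norm 2 V F)"
      using energy_bound[OF p, of lam A B c \<alpha> f F u] * by (simp add: E_def N_def)
  qed
  then show ?thesis by blast
qed

context bounded_open
begin

text \<open>Every test function \<open>\<psi>\<close> is the solution for \<open>A = lam I\<close>, \<open>F = lam \<nabla>\<psi>\<close> and vanishing \<open>B, c, \<alpha>, f\<close>.\<close>

lemma energy_constant_poincare:
  assumes C1: "energy_constant p lam U C1" and p: "lower_exponent CARD('d) p" and lam: "lam > 0" and d: "CARD('d) \<ge> 2"
    and \<psi>: "test_function U \<psi>"
  shows "l2 LU \<psi> \<le> C1 * lam * l2 LU (grad \<psi>)"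
proof -
  let ?A = "\<lambda>x::real^'d. mat lam :: real^'d^'d"
  note p1 = lower_exponent_gt_1(1)[OF p d]
  have C10: "C1 > 0" using C1 by (simp add: energy_constant_def)
  have mat: "(mat lam :: real^'d^'d) *v v = lam *\<^sub>R v" for v
    by (simp add: vec_eq_iff matrix_vector_mult_def mat_def if_distrib[of "\<lambda>a. a * _"] cong: if_cong)
  have entries: "\<bar>(mat lam :: real^'d^'d) $ i $ j\<bar> \<le> lam" for i j using lam by (simp add: mat_def)
  have F: "sq_int LU (\<lambda>x. lam *\<^sub>R grad \<psi> x)" by (rule sq_int_scaleR[OF test_sq_int(2)[OF \<psi>]])
  have zero: "in_Lp p U (\<lambda>x. 0 :: real)" "Lp_norm p U (\<lambda>x. 0 :: real) = 0"
    using p1 by (auto simp: Lp_norm_eq_lp Lp_norm_eq_lp(2) lp_def Lp_norm_def)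
  have "assumption_A p lam U ?A (\<lambda>x. 0) (\<lambda>x. 0) 0"
    unfolding assumption_A_def
  proof (intro conjI allI)
    show "elliptic lam U ?A" by (simp add: elliptic_def mat power2_norm_eq_inner)
    show "in_Linf U (\<lambda>x. ?A x $ i $ j)" for i j
    proof -
      have "Linf_norm U (\<lambda>x. ?A x $ i $ j) \<le> ennreal lam"
        unfolding Linf_norm_def using entries by (intro esssup_I) (auto intro!: ennreal_leI)
      then show ?thesis by (auto simp: in_Linf_def intro: le_less_trans)
    qed
    show "\<exists>Lam>0. \<forall>x\<in>U. \<forall>i j. \<bar>?A x $ i $ j\<bar> \<le> Lam" using lam entries by blast
    show "in_Lp 2 U (\<lambda>x. 0 :: real^'d)" by (simp add: in_Lp_2_iff sq_int_def)
    show "weak_div_nonpos U (\<lambda>x. 0)" by (simp add: weak_div_nonpos_def)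
  qed (use d open_U bounded_U lam zero in auto)
  moreover have "weak_solution U ?A (\<lambda>x. 0) (\<lambda>x. 0) 0 (\<lambda>x. 0) (\<lambda>x. lam *\<^sub>R grad \<psi> x) \<psi>"
    unfolding weak_solution_def Let_def
  proof (intro conjI allI impI test_H12_0(1)[OF \<psi>])
    fix \<phi> assume \<phi>: "test_function U \<phi>"
    have wg: "sq_int LU (weak_grad U \<psi>)"
      by (rule H12_norm_eq(3)[OF test_has_weak_gradient[OF \<psi>] test_sq_int[OF \<psi>]])
    show 1: "integrable LU (\<lambda>x. (?A x *v weak_grad U \<psi> x) \<bullet> grad \<phi> x + (0 \<bullet> weak_grad U \<psi> x + (0 + 0) * \<psi> x) * \<phi> x)"
      using Cauchy_Schwarz_l2(1)[OF wg test_sq_int(2)[OF \<phi>]] by (simp add: mat)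
    show 2: "integrable LU (\<lambda>x. 0 * \<phi> x + (lam *\<^sub>R grad \<psi> x) \<bullet> grad \<phi> x)"
      using Cauchy_Schwarz_l2(1)[OF F test_sq_int(2)[OF \<phi>]] by simp
    show "(\<integral>x. (?A x *v weak_grad U \<psi> x) \<bullet> grad \<phi> x + (0 \<bullet> weak_grad U \<psi> x + (0 + 0) * \<psi> x) * \<phi> x \<partial>LU)
        = (\<integral>x. 0 * \<phi> x + (lam *\<^sub>R grad \<psi> x) \<bullet> grad \<phi> x \<partial>LU)"
    proof (rule integral_cong_AE[OF borel_measurable_integrable[OF 1] borel_measurable_integrable[OF 2]])
      show "AE x in LU. (?A x *v weak_grad U \<psi> x) \<bullet> grad \<phi> x + (0 \<bullet> weak_grad U \<psi> x + (0 + 0) * \<psi> x) * \<phi> x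
          = 0 * \<phi> x + (lam *\<^sub>R grad \<psi> x) \<bullet> grad \<phi> x"
        using test_H12_0(2)[OF \<psi>] by eventually_elim (simp add: mat)
    qed
  qed
  ultimately have "H12_norm U \<psi> \<le> ennreal C1 * (Lp_norm p U (\<lambda>x. 0 :: real) + Lp_norm 2 U (\<lambda>x. lam *\<^sub>R grad \<psi> x))"
    using conjunct2[OF C1[unfolded energy_constant_def], rule_format,
        of U ?A "\<lambda>x. 0" "\<lambda>x. 0" 0 "\<lambda>x. 0" "\<lambda>x. lam *\<^sub>R grad \<psi> x" \<psi>] zero F
    by (simp add: in_Lp_2_iff)
  also have "\<dots> = ennreal (C1 * lam * l2 LU (grad \<psi>))"
    using F lam C10 zero by (simp add: Lp_norm_2(2) sq_int_measurable l2_scaleR mult.assoc flip: ennreal_mult)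
  finally have "sqrt ((l2 LU \<psi>)\<^sup>2 + (l2 LU (grad \<psi>))\<^sup>2) \<le> C1 * lam * l2 LU (grad \<psi>)"
    using C10 lam by (simp add: test_H12_0(3)[OF \<psi>] ennreal_le_iff)
  moreover have "l2 LU \<psi> \<le> sqrt ((l2 LU \<psi>)\<^sup>2 + (l2 LU (grad \<psi>))\<^sup>2)" by (rule real_le_rsqrt) simp
  ultimately show ?thesis by linarith
qed

lemma sobolev_approx_diff:
  assumes v: "sobolev_approx v gv \<phi>" and u: "sobolev_approx u gu \<psi>"
  obtains \<eta> where "sobolev_approx (\<lambda>x. v x - u x) (\<lambda>x. gv x - gu x) \<eta>"
proof -
  have t: "test_function U (\<phi> j)" "test_function U (\<psi> j)" for j using u v by (auto simp: sobolev_approx_def)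
  have s: "sq_int LU v" "sq_int LU gv" "sq_int LU u" "sq_int LU gu" using u v by (auto simp: sobolev_approx_def)
  have lim: "(\<lambda>j. l2 LU (\<lambda>x. (a x - b x) - (a' j x - b' j x))) \<longlonglongrightarrow> 0"
    if "sq_int LU a" "sq_int LU b" "\<And>j. sq_int LU (a' j)" "\<And>j. sq_int LU (b' j)"
      "(\<lambda>j. l2 LU (\<lambda>x. a x - a' j x)) \<longlonglongrightarrow> 0" "(\<lambda>j. l2 LU (\<lambda>x. b x - b' j x)) \<longlonglongrightarrow> 0"
    for a b :: "real^'d \<Rightarrow> 'e::euclidean_space" and a' b'
  proof (rule tendsto_sandwich[OF _ _ tendsto_const])
    show "(\<lambda>j. l2 LU (\<lambda>x. a x - a' j x) + l2 LU (\<lambda>x. b x - b' j x)) \<longlonglongrightarrow> 0"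
      using tendsto_add[OF that(5,6)] by simp
    have "l2 LU (\<lambda>x. (a x - b x) - (a' j x - b' j x)) \<le> l2 LU (\<lambda>x. a x - a' j x) + l2 LU (\<lambda>x. b x - b' j x)" for j
    proof -
      have eq: "(a x - b x) - (a' j x - b' j x) = (a x - a' j x) + - (b x - b' j x)" for x by simp
      have "l2 LU (\<lambda>x. (a x - a' j x) + - (b x - b' j x)) \<le> l2 LU (\<lambda>x. a x - a' j x) + l2 LU (\<lambda>x. - (b x - b' j x))"
        by (intro l2_triangle sq_int_minus sq_int_diff that)
      also have "l2 LU (\<lambda>x. - (b x - b' j x)) = l2 LU (\<lambda>x. b x - b' j x)"
        by (simp add: l2_def norm_minus_commute)
      finally show ?thesis unfolding eq .
    qed
    then show "\<forall>\<^sub>F j in sequentially. l2 LU (\<lambda>x. (a x - b x) - (a' j x - b' j x))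
        \<le> l2 LU (\<lambda>x. a x - a' j x) + l2 LU (\<lambda>x. b x - b' j x)" by (intro always_eventually allI)
  qed simp
  have 1: "(\<lambda>j. l2 LU (\<lambda>x. (v x - u x) - (\<phi> j x - \<psi> j x))) \<longlonglongrightarrow> 0"
    by (rule lim) (use u v s t in \<open>auto simp: sobolev_approx_def test_sq_int\<close>)
  have "(\<lambda>j. l2 LU (\<lambda>x. (gv x - gu x) - (grad (\<phi> j) x - grad (\<psi> j) x))) \<longlonglongrightarrow> 0"
    by (rule lim) (use u v s t in \<open>auto simp: sobolev_approx_def test_sq_int\<close>)
  then have 2: "(\<lambda>j. l2 LU (\<lambda>x. (gv x - gu x) - grad (\<lambda>x. \<phi> j x - \<psi> j x) x)) \<longlonglongrightarrow> 0"
    by (simp add: test_function_diff(2)[OF t])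
  obtain r where "sobolev_approx (\<lambda>x. v x - u x) (\<lambda>x. gv x - gu x) (\<lambda>j x. \<phi> (r j) x - \<psi> (r j) x)"
    using sobolev_approx_subseq[OF test_function_diff(1)[OF t] sq_int_diff[OF s(1,3)] sq_int_diff[OF s(2,4)] 1 2] by blast
  then show thesis by (rule that)
qed

end

section \<open>The difference of two solutions\<close>

context bounded_open
begin

lemma Lp_norm_1:
  fixes f :: "real^'d \<Rightarrow> real"
  shows "in_Lp 1 U f \<longleftrightarrow> integrable LU f" "integrable LU f \<Longrightarrow> Lp_norm 1 U f = ennreal (\<integral>x. \<bar>f x\<bar> \<partial>LU)"
proof -
  have "0 \<le> (\<integral>x. \<bar>f x\<bar> \<partial>LU)" by (rule integral_nonneg_AE) auto
  then have lp1: "lp 1 f = (\<integral>x. \<bar>f x\<bar> \<partial>LU)" by (simp add: lp_def)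
  show 1: "in_Lp 1 U f \<longleftrightarrow> integrable LU f"
    by (auto simp: Lp_norm_eq_lp integrable_abs_iff)
  show "integrable LU f \<Longrightarrow> Lp_norm 1 U f = ennreal (\<integral>x. \<bar>f x\<bar> \<partial>LU)"
    using Lp_norm_eq_lp(2)[of 1 f] 1 lp1 by simp
qed

text \<open>The norm of the gradient of \<open>u\<close> stands where the claim has C_4: it is
  finite for every datum, and the claim follows by the energy estimate. Ellipticity and the sign
  conditions are placed on the primed coefficients, since those govern the equation of the
  difference.\<close>

lemma L1_difference_estimate:
  assumes p: "lower_exponent CARD('d) p" and d: "CARD('d) \<ge> 2" and lam: "lam > 0" and \<alpha>: "\<alpha> > 0"
    and C1: "energy_constant p lam U C1"
    and A: "\<And>i j. in_Linf U (\<lambda>x. A x $ i $ j)" and B: "in_Lp 2 U B" and c: "in_Lp p U c"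
    and f: "in_Lp 1 U f" and F: "in_Lp 2 U F" and u: "weak_solution U A B c \<alpha> f F u"
    and A': "\<And>i j. in_Linf U (\<lambda>x. A' x $ i $ j)" "elliptic lam U A'"
    and B': "in_Lp 2 U B'" "weak_div_nonpos U B'" and c': "in_Lp p U c'" "AE x in LU. 0 \<le> c' x"
    and f': "in_Lp 1 U f'" and F': "in_Lp 2 U F'" and u': "weak_solution U A' B' c' \<alpha> f' F' u'"
  shows "Lp_norm 1 U (\<lambda>x. u' x - u x)
      \<le> ennreal (1 / \<alpha>) * Lp_norm 2 U (weak_grad U u) * (Lp_norm 2 U (\<lambda>x. B x - B' x)
          + ennreal (N_const CARD('d) p (measure lebesgue U)) * Lp_norm p U (\<lambda>x. c x - c' x))
        + ennreal (measure lebesgue U powr (1/2) * C1) * Lp_norm 2 U (\<lambda>x. (A' x - A x) *v weak_grad U u x)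
        + ennreal (1 / \<alpha>) * Lp_norm 1 U (\<lambda>x. f x - f' x)
        + ennreal (measure lebesgue U powr (1/2) * C1) * Lp_norm 2 U (\<lambda>x. F x - F' x)"
proof -
  let ?g = "weak_grad U u" and ?g' = "weak_grad U u'"
  let ?N = "N_const CARD('d) p (measure lebesgue U)" and ?m = "sqrt (measure lebesgue U)"
  define w gw where "w x = u' x - u x" and "gw x = ?g' x - ?g x" for x
  note p1 = lower_exponent_gt_1(1)[OF p d]
  have C10: "C1 > 0" using C1 by (simp add: energy_constant_def)
  have N: "0 \<le> ?N" by (rule N_const_nonneg[OF d p])
  obtain \<phi> where \<phi>: "sobolev_approx u ?g \<phi>" using H12_0_sobolev_approx[OF weak_solution_D(1)[OF u]] .
  obtain \<phi>' where \<phi>': "sobolev_approx u' ?g' \<phi>'" using H12_0_sobolev_approx[OF weak_solution_D(1)[OF u']] .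
  obtain \<eta> where \<eta>: "sobolev_approx w gw \<eta>"
    using sobolev_approx_diff[OF \<phi>' \<phi>] unfolding w_def gw_def .
  have sg: "sq_int LU ?g" "sq_int LU gw" and su: "sq_int LU u" "sq_int LU w"
    using \<phi> \<eta> by (auto simp: sobolev_approx_def)
  have iF: "sq_int LU (\<lambda>x. F x - F' x)" and iB: "sq_int LU (\<lambda>x. B x - B' x)"
    and iB': "sq_int LU B'"
    using F F' B B' by (auto simp: in_Lp_2_iff intro: sq_int_diff)
  have icp: "in_Lp p U (\<lambda>x. c x - c' x)" using p1 by (intro in_Lp_diff c c') simp
  then have ic: "(\<lambda>x. c x - c' x) \<in> borel_measurable LU" "integrable LU (\<lambda>x. \<bar>c x - c' x\<bar> powr p)"
    using p1 by (auto simp: Lp_norm_eq_lp)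
  have iff: "integrable LU (\<lambda>x. f x - f' x)" using f f' by (auto simp: Lp_norm_1)
  define H where "H x = (A' x - A x) *v ?g x" for x
  have Heq: "H = (\<lambda>x. A' x *v ?g x - A x *v ?g x)"
    by (simp add: H_def fun_eq_iff matrix_vector_mult_diff_rdistrib)
  have iH: "sq_int LU H"
    unfolding Heq by (intro sq_int_diff sq_int_matrix_vector A A'(1) sg)
  \<comment> \<open>Replacing the coefficients in the equation of \<open>u\<close> by the primed
    ones leaves these defects as data. They involve only \<open>u\<close>, so only its gradient
    enters the estimate.\<close>
  define r where "r x = (B x - B' x) \<bullet> ?g x + (c x - c' x) * u x - (f x - f' x)" for x
  define G where "G x = - (F x - F' x) - H x" for x
  have rB: "integrable LU (\<lambda>x. (B x - B' x) \<bullet> ?g x)" by (rule Cauchy_Schwarz_l2(1)[OF iB sg(1)])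
  note rc = sobolev_lp[OF \<phi> d p ic]
  have ir: "integrable LU r" unfolding r_def using rB rc(1) iff by simp
  have iG: "sq_int LU G" unfolding G_def by (intro sq_int_diff sq_int_minus iF iH)
  have eq: "(\<integral>x. (A' x *v gw x) \<bullet> grad \<psi> x + (B' x \<bullet> gw x + (c' x + \<alpha>) * w x) * \<psi> x \<partial>LU)
      = (\<integral>x. r x * \<psi> x + G x \<bullet> grad \<psi> x \<partial>LU)" if \<psi>: "test_function U \<psi>" for \<psi>
  proof -
    obtain K where K: "\<And>x. \<bar>\<psi> x\<bar> \<le> K" using test_function_bounded[OF \<psi>] by metis
    \<comment> \<open>The primed integrand minus the unprimed one, both evaluated at
      \<open>u\<close>. With it both sides of the difference equation are combinations of integrands
      already known to be integrable.\<close>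
    define D where "D x = H x \<bullet> grad \<psi> x - ((B x - B' x) \<bullet> ?g x + (c x - c' x) * u x) * \<psi> x" for x
    have iD: "integrable LU D"
      unfolding D_def
      by (intro Bochner_Integration.integrable_diff Cauchy_Schwarz_l2(1)[OF iH test_sq_int(2)[OF \<psi>]]
          integrable_times_bounded[OF _ test_measurable(1)[OF \<psi>] K] Bochner_Integration.integrable_add rB rc(1))
    note U = weak_solution_D(2-4)[OF u \<psi>] and U' = weak_solution_D(2-4)[OF u' \<psi>]
    have L: "(A' x *v gw x) \<bullet> grad \<psi> x + (B' x \<bullet> gw x + (c' x + \<alpha>) * w x) * \<psi> x
       = (A' x *v ?g' x) \<bullet> grad \<psi> x + (B' x \<bullet> ?g' x + (c' x + \<alpha>) * u' x) * \<psi> x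
         - ((A x *v ?g x) \<bullet> grad \<psi> x + (B x \<bullet> ?g x + (c x + \<alpha>) * u x) * \<psi> x) - D x" for x
      by (simp add: D_def Heq gw_def w_def matrix_vector_mult_diff_distrib inner_diff_left inner_diff_right algebra_simps)
    have R: "r x * \<psi> x + G x \<bullet> grad \<psi> x
       = f' x * \<psi> x + F' x \<bullet> grad \<psi> x - (f x * \<psi> x + F x \<bullet> grad \<psi> x) - D x" for x
      by (simp add: D_def r_def G_def inner_diff_left algebra_simps)
    show ?thesis
      unfolding L R using U U' iD by simp
  qed
  \<comment> \<open>The energy constant is used on \<open>U\<close> only through this Poincare
    constant; dividing by \<open>lam\<close> gives back C_1, whence C_3.\<close>
  have pos: "0 < C1 * lam" using C10 lam by simp
  have P: "\<And>\<psi>. test_function U \<psi> \<Longrightarrow> l2 LU \<psi> \<le> (C1 * lam) * l2 LU (grad \<psi>)"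
    by (rule energy_constant_poincare[OF C1 p lam d])
  have "\<alpha> * (\<integral>x. \<bar>w x\<bar> \<partial>LU) \<le> (\<integral>x. \<bar>r x\<bar> \<partial>LU) + \<alpha> * ?m * (C1 * lam / lam) * l2 LU G"
    by (rule L1_estimate[OF \<eta> sq_int_matrix_vector[OF A'(1) sg(2)] elliptic_AE[OF A'(2)] iB' B'(2) c'(2)
          integrable_zero_order_term[OF \<eta> d p c'(1)] ir iG eq lam \<alpha> pos P])
  also have "C1 * lam / lam = C1" using lam by simp
  also have "l2 LU G \<le> l2 LU (\<lambda>x. F x - F' x) + l2 LU H"
  proof -
    have "l2 LU G = l2 LU (\<lambda>x. (F x - F' x) + H x)"
      unfolding l2_def G_def by (simp add: norm_minus_commute add.commute flip: norm_minus_cancel[of "_ + _"])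
    then show ?thesis using l2_triangle[OF iF iH] by simp
  qed
  also have "(\<integral>x. \<bar>r x\<bar> \<partial>LU) \<le> l2 LU (\<lambda>x. B x - B' x) * l2 LU ?g + lp p (\<lambda>x. c x - c' x) * (?N * l2 LU ?g)
      + (\<integral>x. \<bar>f x - f' x\<bar> \<partial>LU)"
  proof -
    have "(\<integral>x. \<bar>r x\<bar> \<partial>LU) \<le> (\<integral>x. \<bar>(B x - B' x) \<bullet> ?g x\<bar> + \<bar>(c x - c' x) * u x\<bar> + \<bar>f x - f' x\<bar> \<partial>LU)"
      using ir rB rc(1) iff by (intro integral_mono_AE) (auto simp: r_def)
    also have "\<dots> = (\<integral>x. \<bar>(B x - B' x) \<bullet> ?g x\<bar> \<partial>LU) + (\<integral>x. \<bar>(c x - c' x) * u x\<bar> \<partial>LU) + (\<integral>x. \<bar>f x - f' x\<bar> \<partial>LU)"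
      using rB rc(1) iff by simp
    also have "(\<integral>x. \<bar>(B x - B' x) \<bullet> ?g x\<bar> \<partial>LU) \<le> (\<integral>x. norm (B x - B' x) * norm (?g x) \<partial>LU)"
      using rB Cauchy_Schwarz_l2_norm(1)[OF iB sg(1)] by (intro integral_mono_AE) (auto simp: Cauchy_Schwarz_ineq2)
    also have "\<dots> \<le> l2 LU (\<lambda>x. B x - B' x) * l2 LU ?g" by (rule Cauchy_Schwarz_l2_norm(2)[OF iB sg(1)])
    finally show ?thesis using rc(2) by linarith
  qed
  finally have "\<alpha> * (\<integral>x. \<bar>w x\<bar> \<partial>LU) \<le> l2 LU (\<lambda>x. B x - B' x) * l2 LU ?g + lp p (\<lambda>x. c x - c' x) * (?N * l2 LU ?g)
      + (\<integral>x. \<bar>f x - f' x\<bar> \<partial>LU) + \<alpha> * ?m * C1 * (l2 LU (\<lambda>x. F x - F' x) + l2 LU H)"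
    using \<alpha> C10 by (simp add: mult_left_mono)
  then have "(\<integral>x. \<bar>w x\<bar> \<partial>LU) \<le> (l2 LU (\<lambda>x. B x - B' x) * l2 LU ?g + lp p (\<lambda>x. c x - c' x) * (?N * l2 LU ?g)
      + (\<integral>x. \<bar>f x - f' x\<bar> \<partial>LU) + \<alpha> * ?m * C1 * (l2 LU (\<lambda>x. F x - F' x) + l2 LU H)) / \<alpha>"
    using \<alpha> by (simp add: pos_le_divide_eq mult.commute)
  also have "\<dots> = 1 / \<alpha> * l2 LU ?g * (l2 LU (\<lambda>x. B x - B' x) + ?N * lp p (\<lambda>x. c x - c' x))
        + (?m * C1) * l2 LU H + 1 / \<alpha> * (\<integral>x. \<bar>f x - f' x\<bar> \<partial>LU) + (?m * C1) * l2 LU (\<lambda>x. F x - F' x)"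
    using \<alpha> by (simp add: field_simps)
  finally have main: "ennreal (\<integral>x. \<bar>w x\<bar> \<partial>LU) \<le> ennreal (1 / \<alpha> * l2 LU ?g * (l2 LU (\<lambda>x. B x - B' x) + ?N * lp p (\<lambda>x. c x - c' x))
        + (?m * C1) * l2 LU H + 1 / \<alpha> * (\<integral>x. \<bar>f x - f' x\<bar> \<partial>LU) + (?m * C1) * l2 LU (\<lambda>x. F x - F' x))"
    by (rule ennreal_leI)
  have nn: "0 \<le> (\<integral>x. \<bar>f x - f' x\<bar> \<partial>LU)" by (rule integral_nonneg_AE) auto
  have split: "ennreal (1 / \<alpha> * l2 LU ?g * (l2 LU (\<lambda>x. B x - B' x) + ?N * lp p (\<lambda>x. c x - c' x))
        + (?m * C1) * l2 LU H + 1 / \<alpha> * (\<integral>x. \<bar>f x - f' x\<bar> \<partial>LU) + (?m * C1) * l2 LU (\<lambda>x. F x - F' x))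
     = ennreal (1 / \<alpha>) * ennreal (l2 LU ?g) * (ennreal (l2 LU (\<lambda>x. B x - B' x)) + ennreal ?N * ennreal (lp p (\<lambda>x. c x - c' x)))
        + ennreal (?m * C1) * ennreal (l2 LU H) + ennreal (1 / \<alpha>) * ennreal (\<integral>x. \<bar>f x - f' x\<bar> \<partial>LU)
        + ennreal (?m * C1) * ennreal (l2 LU (\<lambda>x. F x - F' x))"
    using \<alpha> N C10 nn by (simp only: ennreal_mult ennreal_plus mult_nonneg_nonneg add_nonneg_nonneg l2_nonneg lp_nonneg
        zero_le_divide_1_iff less_imp_le real_sqrt_ge_zero measure_nonneg)
  have m: "measure lebesgue U powr (1/2) = ?m" by (simp add: powr_half_sqrt)
  have "integrable LU w" by (rule sq_int_imp_integrable[OF su(2)])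
  then have lhs: "Lp_norm 1 U (\<lambda>x. u' x - u x) = ennreal (\<integral>x. \<bar>w x\<bar> \<partial>LU)"
    unfolding w_def by (rule Lp_norm_1(2))
  show ?thesis
    using main
    unfolding lhs m split H_def[symmetric] Lp_norm_1(2)[OF iff]
      Lp_norm_2(2)[OF sq_int_measurable[OF sg(1)] sg(1)] Lp_norm_2(2)[OF sq_int_measurable[OF iB] iB]
      Lp_norm_2(2)[OF sq_int_measurable[OF iF] iF] Lp_norm_2(2)[OF sq_int_measurable[OF iH] iH]
      Lp_norm_eq_lp(2)[OF less_trans[OF zero_less_one p1] icp] .
qed

text \<open>For f in L^p this is the energy estimate, as the Sobolev norm dominates the gradient.
  Otherwise the right side is infinite, because C_1 is positive.\<close>

lemma Lp_norm_weak_grad_le_energy: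
  assumes p: "lower_exponent CARD('d) p" and A: "assumption_A p lam U A B c \<alpha>" and C1: "energy_constant p lam U C1"
    and f: "in_Lp 1 U f" and F: "in_Lp 2 U F" and u: "weak_solution U A B c \<alpha> f F u"
  shows "Lp_norm 2 U (weak_grad U u) \<le> ennreal C1 * (Lp_norm p U f + Lp_norm 2 U F)"
proof (cases "Lp_norm p U f = \<infinity>")
  case True
  moreover have "C1 > 0" using C1 by (simp add: energy_constant_def)
  ultimately show ?thesis by (simp add: ennreal_mult_top)
next
  case False
  then have "in_Lp p U f" using f by (simp add: in_Lp_def less_top)
  then have H: "H12_norm U u \<le> ennreal C1 * (Lp_norm p U f + Lp_norm 2 U F)"
    using C1 A F u unfolding energy_constant_def by blast
  have g: "sq_int LU (weak_grad U u)"
    using weak_solution_D(1)[OF u] by (auto simp: H12_0_def H12_def in_Lp_2_iff)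
  have "l2 LU (weak_grad U u) \<le> sqrt ((l2 LU u)\<^sup>2 + (l2 LU (weak_grad U u))\<^sup>2)" by (rule real_le_rsqrt) simp
  then have "ennreal (l2 LU (weak_grad U u)) \<le> H12_norm U u"
    unfolding H12_norm_H12_0[OF weak_solution_D(1)[OF u]] by (rule ennreal_leI)
  then show ?thesis using H Lp_norm_2(2)[OF sq_int_measurable[OF g] g] by simp
qed

lemma Lp_norm_minus_commute:
  fixes f h :: "real^'d \<Rightarrow> 'b::real_normed_vector"
  shows "Lp_norm p U (\<lambda>x. f x - h x) = Lp_norm p U (\<lambda>x. h x - f x)"
  by (simp add: Lp_norm_def norm_minus_commute)

text \<open>Entries that converge only almost everywhere need not converge in the essential supremum
  norm. The fixed function \<open>g\<close> makes dominated convergence possible, with majorant a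
  multiple of |g|^2; hence it matters that the gradient in the estimate is that of \<open>u\<close>
  and not of u_n.\<close>

lemma tendsto_Lp_norm_matrix:
  fixes An :: "nat \<Rightarrow> real^'d \<Rightarrow> real^'d^'d"
  assumes A: "\<And>i j. in_Linf U (\<lambda>x. A x $ i $ j)" "\<And>x i j. x \<in> U \<Longrightarrow> \<bar>A x $ i $ j\<bar> \<le> Lam"
    and An: "\<And>n i j. in_Linf U (\<lambda>x. An n x $ i $ j)" "\<And>n i j. Linf_norm U (\<lambda>x. An n x $ i $ j) \<le> ennreal M" "0 \<le> M"
    and lim: "\<And>i j. AE x in LU. (\<lambda>n. An n x $ i $ j) \<longlonglongrightarrow> A x $ i $ j"
    and g: "sq_int LU g"
  shows "(\<lambda>n. Lp_norm 2 U (\<lambda>x. (An n x - A x) *v g x)) \<longlonglongrightarrow> 0"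
proof -
  let ?H = "\<lambda>n x. (An n x - A x) *v g x"
  have sH: "sq_int LU (?H n)" for n
    using sq_int_diff[OF sq_int_matrix_vector[OF An(1)[of n] g] sq_int_matrix_vector[OF A(1) g]]
    by (simp add: matrix_vector_mult_diff_rdistrib)
  define K where "K = real CARD('d) * (real CARD('d) * (M + Lam))"
  have bnd: "AE x in LU. \<forall>n. \<forall>i. \<forall>j. \<bar>An n x $ i $ j\<bar> \<le> M"
    unfolding AE_all_countable using An by (auto intro!: in_Linf_AE_le simp: in_Linf_def)
  have lim': "AE x in LU. \<forall>i. \<forall>j. (\<lambda>n. An n x $ i $ j) \<longlonglongrightarrow> A x $ i $ j"
    unfolding AE_all_countable using lim by blast
  have "(\<lambda>n. \<integral>x. (norm (?H n x))\<^sup>2 \<partial>LU) \<longlonglongrightarrow> (\<integral>x. 0 \<partial>LU)"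
  proof (rule integral_dominated_convergence[where w = "\<lambda>x. K\<^sup>2 * (norm (g x))\<^sup>2"])
    show "integrable LU (\<lambda>x. K\<^sup>2 * (norm (g x))\<^sup>2)" using sq_int_integrable[OF g] by simp
    show "(\<lambda>x. (norm (?H n x))\<^sup>2) \<in> borel_measurable LU" for n
      using sq_int_integrable[OF sH[of n]] by simp
    show "AE x in LU. (\<lambda>n. (norm (?H n x))\<^sup>2) \<longlonglongrightarrow> 0"
      using lim'
    proof eventually_elim
      fix x assume *: "\<forall>i. \<forall>j. (\<lambda>n. An n x $ i $ j) \<longlonglongrightarrow> A x $ i $ j"
      have "(\<lambda>n. ?H n x) \<longlonglongrightarrow> 0"
      proof (rule vec_tendstoI)
        fix i
        have "(\<lambda>n. \<Sum>j\<in>UNIV. (An n x $ i $ j - A x $ i $ j) * g x $ j) \<longlonglongrightarrow> (\<Sum>j\<in>UNIV. (A x $ i $ j - A x $ i $ j) * g x $ j)"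
          by (intro tendsto_sum tendsto_mult tendsto_diff tendsto_const *[rule_format])
        then show "(\<lambda>n. ?H n x $ i) \<longlonglongrightarrow> 0 $ i" by (simp add: matrix_vector_mult_def)
      qed
      then have "(\<lambda>n. (norm (?H n x))\<^sup>2) \<longlonglongrightarrow> (norm (0 :: real^'d))\<^sup>2" by (intro tendsto_intros)
      then show "(\<lambda>n. (norm (?H n x))\<^sup>2) \<longlonglongrightarrow> 0" by simp
    qed
    show "AE x in LU. norm ((norm (?H n x))\<^sup>2) \<le> K\<^sup>2 * (norm (g x))\<^sup>2" for n
      using bnd AE_space
    proof eventually_elim
      fix x assume *: "\<forall>n. \<forall>i. \<forall>j. \<bar>An n x $ i $ j\<bar> \<le> M" and x: "x \<in> space LU"
      have "norm (?H n x) \<le> real CARD('d) * (real CARD('d) * ((M + Lam) * norm (g x)))"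
      proof (rule norm_matrix_vector_le)
        fix i j
        have "\<bar>An n x $ i $ j\<bar> \<le> M" "\<bar>A x $ i $ j\<bar> \<le> Lam" using * A(2) x by auto
        then show "\<bar>(An n x - A x) $ i $ j\<bar> \<le> M + Lam" by simp
      qed
      then have "norm (?H n x) \<le> K * norm (g x)" by (simp add: K_def mult.assoc)
      then have "(norm (?H n x))\<^sup>2 \<le> (K * norm (g x))\<^sup>2" by (rule power_mono) simp
      then show "norm ((norm (?H n x))\<^sup>2) \<le> K\<^sup>2 * (norm (g x))\<^sup>2" by (simp add: power_mult_distrib)
    qed
  qed simp
  then have "(\<lambda>n. ennreal (sqrt (\<integral>x. (norm (?H n x))\<^sup>2 \<partial>LU))) \<longlonglongrightarrow> ennreal (sqrt 0)"
    by (intro tendsto_intros) simp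
  then show ?thesis
    by (simp add: Lp_norm_2(2)[OF sq_int_measurable[OF sH] sH] l2_def)
qed

end

text \<open>The estimate is claimed for every energy constant; the first conjunct ensures that this
  is not void. The conditions on the divergence of \<open>Bn\<close> and the sign of
  \<open>cn\<close> make the drift and zero order terms nonnegative when the equation of the
  difference is tested.\<close>

theorem corollary1p2:
  fixes U :: "(real^'d::finite) set"
    and A :: "real^'d \<Rightarrow> real^'d^'d" and B F :: "real^'d \<Rightarrow> real^'d" and c f u :: "real^'d \<Rightarrow> real"
    and An :: "nat \<Rightarrow> real^'d \<Rightarrow> real^'d^'d" and Bn Fn :: "nat \<Rightarrow> real^'d \<Rightarrow> real^'d"
    and cn fn un :: "nat \<Rightarrow> real^'d \<Rightarrow> real"
    and p lam \<alpha> :: real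
  assumes "lower_exponent CARD('d) p"
    and "assumption_A p lam U A B c \<alpha>" and "\<alpha> > 0"
    and "in_Lp 1 U f" and "in_Lp 2 U F"
    and "\<And>n i j. n \<ge> 1 \<Longrightarrow> in_Linf U (\<lambda>x. An n x $ i $ j)"
    and "\<And>n. n \<ge> 1 \<Longrightarrow> elliptic lam U (An n)"
    and "\<And>n. n \<ge> 1 \<Longrightarrow> in_Lp 2 U (Bn n)"
    and "\<And>n. n \<ge> 1 \<Longrightarrow> weak_div_nonpos U (Bn n)"
    and "\<And>n. n \<ge> 1 \<Longrightarrow> in_Lp p U (cn n)"
    and "\<And>n. n \<ge> 1 \<Longrightarrow> AE x in lebesgue_on U. cn n x \<ge> 0"
    and "\<And>n. n \<ge> 1 \<Longrightarrow> in_Lp 1 U (fn n)"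
    and "\<And>n. n \<ge> 1 \<Longrightarrow> in_Lp 2 U (Fn n)"
    and "\<And>n. n \<ge> 1 \<Longrightarrow> weak_solution U (An n) (Bn n) (cn n) \<alpha> (fn n) (Fn n) (un n)"
    and "weak_solution U A B c \<alpha> f F u"
  shows "(\<exists>C1. energy_constant p lam U C1) \<and>
    (\<forall>C1. energy_constant p lam U C1 \<longrightarrow>
      (let C4 = ennreal C1 * (Lp_norm p U f + Lp_norm 2 U F);
           C3 = ennreal (measure lebesgue U powr (1/2) * C1);
           N = ennreal (N_const CARD('d) p (measure lebesgue U))
       in \<forall>n\<ge>1. Lp_norm 1 U (\<lambda>x. un n x - u x)
            \<le> ennreal (1 / \<alpha>) * C4 * (Lp_norm 2 U (\<lambda>x. B x - Bn n x)
                                      + N * Lp_norm p U (\<lambda>x. c x - cn n x))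
              + C3 * Lp_norm 2 U (\<lambda>x. (An n x - A x) *v weak_grad U u x)
              + ennreal (1 / \<alpha>) * Lp_norm 1 U (\<lambda>x. f x - fn n x)
              + C3 * Lp_norm 2 U (\<lambda>x. F x - Fn n x))) \<and>
    ((\<exists>M>0. \<forall>n\<ge>1. \<forall>i j. Linf_norm U (\<lambda>x. An n x $ i $ j) \<le> ennreal M) \<and>
     (\<forall>i j. AE x in lebesgue_on U. (\<lambda>n. An n x $ i $ j) \<longlonglongrightarrow> A x $ i $ j) \<and>
     (\<lambda>n. Lp_norm 2 U (\<lambda>x. Bn n x - B x)) \<longlonglongrightarrow> 0 \<and>
     (\<lambda>n. Lp_norm 2 U (\<lambda>x. Fn n x - F x)) \<longlonglongrightarrow> 0 \<and>
     (\<lambda>n. Lp_norm p U (\<lambda>x. cn n x - c x)) \<longlonglongrightarrow> 0 \<and>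
     (\<lambda>n. Lp_norm 1 U (\<lambda>x. fn n x - f x)) \<longlonglongrightarrow> 0
     \<longrightarrow> (\<lambda>n. Lp_norm 1 U (\<lambda>x. un n x - u x)) \<longlonglongrightarrow> 0)"
proof -
  note p = assms(1)
  have d: "CARD('d) \<ge> 2" and lam: "lam > 0" and Ai: "\<And>i j. in_Linf U (\<lambda>x. A x $ i $ j)"
    and B: "in_Lp 2 U B" and c: "in_Lp p U c" and oU: "open U" "bounded U"
    using assms(2) by (auto simp: assumption_A_def)
  obtain Lam where Lam: "\<And>x i j. x \<in> U \<Longrightarrow> \<bar>A x $ i $ j\<bar> \<le> Lam"
    using assms(2) unfolding assumption_A_def by blast
  interpret bounded_open U using oU by unfold_locales
  let ?N = "ennreal (N_const CARD('d) p (measure lebesgue U))" and ?g = "weak_grad U u"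
  have ex: "\<exists>C1. energy_constant p lam U C1" by (rule energy_constant_exists[OF p lam d])
  have est: "Lp_norm 1 U (\<lambda>x. un n x - u x)
      \<le> ennreal (1 / \<alpha>) * Lp_norm 2 U ?g * (Lp_norm 2 U (\<lambda>x. B x - Bn n x) + ?N * Lp_norm p U (\<lambda>x. c x - cn n x))
        + ennreal (measure lebesgue U powr (1/2) * C1) * Lp_norm 2 U (\<lambda>x. (An n x - A x) *v ?g x)
        + ennreal (1 / \<alpha>) * Lp_norm 1 U (\<lambda>x. f x - fn n x)
        + ennreal (measure lebesgue U powr (1/2) * C1) * Lp_norm 2 U (\<lambda>x. F x - Fn n x)"
    if "energy_constant p lam U C1" "n \<ge> 1" for C1 n
    by (rule L1_difference_estimate[OF p d lam assms(3) that(1) Ai B c assms(4,5,15) assms(6-14)[OF that(2)]])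
  have "Lp_norm 1 U (\<lambda>x. un n x - u x)
      \<le> ennreal (1 / \<alpha>) * (ennreal C1 * (Lp_norm p U f + Lp_norm 2 U F))
          * (Lp_norm 2 U (\<lambda>x. B x - Bn n x) + ?N * Lp_norm p U (\<lambda>x. c x - cn n x))
        + ennreal (measure lebesgue U powr (1/2) * C1) * Lp_norm 2 U (\<lambda>x. (An n x - A x) *v ?g x)
        + ennreal (1 / \<alpha>) * Lp_norm 1 U (\<lambda>x. f x - fn n x)
        + ennreal (measure lebesgue U powr (1/2) * C1) * Lp_norm 2 U (\<lambda>x. F x - Fn n x)"
    if C1: "energy_constant p lam U C1" and n: "n \<ge> 1" for C1 n
    by (intro order_trans[OF est[OF C1 n]] add_right_mono mult_right_mono mult_left_mono
        Lp_norm_weak_grad_le_energy[OF p assms(2) C1 assms(4,5,15)]) auto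
  moreover have "(\<lambda>n. Lp_norm 1 U (\<lambda>x. un n x - u x)) \<longlonglongrightarrow> 0"
    if M: "\<exists>M>0. \<forall>n\<ge>1. \<forall>i j. Linf_norm U (\<lambda>x. An n x $ i $ j) \<le> ennreal M"
      and limA: "\<forall>i j. AE x in lebesgue_on U. (\<lambda>n. An n x $ i $ j) \<longlonglongrightarrow> A x $ i $ j"
      and limB: "(\<lambda>n. Lp_norm 2 U (\<lambda>x. Bn n x - B x)) \<longlonglongrightarrow> 0"
      and limF: "(\<lambda>n. Lp_norm 2 U (\<lambda>x. Fn n x - F x)) \<longlonglongrightarrow> 0"
      and limc: "(\<lambda>n. Lp_norm p U (\<lambda>x. cn n x - c x)) \<longlonglongrightarrow> 0"
      and limf: "(\<lambda>n. Lp_norm 1 U (\<lambda>x. fn n x - f x)) \<longlonglongrightarrow> 0"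
  proof -
    obtain C1 where C1: "energy_constant p lam U C1" using ex by blast
    obtain M where M: "M > 0" "\<And>n i j. n \<ge> 1 \<Longrightarrow> Linf_norm U (\<lambda>x. An n x $ i $ j) \<le> ennreal M"
      using M by blast
    have g: "sq_int LU ?g"
      using weak_solution_D(1)[OF assms(15)] by (auto simp: H12_0_def H12_def in_Lp_2_iff)
    \<comment> \<open>In \<open>ennreal\<close>, a constant factor preserves a limit 0 only if it is
      finite.\<close>
    have gfin: "Lp_norm 2 U ?g < top" using Lp_norm_2(2)[OF sq_int_measurable[OF g] g] by simp
    \<comment> \<open>The hypotheses on \<open>An\<close> start at n = 1, while the convergence
      lemma wants them for all indices; the shift is undone right after.\<close>
    have "(\<lambda>n. Lp_norm 2 U (\<lambda>x. (An (Suc n) x - A x) *v ?g x)) \<longlonglongrightarrow> 0"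
    proof (rule tendsto_Lp_norm_matrix[OF Ai Lam _ _ less_imp_le[OF M(1)] _ g])
      show "in_Linf U (\<lambda>x. An (Suc n) x $ i $ j)" for n i j using assms(6) by simp
      show "Linf_norm U (\<lambda>x. An (Suc n) x $ i $ j) \<le> ennreal M" for n i j using M(2) by simp
      show "AE x in LU. (\<lambda>n. An (Suc n) x $ i $ j) \<longlonglongrightarrow> A x $ i $ j" for i j
        using limA[rule_format, of i j] by eventually_elim (rule LIMSEQ_Suc)
    qed
    then have limH: "(\<lambda>n. Lp_norm 2 U (\<lambda>x. (An n x - A x) *v ?g x)) \<longlonglongrightarrow> 0"
      by (rule filterlim_sequentially_Suc[THEN iffD1])
    define C3 where "C3 = ennreal (measure lebesgue U powr (1/2) * C1)"
    have lims: "(\<lambda>n. ennreal (1 / \<alpha>) * Lp_norm 2 U ?g * (Lp_norm 2 U (\<lambda>x. Bn n x - B x) + ?N * Lp_norm p U (\<lambda>x. cn n x - c x))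
        + C3 * Lp_norm 2 U (\<lambda>x. (An n x - A x) *v ?g x)
        + ennreal (1 / \<alpha>) * Lp_norm 1 U (\<lambda>x. fn n x - f x)
        + C3 * Lp_norm 2 U (\<lambda>x. Fn n x - F x))
      \<longlonglongrightarrow> ennreal (1 / \<alpha>) * Lp_norm 2 U ?g * (0 + ?N * 0) + C3 * 0 + ennreal (1 / \<alpha>) * 0 + C3 * 0"
      using gfin by (intro tendsto_add ennreal_tendsto_cmult limB limc limH limf limF)
        (auto simp: C3_def ennreal_mult_less_top)
    show ?thesis
    proof (rule tendsto_sandwich[OF _ _ tendsto_const])
      show "\<forall>\<^sub>F n in sequentially. Lp_norm 1 U (\<lambda>x. un n x - u x)
        \<le> ennreal (1 / \<alpha>) * Lp_norm 2 U ?g * (Lp_norm 2 U (\<lambda>x. Bn n x - B x) + ?N * Lp_norm p U (\<lambda>x. cn n x - c x))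
        + C3 * Lp_norm 2 U (\<lambda>x. (An n x - A x) *v ?g x)
        + ennreal (1 / \<alpha>) * Lp_norm 1 U (\<lambda>x. fn n x - f x)
        + C3 * Lp_norm 2 U (\<lambda>x. Fn n x - F x)"
        using est[OF C1]
        unfolding C3_def Lp_norm_minus_commute[of _ B] Lp_norm_minus_commute[of _ c] Lp_norm_minus_commute[of _ f]
          Lp_norm_minus_commute[of _ F]
        by (intro eventually_sequentiallyI[of 1])
      show "(\<lambda>n. ennreal (1 / \<alpha>) * Lp_norm 2 U ?g * (Lp_norm 2 U (\<lambda>x. Bn n x - B x) + ?N * Lp_norm p U (\<lambda>x. cn n x - c x))
        + C3 * Lp_norm 2 U (\<lambda>x. (An n x - A x) *v ?g x)
        + ennreal (1 / \<alpha>) * Lp_norm 1 U (\<lambda>x. fn n x - f x)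
        + C3 * Lp_norm 2 U (\<lambda>x. Fn n x - F x)) \<longlonglongrightarrow> 0"
        using lims by simp
    qed simp
  qed
  ultimately show ?thesis using ex unfolding Let_def by blast
qed

end
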